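(* Let $(R,\mathfrak m)$ be a complete (Noetherian, commutative) local ring of positive dimension, with an algebraically closed coefficient field $K$ of positive characteristic $p$. Then the number of connected components of the punctured spectrum $\operatorname{Spec} R\setminus\{\mathfrak m\}$ (with the Zariski topology) is $$1+\dim_K \bigcap_{e\in\mathbb N}F^e\bigl(H^1_\mathfrak m(R)\bigr),$$ where $F$ denotes the Frobenius action on $H^1_\mathfrak m(R)$.
   Context: A coefficient field of a local ring $(R,\mathfrak m)$ is a subfield $K\subseteq R$ such that $K\to R\to R/\mathfrak m$ is an isomorphism. The Frobenius action $F$ on $H^i_\mathfrak m(R)$ is the additive map induced on local cohomology by the Frobenius homomorphism $r\mapsto r^p$ of $R$ (using $H^i_{\mathfrak m^{[p]}}(R)=H^i_\mathfrak m(R)$); it satisfies $F(r\eta)=r^pF(\eta)$. Since $K$ is perfect, each $F^e(H^1_\mathfrak m(R))$ is a $K$-vector space, so the intersection is a $K$-vector space. *)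

theory Defs
  imports "HOL-Analysis.Analysis"
begin

definition is_ideal :: "'a::comm_ring_1 set \<Rightarrow> bool" where
  "is_ideal I \<longleftrightarrow> 0 \<in> I \<and> (\<forall>x\<in>I. \<forall>y\<in>I. x + y \<in> I) \<and> (\<forall>r. \<forall>x\<in>I. r * x \<in> I)"

definition prime_ideal :: "'a::comm_ring_1 set \<Rightarrow> bool" where
  "prime_ideal P \<longleftrightarrow> is_ideal P \<and> P \<noteq> UNIV \<and> (\<forall>x y. x * y \<in> P \<longrightarrow> x \<in> P \<or> y \<in> P)"

definition ideal_gen :: "'a::comm_ring_1 list \<Rightarrow> 'a set" where
  "ideal_gen xs = {(\<Sum>i<length xs. rs i * xs ! i) | rs. True}"

definition noetherian_ring :: "'a::comm_ring_1 itself \<Rightarrow> bool" where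
  "noetherian_ring _ \<longleftrightarrow> (\<forall>I::'a set. is_ideal I \<longrightarrow> (\<exists>xs. I = ideal_gen xs))"

definition local_ring :: "'a::comm_ring_1 set \<Rightarrow> bool" where
  "local_ring m \<longleftrightarrow> is_ideal m \<and> m \<noteq> UNIV \<and> (\<forall>x. x \<notin> m \<longrightarrow> x dvd 1)"

definition ideal_span :: "'a::comm_ring_1 set \<Rightarrow> 'a set" where
  "ideal_span S = \<Inter>{I. is_ideal I \<and> S \<subseteq> I}"

fun ideal_pow :: "'a::comm_ring_1 set \<Rightarrow> nat \<Rightarrow> 'a set" where
  "ideal_pow I 0 = UNIV"
| "ideal_pow I (Suc n) = ideal_span {x * y | x y. x \<in> ideal_pow I n \<and> y \<in> I}"

definition positive_dim :: "'a::comm_ring_1 itself \<Rightarrow> bool" where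
  "positive_dim _ \<longleftrightarrow> (\<exists>P Q :: 'a set. prime_ideal P \<and> prime_ideal Q \<and> P \<subset> Q)"

definition madic_complete :: "'a::comm_ring_1 set \<Rightarrow> bool" where
  "madic_complete m \<longleftrightarrow>
     (\<forall>a :: nat \<Rightarrow> 'a. (\<forall>n. a (Suc n) - a n \<in> ideal_pow m n) \<longrightarrow>
        (\<exists>l. \<forall>n. l - a n \<in> ideal_pow m n))"

definition coefficient_field :: "'a::comm_ring_1 set \<Rightarrow> 'a set \<Rightarrow> bool" where
  "coefficient_field m K \<longleftrightarrow>
     0 \<in> K \<and> 1 \<in> K \<and> (\<forall>x\<in>K. \<forall>y\<in>K. x + y \<in> K \<and> x - y \<in> K \<and> x * y \<in> K) \<and>
     (\<forall>x\<in>K. x \<noteq> 0 \<longrightarrow> (\<exists>y\<in>K. x * y = 1)) \<and>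
     (\<forall>r. \<exists>!k. k \<in> K \<and> r - k \<in> m)"

definition alg_closed_subfield :: "'a::comm_ring_1 set \<Rightarrow> bool" where
  "alg_closed_subfield K \<longleftrightarrow>
     (\<forall>cs. set cs \<subseteq> K \<and> length cs \<ge> 1 \<longrightarrow>
        (\<exists>x\<in>K. x ^ length cs + (\<Sum>i<length cs. cs ! i * x ^ i) = 0))"

definition punctured_spec :: "'a::comm_ring_1 set \<Rightarrow> 'a set set" where
  "punctured_spec m = {P. prime_ideal P \<and> P \<noteq> m}"

definition zariski_punctured :: "'a::comm_ring_1 set \<Rightarrow> 'a set topology" where
  "zariski_punctured m = topology (\<lambda>U. \<exists>S. U = punctured_spec m - {P. S \<subseteq> P})"

section \<open>H^1_m(R) via the Cech complex on generators xs of m, and Frobenius\<close>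

text \<open>A Cech 1-cochain is represented by (r, N): the family (r i / x_i^N)_i in prod R_{x_i}.
  It is a cocycle iff r i / x_i^N = r j / x_j^N in R_{x_i x_j} for all i, j.\<close>
definition cech_cocycle :: "'a::comm_ring_1 list \<Rightarrow> (nat \<Rightarrow> 'a) \<times> nat \<Rightarrow> bool" where
  "cech_cocycle xs c \<longleftrightarrow> (case c of (r, N) \<Rightarrow>
     (\<forall>i<length xs. \<forall>j<length xs. \<exists>t.
        (xs ! i * xs ! j) ^ t * (r i * (xs ! j) ^ N - r j * (xs ! i) ^ N) = 0))"

text \<open>Two cocycles define the same class of H^1 iff their difference is the image of some s in R\<close>
definition cech_equiv :: "'a::comm_ring_1 list \<Rightarrow> (nat \<Rightarrow> 'a) \<times> nat \<Rightarrow> (nat \<Rightarrow> 'a) \<times> nat \<Rightarrow> bool" where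
  "cech_equiv xs c d \<longleftrightarrow> (case c of (r, N) \<Rightarrow> case d of (q, M) \<Rightarrow>
     (\<exists>s. \<forall>i<length xs. \<exists>t.
        (xs ! i) ^ t * (r i * (xs ! i) ^ M - q i * (xs ! i) ^ N - s * (xs ! i) ^ (N + M)) = 0))"

definition cech_frob :: "nat \<Rightarrow> nat \<Rightarrow> (nat \<Rightarrow> 'a::comm_ring_1) \<times> nat \<Rightarrow> (nat \<Rightarrow> 'a) \<times> nat" where
  "cech_frob p e c = (case c of (r, N) \<Rightarrow> (\<lambda>i. r i ^ (p ^ e), p ^ e * N))"

definition cech_add :: "'a::comm_ring_1 list \<Rightarrow> (nat \<Rightarrow> 'a) \<times> nat \<Rightarrow> (nat \<Rightarrow> 'a) \<times> nat \<Rightarrow> (nat \<Rightarrow> 'a) \<times> nat" where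
  "cech_add xs c d = (case c of (r, N) \<Rightarrow> case d of (q, M) \<Rightarrow>
     (\<lambda>i. r i * (xs ! i) ^ M + q i * (xs ! i) ^ N, N + M))"

definition cech_smult :: "'a::comm_ring_1 \<Rightarrow> (nat \<Rightarrow> 'a) \<times> nat \<Rightarrow> (nat \<Rightarrow> 'a) \<times> nat" where
  "cech_smult k c = (case c of (r, N) \<Rightarrow> (\<lambda>i. k * r i, N))"

definition cech_zero :: "(nat \<Rightarrow> 'a::comm_ring_1) \<times> nat" where
  "cech_zero = (\<lambda>i. 0, 0)"

fun cech_lincomb :: "'a::comm_ring_1 list \<Rightarrow> 'a list \<Rightarrow> ((nat \<Rightarrow> 'a) \<times> nat) list \<Rightarrow> (nat \<Rightarrow> 'a) \<times> nat" where
  "cech_lincomb xs (k # ks) (b # bs) = cech_add xs (cech_smult k b) (cech_lincomb xs ks bs)"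
| "cech_lincomb xs _ _ = cech_zero"

definition frob_stable_part :: "'a::comm_ring_1 list \<Rightarrow> nat \<Rightarrow> ((nat \<Rightarrow> 'a) \<times> nat) set" where
  "frob_stable_part xs p = {c. cech_cocycle xs c \<and>
     (\<forall>e. \<exists>c'. cech_cocycle xs c' \<and> cech_equiv xs (cech_frob p e c') c)}"

definition cech_dim_eq :: "'a::comm_ring_1 list \<Rightarrow> 'a set \<Rightarrow> ((nat \<Rightarrow> 'a) \<times> nat) set \<Rightarrow> nat \<Rightarrow> bool" where
  "cech_dim_eq xs K V n \<longleftrightarrow> (\<exists>bs. length bs = n \<and> set bs \<subseteq> V \<and>
     (\<forall>ks. length ks = n \<and> set ks \<subseteq> K \<and> cech_equiv xs (cech_lincomb xs ks bs) cech_zero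
          \<longrightarrow> (\<forall>k\<in>set ks. k = 0)) \<and>
     (\<forall>c\<in>V. \<exists>ks. length ks = n \<and> set ks \<subseteq> K \<and> cech_equiv xs c (cech_lincomb xs ks bs)))"

end

theory Submission
  imports Defs
begin

text \<open>
  Let \<open>S\<close> be the ring of sections over the punctured spectrum and \<open>R'\<close> the image of \<open>R\<close> in it, so that
  \<open>H\<^sup>1 = S / R'\<close> and Frobenius on \<open>H\<^sup>1\<close> is induced by the \<open>p\<close>-th power map of \<open>S\<close>. Decompositions of the
  punctured spectrum into open pieces correspond to idempotents of \<open>S\<close>, so the components correspond
  to the primitive idempotents. Their classes are Frobenius-fixed and span a space of
  dimension one less than their number, the only relation being that their sum \<open>1\<close> lies in \<open>R'\<close>.

  It remains to see that they span the stable part. The submodule of Frobenius-nilpotent classes is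
  killed by one power of Frobenius: its preimage \<open>T\<close> in \<open>S\<close> satisfies \<open>T = \<Sum> R t\<^sub>i + \<mm>T\<close> because
  \<open>H\<^sup>1\<close> is Artinian, hence \<open>T = \<Sum> R t\<^sub>i + \<Inter>\<^sub>k \<mm>\<^sup>k T\<close> by completeness, and the intersection consists of
  nilpotent elements by Krull's principal ideal theorem. Frobenius contracts annihilators backwards,
  so the roots \<open>F\<^sup>-\<^sup>e(c)\<close> of a stable class \<open>c\<close> eventually lie in a finite-dimensional space, which yields
  a relation \<open>\<Sum> a\<^sub>i F\<^sup>i(c) = 0\<close>. Factoring it into terms \<open>F - \<alpha>\<close> over the algebraically closed field \<open>K\<close>
  writes \<open>c\<close> as a combination of fixed classes. By Artin--Schreier in the complete ring \<open>R\<close> a fixed class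
  has a representative with \<open>\<sigma>\<^sup>p = \<sigma>\<close>, and such a \<open>\<sigma>\<close> is constant on each primitive idempotent.
\<close>

section \<open>Ideals in Noetherian rings\<close>

text \<open>Classes of H^1 are handled through representatives in \<open>S\<close>, with equality
  modulo R', so no quotient module is formed. The main obstacle is that T is not known to be
  finitely generated: completeness only gives generators up to elements z lying in every m^k T. For
  such z, additivity of Frobenius turns depth k into order k p^e: z^(p^e) comes from m^(k p^e) for
  large e. Suppose y in R behaves like this and is not nilpotent. For a prime P maximal among the
  ideals without a power of y, every larger prime contains y, so Krull's theorem leaves R/P of
  dimension at most one and m^b lies in (y) + P for some b; taking k = b + 1 contradicts Nakayama's
  lemma. Roots t of c of high order have bounded denominators: if x^E c lies in R', then x t is
  Frobenius-nilpotent, and nilpotent classes die after a uniform power. Since F is p-linear,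
  dividing a twisted polynomial with coefficients a_i by F - \<alpha> leaves as remainder the sum of
  a_i \<alpha>^(1 + p + ... + p^(i-1)), an ordinary polynomial in \<alpha>, which has a root in
  K.\<close>

lemma ideal_zero: "is_ideal I \<Longrightarrow> 0 \<in> I"
  and ideal_add: "is_ideal I \<Longrightarrow> x \<in> I \<Longrightarrow> y \<in> I \<Longrightarrow> x + y \<in> I"
  and ideal_mult_left: "is_ideal I \<Longrightarrow> x \<in> I \<Longrightarrow> r * x \<in> I"
  by (auto simp: is_ideal_def)

lemma ideal_mult_right: "is_ideal I \<Longrightarrow> x \<in> I \<Longrightarrow> x * r \<in> I"
  using ideal_mult_left by (metis mult.commute)

lemma ideal_uminus: "is_ideal I \<Longrightarrow> x \<in> I \<Longrightarrow> - x \<in> I"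
  using ideal_mult_left[of I x "-1"] by simp

lemma ideal_diff: "is_ideal I \<Longrightarrow> x \<in> I \<Longrightarrow> y \<in> I \<Longrightarrow> x - y \<in> I"
  using ideal_add[of I x "- y"] ideal_uminus[of I y] by simp

lemma ideal_power: "is_ideal I \<Longrightarrow> x \<in> I \<Longrightarrow> n > 0 \<Longrightarrow> x ^ n \<in> I"
  by (cases n) (auto intro: ideal_mult_right)

lemma ideal_one_UNIV: "is_ideal I \<Longrightarrow> 1 \<in> I \<Longrightarrow> I = UNIV"
  using ideal_mult_left[of I 1] by auto

lemma prime_ideal_is_ideal: "prime_ideal P \<Longrightarrow> is_ideal P"
  by (simp add: prime_ideal_def)

lemma prime_ideal_one: "prime_ideal P \<Longrightarrow> 1 \<notin> P"
  using ideal_one_UNIV by (auto simp: prime_ideal_def)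

lemma prime_ideal_mult_iff: "prime_ideal P \<Longrightarrow> x * y \<in> P \<longleftrightarrow> x \<in> P \<or> y \<in> P"
  by (auto simp: prime_ideal_def intro: ideal_mult_left ideal_mult_right)

lemma prime_ideal_power_iff: "prime_ideal P \<Longrightarrow> x ^ n \<in> P \<longleftrightarrow> x \<in> P \<and> n > 0"
  by (induction n) (auto simp: prime_ideal_one prime_ideal_mult_iff)

lemma prime_ideal_prod_list:
  "prime_ideal P \<Longrightarrow> prod_list as \<in> P \<longleftrightarrow> (\<exists>a\<in>set as. a \<in> P)"
  by (induction as) (auto simp: prime_ideal_one prime_ideal_mult_iff)

lemma is_ideal_Inter: "(\<And>I. I \<in> F \<Longrightarrow> is_ideal I) \<Longrightarrow> is_ideal (\<Inter>F)"
  by (auto simp: is_ideal_def)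

definition ideal_insert :: "'a::comm_ring_1 \<Rightarrow> 'a set \<Rightarrow> 'a set" where
  "ideal_insert x I = {a + r * x | a r. a \<in> I}"

lemma is_ideal_ideal_insert: "is_ideal I \<Longrightarrow> is_ideal (ideal_insert x I)"
proof -
  assume I: "is_ideal I"
  have "\<exists>a r. 0 = a + r * x \<and> a \<in> I"
    using ideal_zero[OF I] by (intro exI[of _ 0]) auto
  moreover have "\<exists>c t. (a + r * x) + (b + s * x) = c + t * x \<and> c \<in> I" if "a \<in> I" "b \<in> I" for a b r s
    using that I by (rule_tac exI[of _ "a + b"], rule_tac exI[of _ "r + s"]) (simp add: algebra_simps ideal_add)
  moreover have "\<exists>c t. q * (a + r * x) = c + t * x \<and> c \<in> I" if "a \<in> I" for a r q
    using that I by (rule_tac exI[of _ "q * a"], rule_tac exI[of _ "q * r"]) (simp add: distrib_left mult.assoc ideal_mult_left)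
  ultimately show ?thesis
    unfolding is_ideal_def ideal_insert_def by blast
qed

lemma subset_ideal_insert: "I \<subseteq> ideal_insert x I"
proof
  fix a assume "a \<in> I"
  then have "a = a + 0 * x \<and> a \<in> I" by simp
  then show "a \<in> ideal_insert x I" unfolding ideal_insert_def by blast
qed

lemma self_mem_ideal_insert: "is_ideal I \<Longrightarrow> x \<in> ideal_insert x I"
proof -
  assume "is_ideal I"
  then have "x = 0 + 1 * x \<and> 0 \<in> I" by (simp add: ideal_zero)
  then show "x \<in> ideal_insert x I" unfolding ideal_insert_def by blast
qed

lemma ideal_insert_subset: "is_ideal J \<Longrightarrow> I \<subseteq> J \<Longrightarrow> x \<in> J \<Longrightarrow> ideal_insert x I \<subseteq> J"
  unfolding ideal_insert_def by (auto intro!: ideal_add ideal_mult_left)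

text \<open>If \<open>gs\<close> generates M and \<open>Q\<close> is an ideal, this is the submodule
  Q M. The map \<open>\<phi>\<close> lets one definition serve both ideals (\<open>icomb\<close>)
  and submodules of another ring.\<close>

primrec lcomb :: "('a \<Rightarrow> 'b::comm_ring_1) \<Rightarrow> 'a set \<Rightarrow> 'b list \<Rightarrow> 'b set" where
  "lcomb \<phi> Q [] = {0}"
| "lcomb \<phi> Q (g # gs) = {\<phi> q * g + y | q y. q \<in> Q \<and> y \<in> lcomb \<phi> Q gs}"

abbreviation "icomb \<equiv> lcomb (\<lambda>x. x)"

lemma ideal_gen_eq_icomb: "ideal_gen xs = icomb UNIV xs"
proof (induction xs)
  case Nil
  show ?case by (auto simp: ideal_gen_def)
next
  case (Cons x xs)
  have "ideal_gen (x # xs) = {q * x + y | q y. y \<in> ideal_gen xs}"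
  proof (intro set_eqI iffI)
    fix z assume "z \<in> ideal_gen (x # xs)"
    then obtain rs where "z = (\<Sum>i<length (x#xs). rs i * (x#xs) ! i)"
      by (auto simp: ideal_gen_def)
    then have "z = rs 0 * x + (\<Sum>i<length xs. (rs \<circ> Suc) i * xs ! i)"
      by (simp add: sum.lessThan_Suc_shift del: sum.lessThan_Suc)
    then show "z \<in> {q * x + y | q y. y \<in> ideal_gen xs}"
      unfolding ideal_gen_def by blast
  next
    fix z assume "z \<in> {q * x + y | q y. y \<in> ideal_gen xs}"
    then obtain q rs where "z = q * x + (\<Sum>i<length xs. rs i * xs ! i)"
      by (auto simp: ideal_gen_def)
    then have "z = (\<Sum>i<length (x#xs). (case_nat q rs) i * (x#xs) ! i)"
      by (simp add: sum.lessThan_Suc_shift del: sum.lessThan_Suc)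
    then show "z \<in> ideal_gen (x # xs)"
      unfolding ideal_gen_def by blast
  qed
  then show ?case using Cons by simp
qed

lemma lcomb_add:
  assumes "\<And>a b. \<phi> (a + b) = \<phi> a + \<phi> b" "is_ideal Q"
  shows "x \<in> lcomb \<phi> Q gs \<Longrightarrow> y \<in> lcomb \<phi> Q gs \<Longrightarrow> x + y \<in> lcomb \<phi> Q gs"
proof (induction gs arbitrary: x y)
  case (Cons g gs)
  from Cons.prems obtain q1 y1 q2 y2 where *: "x = \<phi> q1 * g + y1" "y = \<phi> q2 * g + y2"
    "q1 \<in> Q" "q2 \<in> Q" "y1 \<in> lcomb \<phi> Q gs" "y2 \<in> lcomb \<phi> Q gs" by auto
  have "x + y = \<phi> (q1 + q2) * g + (y1 + y2)"
    using * by (simp add: assms(1) algebra_simps)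
  then show ?case using Cons.IH[of y1 y2] * ideal_add[OF assms(2), of q1 q2]
    unfolding lcomb.simps by blast
qed auto

lemma lcomb_mult:
  assumes "\<And>a b. \<phi> (a * b) = \<phi> a * \<phi> b" "is_ideal Q"
  shows "x \<in> lcomb \<phi> Q gs \<Longrightarrow> \<phi> r * x \<in> lcomb \<phi> Q gs"
proof (induction gs arbitrary: x)
  case (Cons g gs)
  from Cons.prems obtain q1 y1 where *: "x = \<phi> q1 * g + y1" "q1 \<in> Q" "y1 \<in> lcomb \<phi> Q gs" by auto
  have "\<phi> r * x = \<phi> (r * q1) * g + \<phi> r * y1"
    using * by (simp add: assms(1) algebra_simps)
  then show ?case using Cons.IH[of y1] * ideal_mult_left[OF assms(2), of q1 r]
    unfolding lcomb.simps by blast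
qed auto

lemma lcomb_zero: fixes \<phi> :: "'a::zero \<Rightarrow> 'b::comm_ring_1" shows "\<phi> 0 = 0 \<Longrightarrow> 0 \<in> Q \<Longrightarrow> 0 \<in> lcomb \<phi> Q gs"
proof (induction gs)
  case (Cons g gs)
  then have "(0::'b) = \<phi> 0 * g + 0" by simp
  with Cons show ?case unfolding lcomb.simps by blast
qed auto

lemma lcomb_subset:
  assumes "0 \<in> A" "\<And>x y. x \<in> A \<Longrightarrow> y \<in> A \<Longrightarrow> x + y \<in> A"
    "\<And>q g. q \<in> Q \<Longrightarrow> g \<in> set gs \<Longrightarrow> \<phi> q * g \<in> A"
  shows "lcomb \<phi> Q gs \<subseteq> A"
  using assms(3) by (induction gs) (auto intro: assms(1,2))

lemma lcomb_mem:
  fixes \<phi> :: "'a::zero \<Rightarrow> 'b::comm_ring_1"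
  assumes "g \<in> set gs" "q \<in> Q" "\<phi> 0 = 0" "0 \<in> Q"
  shows "\<phi> q * g \<in> lcomb \<phi> Q gs"
  using assms(1)
proof (induction gs)
  case (Cons h gs)
  show ?case
  proof (cases "g = h")
    case True
    then show ?thesis using lcomb_zero[of \<phi> Q gs] assms by force
  next
    case False
    then have "\<phi> q * g \<in> lcomb \<phi> Q gs" using Cons by auto
    moreover have "\<phi> q * g = \<phi> 0 * h + \<phi> q * g" using assms by simp
    ultimately show ?thesis using assms unfolding lcomb.simps by blast
  qed
qed auto

lemma is_ideal_UNIV: "is_ideal UNIV"
  by (simp add: is_ideal_def)

lemma is_ideal_icomb: "is_ideal Q \<Longrightarrow> is_ideal (icomb Q gs)"
  unfolding is_ideal_def[of "icomb Q gs"]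
  using lcomb_zero[of "\<lambda>x. x" Q] lcomb_add[of "\<lambda>x. x" Q] lcomb_mult[of "\<lambda>x. x" Q] ideal_zero[of Q]
  by auto

lemma ideal_gen_mem: "x \<in> set xs \<Longrightarrow> x \<in> ideal_gen xs"
  using lcomb_mem[of x xs 1 UNIV "\<lambda>x. x"] by (simp add: ideal_gen_eq_icomb)

lemma ideal_gen_subset: "is_ideal I \<Longrightarrow> set xs \<subseteq> I \<Longrightarrow> ideal_gen xs \<subseteq> I"
  unfolding ideal_gen_eq_icomb
  by (rule lcomb_subset) (auto intro: ideal_zero ideal_add ideal_mult_left)

lemma noetherian_fg:
  assumes "noetherian_ring TYPE('a::comm_ring_1)" "is_ideal (I::'a set)"
  obtains gs where "I = icomb UNIV gs" "set gs \<subseteq> I"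
  using assms ideal_gen_mem unfolding noetherian_ring_def ideal_gen_eq_icomb
  by (metis subsetI)

text \<open>The union of a chain of ideals has finitely many generators, which already lie in one
  member, so the union belongs to the chain and bounds it for Zorn's lemma.\<close>

lemma noetherian_maximal:
  assumes noeth: "noetherian_ring TYPE('a::comm_ring_1)"
    and F: "\<And>I. I \<in> F \<Longrightarrow> is_ideal (I::'a set)" and "I0 \<in> F"
  obtains I where "I \<in> F" "I0 \<subseteq> I" "\<And>J. J \<in> F \<Longrightarrow> I \<subseteq> J \<Longrightarrow> J = I"
proof -
  let ?G = "{I \<in> F. I0 \<subseteq> I}"
  have "\<exists>M\<in>?G. \<forall>X\<in>?G. M \<subseteq> X \<longrightarrow> X = M"
  proof (rule subset_Zorn_nonempty)
    show "?G \<noteq> {}" using assms by auto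
  next
    fix C assume C: "C \<noteq> {}" "subset.chain ?G C"
    have lin: "X \<subseteq> Y \<or> Y \<subseteq> X" if "X \<in> C" "Y \<in> C" for X Y
      using C that by (auto simp: subset_chain_def)
    have CG: "C \<subseteq> ?G" using C by (auto simp: subset_chain_def)
    have Ci: "is_ideal X" if "X \<in> C" for X using CG F that by auto
    have "is_ideal (\<Union>C)"
      unfolding is_ideal_def
    proof (intro conjI ballI allI)
      show "0 \<in> \<Union>C" using C(1) Ci ideal_zero by blast
      fix x y r assume "x \<in> \<Union>C" "y \<in> \<Union>C"
      then obtain X Y where XY: "x \<in> X" "X \<in> C" "y \<in> Y" "Y \<in> C" by blast
      from lin[of X Y] XY have "x + y \<in> X \<or> x + y \<in> Y"
        using ideal_add[OF Ci] by blast
      then show "x + y \<in> \<Union>C" using XY by blast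
    next
      fix r x assume "x \<in> \<Union>C"
      then show "r * x \<in> \<Union>C" using ideal_mult_left[OF Ci] by blast
    qed
    then obtain gs where gs: "\<Union>C = ideal_gen gs"
      using noeth by (auto simp: noetherian_ring_def)
    have "finite (set gs)" "set gs \<subseteq> \<Union>C" using gs ideal_gen_mem by auto
    then obtain X where X: "X \<in> C" "set gs \<subseteq> X"
      using finite_subset_Union_chain[of "set gs" C ?G] C by auto
    have "ideal_gen gs \<subseteq> X" using X CG F by (intro ideal_gen_subset) auto
    then have "\<Union>C = X" using gs X by auto
    then show "\<Union>C \<in> ?G" using X CG by auto
  qed
  then show thesis using that by force
qed

text \<open>Nakayama's lemma after localizing at a prime \<open>Q\<close>: ideals of the localization are
  represented by ideals \<open>J\<close> saturated with respect to the complement of \<open>Q\<close>.\<close>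

lemma nakayama_saturated:
  fixes Q J :: "'a::comm_ring_1 set"
  assumes Q: "prime_ideal Q" and J: "is_ideal J"
    and sat: "\<And>s u. s \<notin> Q \<Longrightarrow> s * u \<in> J \<Longrightarrow> u \<in> J"
  shows "(\<And>g. g \<in> set gs \<Longrightarrow> \<exists>s j y. s \<notin> Q \<and> j \<in> J \<and> y \<in> icomb Q gs \<and> s * g = j + y)
    \<Longrightarrow> set gs \<subseteq> J"
proof (induction gs)
  case (Cons g gs)
  note Qi = prime_ideal_is_ideal[OF Q]
  note cl = is_ideal_icomb[OF Qi, of gs]
  obtain s j q y where s: "s \<notin> Q" "j \<in> J" "q \<in> Q" "y \<in> icomb Q gs" "s * g = j + (q * g + y)"
    using Cons.prems[of g] by auto
  \<comment> \<open>Moving q * g to the left keeps the coefficient of g outside Q. Substituting the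
    formula for (s - q) * g eliminates g from the relations of the other generators.\<close>
  have s': "s - q \<notin> Q" using s ideal_add[OF Qi, of "s - q" q] by auto
  have sg: "(s - q) * g = j + y" using s by (simp add: algebra_simps)
  have "set gs \<subseteq> J"
  proof (rule Cons.IH)
    fix h assume "h \<in> set gs"
    then obtain t k a z where t: "t \<notin> Q" "k \<in> J" "a \<in> Q" "z \<in> icomb Q gs" "t * h = k + (a * g + z)"
      using Cons.prems[of h] by auto
    have "((s - q) * t) * h = (s - q) * (k + (a * g + z))" using t by (simp add: mult.assoc)
    also have "\<dots> = (s - q) * k + a * ((s - q) * g) + (s - q) * z" by (simp add: algebra_simps)
    also have "\<dots> = ((s - q) * k + a * j) + (a * y + (s - q) * z)" unfolding sg by (simp add: algebra_simps)
    finally have "((s - q) * t) * h = ((s - q) * k + a * j) + (a * y + (s - q) * z)" .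
    moreover have "(s - q) * t \<notin> Q" using s' t Q by (simp add: prime_ideal_mult_iff)
    moreover have "(s - q) * k + a * j \<in> J" using t s J by (auto intro!: ideal_add ideal_mult_left)
    moreover have "a * y + (s - q) * z \<in> icomb Q gs" using t s cl by (intro ideal_add ideal_mult_left)
    ultimately show "\<exists>s j y. s \<notin> Q \<and> j \<in> J \<and> y \<in> icomb Q gs \<and> s * h = j + y" by blast
  qed
  moreover have "icomb Q gs \<subseteq> J"
    using calculation J by (intro lcomb_subset) (auto intro: ideal_zero ideal_add ideal_mult_left)
  ultimately have "(s - q) * g \<in> J" using s sg J by (auto intro: ideal_add)
  then have "g \<in> J" using sat s' by blast
  then show ?case using \<open>set gs \<subseteq> J\<close> by simp
qed auto

subsection \<open>Powers of ideals\<close>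

lemma is_ideal_ideal_span: "is_ideal (ideal_span S)"
  unfolding ideal_span_def by (rule is_ideal_Inter) auto

lemma ideal_span_superset: "S \<subseteq> ideal_span S"
  by (auto simp: ideal_span_def)

lemma ideal_span_minimal: "is_ideal I \<Longrightarrow> S \<subseteq> I \<Longrightarrow> ideal_span S \<subseteq> I"
  by (auto simp: ideal_span_def)

lemma is_ideal_ideal_pow: "is_ideal (ideal_pow I n)"
  by (cases n) (auto simp: is_ideal_UNIV is_ideal_ideal_span)

lemma ideal_pow_Suc_mem: "x \<in> ideal_pow I n \<Longrightarrow> y \<in> I \<Longrightarrow> x * y \<in> ideal_pow I (Suc n)"
  using ideal_span_superset[of "{x * y | x y. x \<in> ideal_pow I n \<and> y \<in> I}"] by auto

lemma ideal_pow_Suc_subset: "ideal_pow I (Suc n) \<subseteq> ideal_pow I n"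
  unfolding ideal_pow.simps(2)
  by (rule ideal_span_minimal[OF is_ideal_ideal_pow]) (auto simp: ideal_mult_right[OF is_ideal_ideal_pow])

lemma ideal_pow_antimono: "i \<le> j \<Longrightarrow> ideal_pow I j \<subseteq> ideal_pow I i"
  by (rule lift_Suc_antimono_le[of "ideal_pow I"]) (auto simp only: ideal_pow_Suc_subset)

lemma ideal_pow_mult:
  "a \<in> ideal_pow I i \<Longrightarrow> b \<in> ideal_pow I j \<Longrightarrow> a * b \<in> ideal_pow I (i + j)"
proof (induction j arbitrary: a b)
  case 0
  then show ?case by (simp add: ideal_mult_right[OF is_ideal_ideal_pow])
next
  case (Suc j)
  have "ideal_pow I (Suc j) \<subseteq> {b. a * b \<in> ideal_pow I (i + Suc j)}" (is "_ \<subseteq> ?J")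
    unfolding ideal_pow.simps(2)
  proof (rule ideal_span_minimal)
    have I: "is_ideal (ideal_pow I (Suc (i + j)))" by (rule is_ideal_ideal_pow)
    show "is_ideal ?J"
      unfolding is_ideal_def using I
      by (auto simp: distrib_left mult.left_commute[of a] simp del: ideal_pow.simps intro: ideal_zero ideal_add ideal_mult_left)
    show "{x * y |x y. x \<in> ideal_pow I j \<and> y \<in> I} \<subseteq> ?J"
      using Suc.IH[OF Suc.prems(1)] ideal_pow_Suc_mem[of _ I "i + j"]
      by (auto simp: mult.assoc[symmetric] simp del: ideal_pow.simps)
  qed
  then show ?case using Suc.prems by auto
qed

lemma ideal_pow_mono_mem: "x \<in> ideal_pow I j \<Longrightarrow> i \<le> j \<Longrightarrow> x \<in> ideal_pow I i"
  using ideal_pow_antimono by blast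

lemma ideal_pow_one: "is_ideal I \<Longrightarrow> ideal_pow I (Suc 0) = I"
proof
  assume I: "is_ideal I"
  show "ideal_pow I (Suc 0) \<subseteq> I"
    unfolding ideal_pow.simps(2)
    by (rule ideal_span_minimal[OF I]) (auto simp: ideal_mult_left[OF I])
  show "I \<subseteq> ideal_pow I (Suc 0)"
    using ideal_pow_Suc_mem[of 1 I 0] by auto
qed

lemma ideal_pow_power: "x \<in> ideal_pow I k \<Longrightarrow> x ^ n \<in> ideal_pow I (k * n)"
proof (induction n)
  case (Suc n)
  then show ?case using ideal_pow_mult[of x I k "x ^ n" "k * n"] by simp
qed auto

lemma ideal_power_mem_pow: "is_ideal I \<Longrightarrow> x \<in> I \<Longrightarrow> x ^ n \<in> ideal_pow I n"
  using ideal_pow_power[of x I "Suc 0" n] by (simp only: ideal_pow_one mult_Suc mult_0 add_0_right)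

lemma is_ideal_colon: "is_ideal J \<Longrightarrow> is_ideal {x. \<forall>y\<in>Y. x * y \<in> J}"
  unfolding is_ideal_def by (auto simp: distrib_right mult.assoc)

text \<open>Replacing \<open>J\<close> by the colon ideal (J : I) lowers \<open>j\<close> by one, so
  the induction runs over all \<open>J\<close>.\<close>

lemma ideal_pow_add_subset:
  assumes J: "is_ideal J" and prod: "\<And>a b. a \<in> ideal_pow I i \<Longrightarrow> b \<in> ideal_pow I j \<Longrightarrow> a * b \<in> J"
  shows "ideal_pow I (i + j) \<subseteq> J"
  using J prod
proof (induction j arbitrary: J)
  case 0
  show ?case using 0(2)[of _ 1] by auto
next
  case (Suc j)
  have "ideal_pow I (i + j) \<subseteq> {x. \<forall>y\<in>I. x * y \<in> J}"
  proof (rule Suc.IH[OF is_ideal_colon[OF Suc.prems(1)]])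
    fix a b assume ab: "a \<in> ideal_pow I i" "b \<in> ideal_pow I j"
    have "a * (b * y) \<in> J" if "y \<in> I" for y
      using Suc.prems(2)[OF ab(1)] ideal_pow_Suc_mem[OF ab(2) that] by blast
    then show "a * b \<in> {x. \<forall>y\<in>I. x * y \<in> J}" by (simp add: mult.assoc)
  qed
  then have "ideal_pow I (Suc (i + j)) \<subseteq> J"
    unfolding ideal_pow.simps(2) by (intro ideal_span_minimal Suc.prems(1)) blast
  then show ?case by simp
qed

subsection \<open>Prime ideals\<close>

text \<open>An ideal maximal among those missing all powers of \<open>y\<close> is prime. The last
  conclusion puts \<open>y\<close> into every prime strictly above P, which is the situation of
  Krull's theorem below.\<close>

lemma prime_ideal_avoiding_powers:
  assumes noeth: "noetherian_ring TYPE('a::comm_ring_1)"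
    and I: "is_ideal (I::'a set)" and avoid: "\<And>n. y ^ n \<notin> I"
  obtains P where "prime_ideal P" "I \<subseteq> P" "y \<notin> P"
    "\<And>J. is_ideal J \<Longrightarrow> P \<subset> J \<Longrightarrow> \<exists>n. y ^ n \<in> J"
proof -
  let ?F = "{J. is_ideal J \<and> (\<forall>n. y ^ n \<notin> J)}"
  obtain P where P: "P \<in> ?F" "I \<subseteq> P" and max: "\<And>J. J \<in> ?F \<Longrightarrow> P \<subseteq> J \<Longrightarrow> J = P"
    by (rule noetherian_maximal[OF noeth, of ?F I]) (use I avoid in auto)
  have Pi: "is_ideal P" and Pn: "\<And>n. y ^ n \<notin> P" using P by auto
  have up: "\<exists>n. y ^ n \<in> J" if "is_ideal J" "P \<subset> J" for J
    using max[of J] that by auto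
  have "prime_ideal P"
    unfolding prime_ideal_def
  proof (intro conjI Pi allI impI)
    show "P \<noteq> UNIV" using Pn by auto
    fix a b assume ab: "a * b \<in> P"
    show "a \<in> P \<or> b \<in> P"
    proof (rule ccontr)
      assume neg: "\<not> (a \<in> P \<or> b \<in> P)"
      have "P \<subset> ideal_insert a P" "P \<subset> ideal_insert b P"
        using neg self_mem_ideal_insert[OF Pi] subset_ideal_insert by blast+
      then obtain n1 n2 where "y ^ n1 \<in> ideal_insert a P" "y ^ n2 \<in> ideal_insert b P"
        using up is_ideal_ideal_insert[OF Pi] by meson
      then obtain p1 p2 r1 r2 where *: "y ^ n1 = p1 + r1 * a" "y ^ n2 = p2 + r2 * b" "p1 \<in> P" "p2 \<in> P"
        by (auto simp: ideal_insert_def)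
      have "y ^ (n1 + n2) = (p1 + r1 * a) * (p2 + r2 * b)"
        by (simp add: power_add *)
      also have "\<dots> = (p2 + r2 * b) * p1 + r1 * a * p2 + r1 * r2 * (a * b)" by (simp add: algebra_simps)
      also have "\<dots> \<in> P" using * ab Pi by (simp add: ideal_add ideal_mult_left)
      finally show False using Pn by blast
    qed
  qed
  moreover have "y \<notin> P" using Pn[of 1] by simp
  ultimately show thesis by (rule that[OF _ P(2) _ up])
qed

lemma nilpotent_if_in_all_primes:
  assumes "noetherian_ring TYPE('a::comm_ring_1)" "is_ideal (I::'a set)"
    "\<And>P. prime_ideal P \<Longrightarrow> I \<subseteq> P \<Longrightarrow> y \<in> P"
  shows "\<exists>n. y ^ n \<in> I"
  using prime_ideal_avoiding_powers[OF assms(1,2), of y] assms(3) by metis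

text \<open>Takes the place of the finiteness of the set of minimal primes. A maximal counterexample
  M is not prime, so a * b lies in M with neither factor in M; concatenating the lists for M + (a)
  and M + (b) gives one for M. Choosing one element from each prime avoids products of
  ideals.\<close>

lemma ideal_contains_prime_product:
  assumes noeth: "noetherian_ring TYPE('a::comm_ring_1)" and I: "is_ideal (I::'a set)"
  shows "\<exists>Ps. (\<forall>P\<in>set Ps. prime_ideal P \<and> I \<subseteq> P) \<and> (\<forall>as. list_all2 (\<in>) as Ps \<longrightarrow> prod_list as \<in> I)"
    (is "?good I")
proof (rule ccontr)
  assume bad: "\<not> ?good I"
  obtain M where M: "M \<in> {J. is_ideal J \<and> \<not> ?good J}"
    and max: "\<And>J. J \<in> {J. is_ideal J \<and> \<not> ?good J} \<Longrightarrow> M \<subseteq> J \<Longrightarrow> J = M"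
    by (rule noetherian_maximal[OF noeth, of "{J. is_ideal J \<and> \<not> ?good J}" I]) (use I bad in auto)
  have Mi: "is_ideal M" and Mbad: "\<not> ?good M" using M by auto
  have "M \<noteq> UNIV"
  proof
    assume "M = UNIV"
    then have "?good M" by (intro exI[of _ "[]"]) auto
    with Mbad show False by blast
  qed
  moreover have "\<not> prime_ideal M"
  proof
    assume "prime_ideal M"
    then have "?good M" by (intro exI[of _ "[M]"]) (auto simp: list_all2_Cons2)
    with Mbad show False by blast
  qed
  ultimately obtain a b where ab: "a * b \<in> M" "a \<notin> M" "b \<notin> M"
    using Mi unfolding prime_ideal_def by blast
  have good_insert: "?good (ideal_insert c M)" if "c \<notin> M" for c
  proof (rule ccontr)
    assume "\<not> ?good (ideal_insert c M)"
    then have "ideal_insert c M = M"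
      by (intro max subset_ideal_insert CollectI conjI is_ideal_ideal_insert[OF Mi])
    then show False using self_mem_ideal_insert[OF Mi, of c] that by simp
  qed
  obtain Ps Qs where
    Ps: "\<forall>P\<in>set Ps. prime_ideal P \<and> ideal_insert a M \<subseteq> P"
      "\<And>as. list_all2 (\<in>) as Ps \<Longrightarrow> prod_list as \<in> ideal_insert a M" and
    Qs: "\<forall>P\<in>set Qs. prime_ideal P \<and> ideal_insert b M \<subseteq> P"
      "\<And>as. list_all2 (\<in>) as Qs \<Longrightarrow> prod_list as \<in> ideal_insert b M"
    using good_insert[OF ab(2)] good_insert[OF ab(3)] by metis
  have "?good M"
  proof (intro exI[of _ "Ps @ Qs"] conjI ballI allI impI)
    fix P assume "P \<in> set (Ps @ Qs)"
    then have "prime_ideal P \<and> (ideal_insert a M \<subseteq> P \<or> ideal_insert b M \<subseteq> P)"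
      using Ps Qs by auto
    then show "prime_ideal P" "M \<subseteq> P"
      using subset_ideal_insert[of M a] subset_ideal_insert[of M b] by auto
  next
    fix as assume "list_all2 (\<in>) as (Ps @ Qs)"
    then obtain bs cs where *: "as = bs @ cs" "list_all2 (\<in>) bs Ps" "list_all2 (\<in>) cs Qs"
      by (auto simp: list_all2_append2)
    obtain p1 p2 r1 r2 where **: "prod_list bs = p1 + r1 * a" "prod_list cs = p2 + r2 * b" "p1 \<in> M" "p2 \<in> M"
      using Ps(2)[OF *(2)] Qs(2)[OF *(3)] by (auto simp: ideal_insert_def)
    have "prod_list as = (p2 + r2 * b) * p1 + r1 * a * p2 + r1 * r2 * (a * b)"
      using * ** by (simp add: algebra_simps)
    also have "\<dots> \<in> M" using ** ab Mi by (simp add: ideal_add ideal_mult_left)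
    finally show "prod_list as \<in> M" .
  qed
  with Mbad show False by blast
qed

text \<open>A prime contained in another one of \<open>F\<close> may be dropped. For pairwise
  incomparable primes, an x avoiding all but P is corrected by \<open>?y\<close>, which lies in
  \<open>I\<close> and in all the others but not in P.\<close>

lemma prime_avoidance:
  assumes I: "is_ideal (I :: 'a::comm_ring_1 set)" and F: "finite F"
    and "\<And>P. P \<in> F \<Longrightarrow> prime_ideal P" "\<And>P. P \<in> F \<Longrightarrow> \<not> I \<subseteq> P"
  shows "\<exists>x\<in>I. \<forall>P\<in>F. x \<notin> P"
  using F assms(3,4)
proof (induction F rule: finite_psubset_induct)
  case (psubset F)
  show ?case
  proof (cases "\<exists>P\<in>F. \<exists>P'\<in>F. P \<subset> P'")
    case True
    then obtain P P' where PP: "P \<in> F" "P' \<in> F" "P \<subset> P'" by auto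
    have "\<exists>x\<in>I. \<forall>Q\<in>F - {P}. x \<notin> Q"
      using psubset.prems PP(1) by (intro psubset.IH) auto
    then obtain x where x: "x \<in> I" "\<forall>Q\<in>F - {P}. x \<notin> Q" by blast
    then show ?thesis using PP by (intro bexI[of _ x]) auto
  next
    case incomp: False
    show ?thesis
    proof (cases "F = {}")
      case True
      then show ?thesis using ideal_zero[OF I] by auto
    next
      case False
      then obtain P where P: "P \<in> F" by auto
      have "\<exists>x\<in>I. \<forall>Q\<in>F - {P}. x \<notin> Q"
        using psubset.prems P by (intro psubset.IH) auto
      then obtain x where x: "x \<in> I" "\<forall>Q\<in>F - {P}. x \<notin> Q" by blast
      have "\<forall>Q\<in>F - {P}. \<exists>z. z \<in> Q \<and> z \<notin> P" using incomp P by blast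
      then obtain z where z: "\<And>Q. Q \<in> F - {P} \<Longrightarrow> z Q \<in> Q \<and> z Q \<notin> P" by metis
      obtain w where w: "w \<in> I" "w \<notin> P" using psubset.prems P by blast
      have Pp: "prime_ideal P" using psubset.prems P by auto
      let ?y = "w * prod z (F - {P})"
      have fin: "finite (F - {P})" using psubset.hyps by auto
      have prodP: "prod z S \<notin> P" if "finite S" "S \<subseteq> F - {P}" for S
        using that
      proof (induction S)
        case empty
        show ?case by (simp add: prime_ideal_one[OF Pp])
      next
        case (insert Q S)
        then show ?case using z[of Q] by (auto simp: prime_ideal_mult_iff[OF Pp])
      qed
      then have yP: "?y \<notin> P" using w fin by (auto simp: prime_ideal_mult_iff[OF Pp])
      have yI: "?y \<in> I" using w I by (auto intro: ideal_mult_right)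
      have yQ: "?y \<in> Q" if "Q \<in> F - {P}" for Q
      proof -
        have Qi: "is_ideal Q" using psubset.prems that by (auto intro: prime_ideal_is_ideal)
        have "prod z (F - {P}) = z Q * prod z (F - {P} - {Q})"
          using fin that by (simp add: prod.remove)
        then show ?thesis using z[OF that] Qi by (auto intro: ideal_mult_left ideal_mult_right)
      qed
      show ?thesis
      proof (cases "x \<in> P")
        case False
        then show ?thesis using x by (intro bexI[of _ x]) auto
      next
        case True
        have "x + ?y \<notin> P"
          using yP True ideal_diff[OF prime_ideal_is_ideal[OF Pp], of "x + ?y" x] by auto
        moreover have "x + ?y \<notin> Q" if "Q \<in> F - {P}" for Q
          using ideal_diff[of Q "x + ?y" ?y] yQ[OF that] x that psubset.prems
          by (auto dest: prime_ideal_is_ideal)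
        ultimately show ?thesis using x yI I by (intro bexI[of _ "x + ?y"]) (auto intro: ideal_add)
      qed
    qed
  qed
qed

section \<open>Descending chain conditions\<close>

text \<open>Preservation of 1 is left out on purpose: the map used in the end sends 1 to an
  idempotent that is the unit of \<open>S\<close> but not of the ambient ring.\<close>

definition rhom :: "('a::comm_ring_1 \<Rightarrow> 'b::comm_ring_1) \<Rightarrow> bool" where
  "rhom \<phi> \<longleftrightarrow> (\<forall>a b. \<phi> (a + b) = \<phi> a + \<phi> b \<and> \<phi> (a * b) = \<phi> a * \<phi> b)"

lemma rhom_add: "rhom \<phi> \<Longrightarrow> \<phi> (a + b) = \<phi> a + \<phi> b"
  and rhom_mult: "rhom \<phi> \<Longrightarrow> \<phi> (a * b) = \<phi> a * \<phi> b"
  by (auto simp: rhom_def)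

lemma rhom_zero: "rhom \<phi> \<Longrightarrow> \<phi> 0 = 0"
  using rhom_add[of \<phi> 0 0] by simp

lemma rhom_uminus: "rhom \<phi> \<Longrightarrow> \<phi> (- a) = - \<phi> a"
  using rhom_add[of \<phi> "- a" a] rhom_zero[of \<phi>] by (simp add: eq_neg_iff_add_eq_0)

lemma rhom_diff: "rhom \<phi> \<Longrightarrow> \<phi> (a - b) = \<phi> a - \<phi> b"
  using rhom_add[of \<phi> a "- b"] rhom_uminus[of \<phi> b] by simp

lemma rhom_power: "rhom \<phi> \<Longrightarrow> n > 0 \<Longrightarrow> \<phi> (a ^ n) = \<phi> a ^ n"
proof (induction n)
  case (Suc n)
  then show ?case by (cases n) (auto simp: rhom_mult)
qed auto

lemma rhom_sum: "rhom \<phi> \<Longrightarrow> \<phi> (sum f S) = (\<Sum>i\<in>S. \<phi> (f i))"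
  by (induction S rule: infinite_finite_induct) (auto simp: rhom_zero rhom_add)

lemma rhom_ident: "rhom (\<lambda>x. x)"
  by (simp add: rhom_def)

definition submod :: "('a::comm_ring_1 \<Rightarrow> 'b::comm_ring_1) \<Rightarrow> 'b set \<Rightarrow> bool" where
  "submod \<phi> B \<longleftrightarrow> 0 \<in> B \<and> (\<forall>x\<in>B. \<forall>y\<in>B. x - y \<in> B) \<and> (\<forall>r. \<forall>x\<in>B. \<phi> r * x \<in> B)"

lemma submod_zero: "submod \<phi> B \<Longrightarrow> 0 \<in> B"
  and submod_diff: "submod \<phi> B \<Longrightarrow> x \<in> B \<Longrightarrow> y \<in> B \<Longrightarrow> x - y \<in> B"
  and submod_mult: "submod \<phi> B \<Longrightarrow> x \<in> B \<Longrightarrow> \<phi> r * x \<in> B"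
  by (auto simp: submod_def)

lemma submod_add: "submod \<phi> B \<Longrightarrow> x \<in> B \<Longrightarrow> y \<in> B \<Longrightarrow> x + y \<in> B"
  using submod_diff[of \<phi> B x "0 - y"] submod_diff[of \<phi> B 0 y] submod_zero[of \<phi> B] by simp

lemma submod_sum: "submod \<phi> B \<Longrightarrow> (\<And>i. i \<in> S \<Longrightarrow> f i \<in> B) \<Longrightarrow> sum f S \<in> B"
  by (induction S rule: infinite_finite_induct) (auto simp: submod_zero submod_add)

lemma submod_ident: "submod (\<lambda>x. x) I \<longleftrightarrow> is_ideal I"
  using submod_zero submod_add submod_mult ideal_zero ideal_diff ideal_mult_left
  unfolding submod_def is_ideal_def by (metis (no_types, lifting) submod_add submod_def)

lemma lcomb_diff:
  assumes "rhom \<phi>" "is_ideal Q"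
  shows "x \<in> lcomb \<phi> Q gs \<Longrightarrow> y \<in> lcomb \<phi> Q gs \<Longrightarrow> x - y \<in> lcomb \<phi> Q gs"
proof (induction gs arbitrary: x y)
  case (Cons g gs)
  from Cons.prems obtain q1 y1 q2 y2 where *: "x = \<phi> q1 * g + y1" "y = \<phi> q2 * g + y2"
    "q1 \<in> Q" "q2 \<in> Q" "y1 \<in> lcomb \<phi> Q gs" "y2 \<in> lcomb \<phi> Q gs" by auto
  have "x - y = \<phi> (q1 - q2) * g + (y1 - y2)"
    using * by (simp add: rhom_diff[OF assms(1)] algebra_simps)
  then show ?case using Cons.IH[of y1 y2] * ideal_diff[OF assms(2), of q1 q2]
    unfolding lcomb.simps by blast
qed auto

lemma submod_lcomb: "rhom \<phi> \<Longrightarrow> is_ideal Q \<Longrightarrow> submod \<phi> (lcomb \<phi> Q gs)"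
  unfolding submod_def
  using lcomb_zero[of \<phi> Q gs] lcomb_diff[of \<phi> Q _ gs] lcomb_mult[of \<phi> Q _ gs]
  by (simp add: rhom_zero ideal_zero rhom_mult)

lemma submod_lcomb_subset: "submod \<phi> B \<Longrightarrow> set gs \<subseteq> B \<Longrightarrow> lcomb \<phi> Q gs \<subseteq> B"
  by (rule lcomb_subset) (auto simp: submod_zero submod_add submod_mult)

definition set_plus :: "'b::comm_ring_1 set \<Rightarrow> 'b set \<Rightarrow> 'b set" where
  "set_plus B C = {b + c | b c. b \<in> B \<and> c \<in> C}"

lemma set_plusI: "b \<in> B \<Longrightarrow> c \<in> C \<Longrightarrow> b + c \<in> set_plus B C"
  by (auto simp: set_plus_def)

lemma set_plusE: "x \<in> set_plus B C \<Longrightarrow> (\<And>b c. x = b + c \<Longrightarrow> b \<in> B \<Longrightarrow> c \<in> C \<Longrightarrow> thesis) \<Longrightarrow> thesis"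
  by (auto simp: set_plus_def)

lemma submod_set_plus:
  assumes B: "submod \<phi> B" and C: "submod \<phi> C"
  shows "submod \<phi> (set_plus B C)"
proof -
  have "b + c - (b' + c') \<in> set_plus B C" if "b \<in> B" "b' \<in> B" "c \<in> C" "c' \<in> C" for b b' c c'
    using set_plusI[of "b - b'" B "c - c'" C] that submod_diff[OF B] submod_diff[OF C]
    by (simp add: algebra_simps)
  moreover have "\<phi> r * (b + c) \<in> set_plus B C" if "b \<in> B" "c \<in> C" for b c r
    using set_plusI[of "\<phi> r * b" B "\<phi> r * c" C] that submod_mult[OF B] submod_mult[OF C]
    by (simp add: distrib_left)
  moreover have "0 \<in> set_plus B C" using set_plusI[OF submod_zero[OF B] submod_zero[OF C]] by simp
  ultimately show ?thesis
    unfolding submod_def by (metis set_plusE)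
qed

lemma set_plus_left: "submod \<phi> C \<Longrightarrow> B \<subseteq> set_plus B C"
  using set_plusI[of _ B 0 C] submod_zero[of \<phi> C] by fastforce

lemma set_plus_right: "submod \<phi> B \<Longrightarrow> C \<subseteq> set_plus B C"
  using set_plusI[of 0 B _ C] submod_zero[of \<phi> B] by fastforce

lemma set_plus_subset: "submod \<phi> D \<Longrightarrow> B \<subseteq> D \<Longrightarrow> C \<subseteq> D \<Longrightarrow> set_plus B C \<subseteq> D"
  unfolding set_plus_def by (auto intro: submod_add)

definition stationary :: "(nat \<Rightarrow> 'b set) \<Rightarrow> bool" where
  "stationary A \<longleftrightarrow> (\<exists>n. \<forall>i\<ge>n. A i = A n)"

text \<open>The quotient \<open>(B + R g) / B\<close> is, after localizing at \<open>Q\<close>, zero or simple.\<close>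

lemma stationary_step:
  fixes \<phi> :: "'a::comm_ring_1 \<Rightarrow> 'b::comm_ring_1" and A :: "nat \<Rightarrow> 'b set"
  assumes \<phi>: "rhom \<phi>"
    and anti: "\<And>i j. i \<le> j \<Longrightarrow> A j \<subseteq> A i"
    and A: "\<And>i. submod \<phi> (A i)"
    and sat: "\<And>i r a. r \<notin> Q \<Longrightarrow> a \<in> A 0 \<Longrightarrow> \<phi> r * a \<in> A i \<Longrightarrow> a \<in> A i"
    and B: "submod \<phi> B"
    and Qg: "\<And>r. r \<in> Q \<Longrightarrow> \<phi> r * g \<in> B"
    and ev: "stationary (\<lambda>i. A i \<inter> B)"
  shows "stationary (\<lambda>i. A i \<inter> set_plus B (lcomb \<phi> UNIV [g]))" (is "stationary (\<lambda>i. A i \<inter> ?B)")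
proof -
  obtain n where n: "\<And>i. i \<ge> n \<Longrightarrow> A i \<inter> B = A n \<inter> B"
    using ev unfolding stationary_def by blast
  have BB: "B \<subseteq> ?B" by (rule set_plus_left[OF submod_lcomb[OF \<phi> is_ideal_UNIV]])
  have elem: "\<exists>b r. b \<in> B \<and> a = b + \<phi> r * g" if "a \<in> ?B" for a
    using that unfolding set_plus_def by auto
  show ?thesis
  \<comment> \<open>Either some A i0, hence every later one, meets B + R g only with coefficients
    from Q and adds nothing to B; or each A i has an element with coefficient r' outside Q, which
    cancels the g-part of r' * a for any a in A n.\<close>
  proof (cases "\<exists>i0. \<forall>r b. b \<in> B \<longrightarrow> b + \<phi> r * g \<in> A i0 \<longrightarrow> r \<in> Q")
    case True
    then obtain i0 where i0: "\<And>r b. b \<in> B \<Longrightarrow> b + \<phi> r * g \<in> A i0 \<Longrightarrow> r \<in> Q" by blast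
    have *: "A i \<inter> ?B = A i \<inter> B" if "i \<ge> i0" for i
    proof
      show "A i \<inter> ?B \<subseteq> A i \<inter> B"
      proof
        fix a assume a: "a \<in> A i \<inter> ?B"
        then obtain b r where br: "b \<in> B" "a = b + \<phi> r * g" using elem by blast
        then have "r \<in> Q" using i0 a anti[OF that] by blast
        then show "a \<in> A i \<inter> B" using a br submod_add[OF B] Qg by auto
      qed
    qed (use BB in auto)
    have "A i \<inter> ?B = A (max n i0) \<inter> ?B" if "i \<ge> max n i0" for i
      using *[of i] *[of "max n i0"] n[of i] n[of "max n i0"] that by simp
    then show ?thesis unfolding stationary_def by blast
  next
    case False
    have "A i \<inter> ?B = A n \<inter> ?B" if "i \<ge> n" for i
    proof
      show "A i \<inter> ?B \<subseteq> A n \<inter> ?B" using anti[OF that] by auto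
      show "A n \<inter> ?B \<subseteq> A i \<inter> ?B"
      proof
        fix a assume a: "a \<in> A n \<inter> ?B"
        then obtain b r where br: "b \<in> B" "a = b + \<phi> r * g" using elem by blast
        from False obtain r' b' where b': "b' \<in> B" "b' + \<phi> r' * g \<in> A i" "r' \<notin> Q" by blast
        have eq: "\<phi> r' * a - \<phi> r * (b' + \<phi> r' * g) = \<phi> r' * b - \<phi> r * b'"
          using br by (simp add: algebra_simps)
        have "\<phi> r' * a \<in> A n" using a submod_mult[OF A] by auto
        moreover have ri: "\<phi> r * (b' + \<phi> r' * g) \<in> A i" using b' submod_mult[OF A] by auto
        ultimately have "\<phi> r' * b - \<phi> r * b' \<in> A n"
          using anti[OF that] submod_diff[OF A, of "\<phi> r' * a" n "\<phi> r * (b' + \<phi> r' * g)"] eq by auto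
        moreover have "\<phi> r' * b - \<phi> r * b' \<in> B"
          using br b' submod_mult[OF B] submod_diff[OF B] by auto
        ultimately have "\<phi> r' * b - \<phi> r * b' \<in> A i" using n[OF that] by auto
        then have "\<phi> r' * a \<in> A i"
          using submod_add[OF A, of "\<phi> r' * b - \<phi> r * b'" i "\<phi> r * (b' + \<phi> r' * g)"] ri eq
          by (simp add: algebra_simps)
        then show "a \<in> A i \<inter> ?B" using sat[OF b'(3)] a anti[of 0 n] by auto
      qed
    qed
    then show ?thesis unfolding stationary_def by blast
  qed
qed

lemma set_plus_lcomb_Cons:
  "set_plus (set_plus B (lcomb \<phi> UNIV [g])) (lcomb \<phi> UNIV gs) = set_plus B (lcomb \<phi> UNIV (g # gs))"
  (is "?L = ?R")
proof
  show "?L \<subseteq> ?R"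
  proof
    fix z assume "z \<in> ?L"
    then obtain b q y where "z = b + \<phi> q * g + y" "b \<in> B" "y \<in> lcomb \<phi> UNIV gs"
      by (auto elim!: set_plusE)
    then show "z \<in> ?R" using set_plusI[of b B "\<phi> q * g + y" "lcomb \<phi> UNIV (g # gs)"]
      by (auto simp: add.assoc)
  qed
  show "?R \<subseteq> ?L"
  proof
    fix z assume "z \<in> ?R"
    then obtain b q y where *: "z = b + (\<phi> q * g + y)" "b \<in> B" "y \<in> lcomb \<phi> UNIV gs"
      by (auto elim!: set_plusE)
    then have "b + \<phi> q * g \<in> set_plus B (lcomb \<phi> UNIV [g])" by (intro set_plusI) auto
    then show "z \<in> ?L" using * by (auto simp: add.assoc[symmetric] intro: set_plusI)
  qed
qed

lemma stationary_steps:
  fixes \<phi> :: "'a::comm_ring_1 \<Rightarrow> 'b::comm_ring_1" and A :: "nat \<Rightarrow> 'b set"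
  assumes \<phi>: "rhom \<phi>"
    and anti: "\<And>i j. i \<le> j \<Longrightarrow> A j \<subseteq> A i"
    and A: "\<And>i. submod \<phi> (A i)"
    and sat: "\<And>i r a. r \<notin> Q \<Longrightarrow> a \<in> A 0 \<Longrightarrow> \<phi> r * a \<in> A i \<Longrightarrow> a \<in> A i"
  shows "submod \<phi> B \<Longrightarrow> (\<And>r g. r \<in> Q \<Longrightarrow> g \<in> set gs \<Longrightarrow> \<phi> r * g \<in> B) \<Longrightarrow>
    stationary (\<lambda>i. A i \<inter> B) \<Longrightarrow> stationary (\<lambda>i. A i \<inter> set_plus B (lcomb \<phi> UNIV gs))"
proof (induction gs arbitrary: B)
  case Nil
  then show ?case by (simp add: set_plus_def)
next
  case (Cons g gs)
  let ?B = "set_plus B (lcomb \<phi> UNIV [g])"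
  have "stationary (\<lambda>i. A i \<inter> set_plus ?B (lcomb \<phi> UNIV gs))"
  proof (rule Cons.IH)
    show "submod \<phi> ?B" by (intro submod_set_plus submod_lcomb \<phi> is_ideal_UNIV Cons.prems)
    show "\<phi> r * h \<in> ?B" if "r \<in> Q" "h \<in> set gs" for r h
      using Cons.prems(2)[OF that(1), of h] that(2)
        set_plus_left[OF submod_lcomb[OF \<phi> is_ideal_UNIV], of B "[g]"] by (meson list.set_intros(2) subsetD)
    show "stationary (\<lambda>i. A i \<inter> ?B)"
      by (rule stationary_step[where Q = Q]) (use assms Cons.prems in auto)
  qed
  then show ?case by (simp only: set_plus_lcomb_Cons)
qed

text \<open>For a prime \<open>Q\<close> this expresses the finite length of R / Q^c after
  localizing at \<open>Q\<close>. The induction climbs from Q^c, contained in every A i, to Q^0 = R;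
  each layer Q^k / Q^(k+1) has finitely many generators, all killed by \<open>Q\<close>.\<close>

lemma stationary_saturated_ideals:
  fixes A :: "nat \<Rightarrow> 'a::comm_ring_1 set"
  assumes noeth: "noetherian_ring TYPE('a)" and Q: "is_ideal Q"
    and anti: "\<And>i j. i \<le> j \<Longrightarrow> A j \<subseteq> A i"
    and A: "\<And>i. is_ideal (A i)"
    and sat: "\<And>i s u. s \<notin> Q \<Longrightarrow> s * u \<in> A i \<Longrightarrow> u \<in> A i"
    and pow: "\<And>i. ideal_pow Q c \<subseteq> A i"
  shows "stationary A"
proof -
  have "stationary (\<lambda>i. A i \<inter> ideal_pow Q 0)"
  proof (rule inc_induct[of 0 c])
    have "A i \<inter> ideal_pow Q c = ideal_pow Q c" for i using pow by blast
    then show "stationary (\<lambda>i. A i \<inter> ideal_pow Q c)" by (simp add: stationary_def)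
  next
    fix k assume IH: "stationary (\<lambda>i. A i \<inter> ideal_pow Q (Suc k))"
    let ?P = "ideal_pow Q k" and ?P' = "ideal_pow Q (Suc k)"
    obtain gs where gs: "?P = icomb UNIV gs" "set gs \<subseteq> ?P"
      using noetherian_fg[OF noeth is_ideal_ideal_pow[of Q k]] by metis
    have P': "submod (\<lambda>x. x) ?P'" using is_ideal_ideal_pow[of Q "Suc k"] by (simp only: submod_ident)
    have P: "submod (\<lambda>x. x) ?P" by (simp only: submod_ident is_ideal_ideal_pow)
    have "stationary (\<lambda>i. A i \<inter> set_plus ?P' (icomb UNIV gs))"
    proof (rule stationary_steps[where Q = Q])
      show "r * g \<in> ?P'" if "r \<in> Q" "g \<in> set gs" for r g
        using ideal_pow_Suc_mem[of g Q k r] that gs by (auto simp: mult.commute simp del: ideal_pow.simps)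
    qed (use anti A sat IH P' in \<open>auto simp: submod_ident rhom_ident simp del: ideal_pow.simps\<close>)
    moreover have "set_plus ?P' (icomb UNIV gs) = ?P"
    proof
      show "set_plus ?P' (icomb UNIV gs) \<subseteq> ?P"
        by (rule set_plus_subset[OF P ideal_pow_Suc_subset]) (simp add: gs(1))
      show "?P \<subseteq> set_plus ?P' (icomb UNIV gs)"
        using set_plus_right[OF P', of "icomb UNIV gs"] unfolding gs(1) .
    qed
    ultimately show "stationary (\<lambda>i. A i \<inter> ?P)" by simp
  qed simp
  then show ?thesis by simp
qed

section \<open>Asymptotic Krull intersection\<close>

lemma ideal_pow_subset_if_products:
  assumes "is_ideal J" "\<And>as. length as = n \<Longrightarrow> set as \<subseteq> I \<Longrightarrow> prod_list as \<in> J"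
  shows "ideal_pow I n \<subseteq> J"
  using assms
proof (induction n arbitrary: J)
  case 0
  then show ?case using ideal_one_UNIV[of J] by fastforce
next
  case (Suc n)
  have "ideal_pow I n \<subseteq> {x. \<forall>y\<in>I. x * y \<in> J}"
  proof (rule Suc.IH[OF is_ideal_colon[OF Suc.prems(1)]])
    fix as assume as: "length as = n" "set as \<subseteq> I"
    have "prod_list as * y \<in> J" if "y \<in> I" for y
      using Suc.prems(2)[of "y # as"] as that by (simp add: mult.commute)
    then show "prod_list as \<in> {x. \<forall>y\<in>I. x * y \<in> J}" by simp
  qed
  then show ?case
    unfolding ideal_pow.simps(2) by (intro ideal_span_minimal Suc.prems(1)) blast
qed

text \<open>For multiplicative \<open>W\<close>, the contraction to R of the extension of
  \<open>I\<close> to the localization at \<open>W\<close>; working with such ideals avoids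
  constructing localized rings.\<close>

definition saturation :: "'a::comm_ring_1 set \<Rightarrow> 'a set \<Rightarrow> 'a set" where
  "saturation W I = {u. \<exists>w\<in>W. w * u \<in> I}"

lemma is_ideal_saturation:
  assumes I: "is_ideal I" and W: "1 \<in> W" "\<And>a b. a \<in> W \<Longrightarrow> b \<in> W \<Longrightarrow> a * b \<in> W"
  shows "is_ideal (saturation W I)"
  unfolding is_ideal_def
proof (intro conjI ballI allI)
  show "0 \<in> saturation W I" using W ideal_zero[OF I] by (auto simp: saturation_def)
next
  fix x y assume "x \<in> saturation W I" "y \<in> saturation W I"
  then obtain v w where *: "v \<in> W" "w \<in> W" "v * x \<in> I" "w * y \<in> I" by (auto simp: saturation_def)
  have "(v * w) * (x + y) = w * (v * x) + v * (w * y)" by (simp add: algebra_simps)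
  also have "\<dots> \<in> I" using * I by (simp add: ideal_add ideal_mult_left)
  finally show "x + y \<in> saturation W I" using W(2)[OF *(1,2)] by (auto simp: saturation_def)
next
  fix r x assume "x \<in> saturation W I"
  then obtain w where *: "w \<in> W" "w * x \<in> I" by (auto simp: saturation_def)
  then have "w * (r * x) \<in> I" using ideal_mult_left[OF I *(2), of r] by (simp add: mult.left_commute)
  then show "r * x \<in> saturation W I" using * by (auto simp: saturation_def)
qed

lemma saturation_saturated:
  "(\<And>a b. a \<in> W \<Longrightarrow> b \<in> W \<Longrightarrow> a * b \<in> W) \<Longrightarrow> s \<in> W \<Longrightarrow> s * u \<in> saturation W I \<Longrightarrow> u \<in> saturation W I"
  unfolding saturation_def by (auto simp: mult.assoc[symmetric])

lemma saturation_mono: "I \<subseteq> J \<Longrightarrow> saturation W I \<subseteq> saturation W J"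
  by (auto simp: saturation_def)

lemma subset_saturation: "1 \<in> W \<Longrightarrow> I \<subseteq> saturation W I"
  by (auto simp: saturation_def intro!: bexI[of _ 1])

lemma ideal_insert_mono: "I \<subseteq> J \<Longrightarrow> ideal_insert x I \<subseteq> ideal_insert x J"
  by (auto simp: ideal_insert_def)

section \<open>Elementary facts about local rings\<close>

lemma local_ring_ideal_subset:
  assumes "local_ring m" "is_ideal I" "I \<noteq> UNIV"
  shows "I \<subseteq> m"
proof
  fix x assume x: "x \<in> I"
  show "x \<in> m"
  proof (rule ccontr)
    assume "x \<notin> m"
    then obtain y where "1 = x * y" using assms(1) by (auto simp: local_ring_def dvd_def)
    then have "1 \<in> I" using ideal_mult_right[OF assms(2) x, of y] by simp
    then show False using ideal_one_UNIV assms by blast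
  qed
qed

lemma local_ring_is_ideal: "local_ring m \<Longrightarrow> is_ideal m"
  by (simp add: local_ring_def)

lemma local_ring_one: "local_ring m \<Longrightarrow> 1 \<notin> m"
  using ideal_one_UNIV by (auto simp: local_ring_def)

lemma local_ring_inverse:
  assumes "local_ring m" "x \<notin> m" obtains y where "x * y = 1"
  using assms unfolding local_ring_def dvd_def by metis

lemma local_ring_prime:
  assumes m: "local_ring m" shows "prime_ideal m"
  unfolding prime_ideal_def
proof (intro conjI allI impI)
  show "is_ideal m" "m \<noteq> UNIV" using m by (auto simp: local_ring_def)
  fix x y assume xy: "x * y \<in> m"
  show "x \<in> m \<or> y \<in> m"
  proof (rule ccontr)
    assume "\<not> (x \<in> m \<or> y \<in> m)"
    then obtain z where z: "x * z = 1" and y: "y \<notin> m" using local_ring_inverse[OF m] by metis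
    have "z * (x * y) \<in> m" using xy m by (simp add: ideal_mult_left local_ring_is_ideal)
    moreover have "z * (x * y) = (x * z) * y" by (simp add: ac_simps)
    ultimately show False using y z by simp
  qed
qed

lemma prod_list_map2_mult:
  "length qs = length Rs \<Longrightarrow>
    prod_list (map2 (\<lambda>R q. a R * q) Rs qs) = prod_list (map a Rs) * prod_list (qs :: 'a::comm_ring_1 list)"
  by (induction qs Rs rule: list_induct2) (auto simp: algebra_simps)

text \<open>A form of Krull's principal ideal theorem: a Noetherian local domain in which every
  nonzero prime contains \<open>y\<close> has dimension at most one.\<close>

lemma power_maximal_subset_if_primes_contain:
  fixes m P :: "'a::comm_ring_1 set"
  assumes noeth: "noetherian_ring TYPE('a)" and m: "local_ring m"
    and P: "prime_ideal P" and y: "y \<in> m" "y \<notin> P"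
    and above: "\<And>J. prime_ideal J \<Longrightarrow> P \<subset> J \<Longrightarrow> y \<in> J"
  shows "\<exists>b. ideal_pow m b \<subseteq> ideal_insert y P"
proof (rule ccontr)
  assume neg: "\<not> (\<exists>b. ideal_pow m b \<subseteq> ideal_insert y P)"
  note Pi = prime_ideal_is_ideal[OF P] and mi = local_ring_is_ideal[OF m]
  have ins: "is_ideal (ideal_insert z P)" for z by (rule is_ideal_ideal_insert[OF Pi])
  have sub_m: "J \<subseteq> m" if "prime_ideal J" for J
    using that local_ring_ideal_subset[OF m] by (auto simp: prime_ideal_def)
  obtain Ps where Ps: "\<And>J. J \<in> set Ps \<Longrightarrow> prime_ideal J" "\<And>J. J \<in> set Ps \<Longrightarrow> ideal_insert y P \<subseteq> J"
    "\<And>as. list_all2 (\<in>) as Ps \<Longrightarrow> prod_list as \<in> ideal_insert y P"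
    using ideal_contains_prime_product[OF noeth ins, of y] by metis
  \<comment> \<open>If every prime in \<open>Ps\<close> were m, each product of
    \<open>length Ps\<close> elements of m would lie in (y) + P, against \<open>neg\<close>.\<close>
  define F where "F = {J \<in> set Ps. J \<noteq> m}"
  have "F \<noteq> {}"
  proof
    assume "F = {}"
    then have "list_all2 (\<in>) as Ps" if "length as = length Ps" "set as \<subseteq> m" for as
      using that by (auto simp: F_def list_all2_conv_all_nth)
        (metis in_mono nth_mem)
    then have "ideal_pow m (length Ps) \<subseteq> ideal_insert y P"
      by (intro ideal_pow_subset_if_products[OF ins]) (auto intro: Ps(3))
    with neg show False by blast
  qed
  \<comment> \<open>An x outside all of F produces a chain P, Q0, Q: a prime Q minimal in the list
    over (x) + P contains y, hence some Q0 of F, and x separates Q from Q0. Krull's theorem modulo P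
    forbids such a Q0 between P and Q.\<close>
  have "\<exists>x\<in>m. \<forall>J\<in>F. x \<notin> J"
    using Ps(1) sub_m by (intro prime_avoidance mi) (auto simp: F_def)
  then obtain x where x: "x \<in> m" "\<And>J. J \<in> F \<Longrightarrow> x \<notin> J" by blast
  have "x \<notin> P"
    using \<open>F \<noteq> {}\<close> x(2) Ps(2) subset_ideal_insert[of P y] unfolding F_def by blast
  obtain Rs where Rs: "\<And>J. J \<in> set Rs \<Longrightarrow> prime_ideal J" "\<And>J. J \<in> set Rs \<Longrightarrow> ideal_insert x P \<subseteq> J"
    "\<And>as. list_all2 (\<in>) as Rs \<Longrightarrow> prod_list as \<in> ideal_insert x P"
    using ideal_contains_prime_product[OF noeth ins, of x] by metis
  have insx: "ideal_insert x P \<subseteq> m" using x(1) sub_m[OF P] by (intro ideal_insert_subset mi)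
  have "set Rs \<noteq> {}" using Rs(3)[of "[]"] insx local_ring_one[OF m] by auto
  then obtain Q where Q: "Q \<in> set Rs" and Qmin: "\<And>J. J \<in> set Rs \<Longrightarrow> J \<subseteq> Q \<Longrightarrow> J = Q"
    using finite_has_minimal[of "set Rs"] by (metis List.finite_set)
  have Qp: "prime_ideal Q" and xQ: "ideal_insert x P \<subseteq> Q" using Q Rs by auto
  note Qi = prime_ideal_is_ideal[OF Qp]
  have "x \<in> Q" "P \<subseteq> Q" using xQ self_mem_ideal_insert[OF Pi] subset_ideal_insert by blast+
  then have "y \<in> Q" using above[OF Qp] \<open>x \<notin> P\<close> by blast
  then have yQ: "ideal_insert y P \<subseteq> Q" using \<open>P \<subseteq> Q\<close> by (intro ideal_insert_subset Qi)
  have "\<exists>J\<in>set Ps. J \<subseteq> Q"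
  proof (rule ccontr)
    assume "\<not> ?thesis"
    then have "\<forall>J\<in>set Ps. \<exists>a. a \<in> J \<and> a \<notin> Q" by blast
    then obtain a where a: "\<And>J. J \<in> set Ps \<Longrightarrow> a J \<in> J \<and> a J \<notin> Q" by metis
    have "prod_list (map a Ps) \<in> ideal_insert y P"
      using a by (intro Ps(3)) (auto simp: list_all2_conv_all_nth)
    then have "prod_list (map a Ps) \<in> Q" using yQ by blast
    then show False using a by (auto simp: prime_ideal_prod_list[OF Qp])
  qed
  then obtain Q0 where Q0: "Q0 \<in> F" "Q0 \<subseteq> Q"
    using \<open>F \<noteq> {}\<close> sub_m[OF Qp] sub_m Ps(1) unfolding F_def by blast
  have Q0p: "prime_ideal Q0" and yQ0: "ideal_insert y P \<subseteq> Q0" and xQ0: "x \<notin> Q0"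
    using Q0 Ps x by (auto simp: F_def)

  \<comment> \<open>Every other prime in \<open>Rs\<close> contributes a factor outside Q that takes
    care of its place in a product, while Q itself gets the factor 1. So s * Q^c lies in (x) + P,
    with c the length of \<open>Rs\<close>.\<close>
  have "\<forall>J. \<exists>a. a \<notin> Q \<and> (J \<in> set Rs \<longrightarrow> J \<noteq> Q \<longrightarrow> a \<in> J) \<and> (J = Q \<longrightarrow> a = 1)"
    using Qmin prime_ideal_one[OF Qp] by (metis subsetI)
  then obtain a where a: "\<And>J. a J \<notin> Q" "\<And>J. J \<in> set Rs \<Longrightarrow> J \<noteq> Q \<Longrightarrow> a J \<in> J" "a Q = 1" by metis
  define s where "s = prod_list (map a Rs)"
  define c where "c = length Rs"
  have sQ: "s \<notin> Q" using a(1) by (auto simp: s_def prime_ideal_prod_list[OF Qp])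
  have sc: "ideal_pow Q c \<subseteq> {g. s * g \<in> ideal_insert x P}"
  proof (rule ideal_pow_subset_if_products)
    show "is_ideal {g. s * g \<in> ideal_insert x P}"
      using is_ideal_colon[OF ins, of "{s}" x] by (simp add: mult.commute)
    fix qs assume qs: "length qs = c" "set qs \<subseteq> Q"
    have "list_all2 (\<in>) (map2 (\<lambda>R q. a R * q) Rs qs) Rs"
      unfolding list_all2_conv_all_nth
    proof (intro conjI allI impI)
      fix i assume "i < length (map2 (\<lambda>R q. a R * q) Rs qs)"
      then have i: "i < length Rs" "i < length qs" by auto
      have R: "Rs ! i \<in> set Rs" "qs ! i \<in> Q" using i qs by auto
      have "a (Rs ! i) * qs ! i \<in> Rs ! i"
      proof (cases "Rs ! i = Q")
        case True
        then show ?thesis using a(3) R by simp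
      next
        case False
        then show ?thesis using a(2) R ideal_mult_right[OF prime_ideal_is_ideal[OF Rs(1)]] by blast
      qed
      then show "map2 (\<lambda>R q. a R * q) Rs qs ! i \<in> Rs ! i" using i by simp
    qed (use qs c_def in simp)
    then have "prod_list (map2 (\<lambda>R q. a R * q) Rs qs) \<in> ideal_insert x P" by (rule Rs(3))
    then show "prod_list qs \<in> {g. s * g \<in> ideal_insert x P}"
      using prod_list_map2_mult[of qs Rs a] qs by (simp add: s_def c_def)
  qed

  \<comment> \<open>The elements outside Q are inverted, and x as well. Modulo x the ideals
    \<open>J n\<close> give the chain \<open>A n\<close>, which becomes constant because each
    \<open>A n\<close> contains Q^c.\<close>
  define W where "W = {s * x ^ t | s t. s \<notin> Q}"
  have memW: "s' * x ^ t \<in> W" if "s' \<notin> Q" for s' t unfolding W_def using that by blast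
  have W1: "1 \<in> W" using memW[of 1 0] prime_ideal_one[OF Qp] by simp
  have W2: "v * w \<in> W" if vw: "v \<in> W" "w \<in> W" for v w
  proof -
    obtain s1 t1 s2 t2 where "v = s1 * x ^ t1" "w = s2 * x ^ t2" "s1 \<notin> Q" "s2 \<notin> Q"
      using vw by (auto simp: W_def)
    then have "v * w = (s1 * s2) * x ^ (t1 + t2) \<and> s1 * s2 \<notin> Q"
      by (simp add: power_add algebra_simps prime_ideal_mult_iff[OF Qp])
    then show ?thesis unfolding W_def by blast
  qed
  have QW: "s' \<in> W" if "s' \<notin> Q" for s' using memW[of s' 0] that by simp
  have xW: "x \<in> W" using memW[of 1 1] prime_ideal_one[OF Qp] by simp
  define J where "J n = saturation W (ideal_insert (y ^ n) P)" for n
  define A where "A n = saturation (- Q) (ideal_insert x (J n))" for n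
  have Ji: "is_ideal (J n)" for n unfolding J_def by (rule is_ideal_saturation[OF ins W1 W2])
  have C2: "u * v \<in> - Q" if "u \<in> - Q" "v \<in> - Q" for u v
    using that by (simp add: prime_ideal_mult_iff[OF Qp])
  have Ai: "is_ideal (A n)" for n
    unfolding A_def
    by (rule is_ideal_saturation[OF is_ideal_ideal_insert[OF Ji] _ C2]) (auto simp: prime_ideal_one[OF Qp])
  have Jsat: "u \<in> J n" if "w \<in> W" "w * u \<in> J n" for w u n
    using saturation_saturated[OF W2 that(1)] that(2) unfolding J_def by blast
  have Janti: "J j \<subseteq> J i" if "i \<le> j" for i j
  proof -
    have "y ^ j \<in> ideal_insert (y ^ i) P"
      using self_mem_ideal_insert[OF Pi, of "y ^ i"] ideal_mult_left[OF ins, of "y ^ i" "y ^ i" "y ^ (j - i)"] that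
      by (simp add: power_add[symmetric])
    then show ?thesis
      unfolding J_def by (intro saturation_mono ideal_insert_subset ins subset_ideal_insert)
  qed
  have "stationary A"
  proof (rule stationary_saturated_ideals[OF noeth Qi])
    show "A j \<subseteq> A i" if "i \<le> j" for i j
      unfolding A_def using Janti[OF that] by (intro saturation_mono ideal_insert_mono)
    show "is_ideal (A i)" for i by (rule Ai)
    show "u \<in> A i" if "s \<notin> Q" "s * u \<in> A i" for i s u
      using saturation_saturated[OF C2, of s u] that unfolding A_def by blast
    have "P \<subseteq> J i" for i
      unfolding J_def using subset_ideal_insert[of P] subset_saturation[OF W1] by blast
    then have "ideal_insert x P \<subseteq> ideal_insert x (J i)" for i by (rule ideal_insert_mono)
    then show "ideal_pow Q c \<subseteq> A i" for i
      unfolding A_def saturation_def using sc sQ by blast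
  qed
  then obtain n where n: "A (Suc n) = A n" unfolding stationary_def by (metis le_Suc_eq order.refl)
  obtain gs where gs: "J n = icomb UNIV gs" "set gs \<subseteq> J n" using noetherian_fg[OF noeth Ji] by metis
  have "set gs \<subseteq> J (Suc n)"
  proof (rule nakayama_saturated[OF Qp Ji])
    show "u \<in> J (Suc n)" if "s \<notin> Q" "s * u \<in> J (Suc n)" for s u
      using Jsat QW that by blast
    fix g assume "g \<in> set gs"
    then have g: "g \<in> J n" using gs by blast
    then have "g \<in> ideal_insert x (J n)" using subset_ideal_insert by (rule subsetD[rotated])
    moreover have "1 \<in> - Q" using prime_ideal_one[OF Qp] by simp
    ultimately have "g \<in> A n" unfolding A_def using subset_saturation by (meson subsetD)
    then have "g \<in> A (Suc n)" by (simp only: n)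
    then obtain s v r where s: "s \<notin> Q" "v \<in> J (Suc n)" "s * g = v + r * x"
      unfolding A_def saturation_def ideal_insert_def by blast
    \<comment> \<open>As x belongs to \<open>W\<close>, the coefficient r itself lies in
      \<open>J n\<close>. So at Q the ideal J n is contained in J (n + 1) + Q J n, and Nakayama's
      lemma removes the second summand.\<close>
    have "x * r = s * g - v" using s by (simp add: mult.commute)
    also have "\<dots> \<in> J n"
      using ideal_diff[OF Ji ideal_mult_left[OF Ji g]] s(2) Janti[of n "Suc n"] by auto
    finally have "r \<in> J n" using Jsat xW by blast
    then have "x * r \<in> icomb Q gs"
    proof -
      have "icomb UNIV gs \<subseteq> {r. x * r \<in> icomb Q gs}"
      proof (rule submod_lcomb_subset[of "\<lambda>x. x"])
        show "submod (\<lambda>x. x) {r. x * r \<in> icomb Q gs}"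
          using is_ideal_colon[OF is_ideal_icomb[OF Qi], of "{x}" gs]
          by (simp add: submod_ident mult.commute)
        show "set gs \<subseteq> {r. x * r \<in> icomb Q gs}"
          using lcomb_mem[of _ gs x Q "\<lambda>x. x"] \<open>x \<in> Q\<close> ideal_zero[OF Qi] by auto
      qed
      then show ?thesis using \<open>r \<in> J n\<close> gs by auto
    qed
    then have "r * x \<in> icomb Q gs" by (simp add: mult.commute)
    then show "\<exists>s j y. s \<notin> Q \<and> j \<in> J (Suc n) \<and> y \<in> icomb Q gs \<and> s * g = j + y"
      using s by blast
  qed
  then have "J n \<subseteq> J (Suc n)"
    unfolding gs(1) by (intro submod_lcomb_subset) (auto simp: submod_ident Ji)
  moreover have "y ^ n \<in> J n"
    unfolding J_def using subset_saturation[OF W1] self_mem_ideal_insert[OF Pi] by blast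
  ultimately obtain w z r where w: "w \<in> W" "z \<in> P" "w * y ^ n = z + r * y ^ Suc n"
    unfolding J_def saturation_def ideal_insert_def by blast
  \<comment> \<open>Cancelling y^n modulo P puts w into (y) + P, hence into Q0, although w is a
    product of elements outside Q0.\<close>
  have "y ^ n * (w - r * y) = z" using w by (simp add: algebra_simps)
  then have "w - r * y \<in> P" using w y prime_ideal_mult_iff[OF P] prime_ideal_power_iff[OF P] by metis
  moreover have "w = (w - r * y) + r * y" by simp
  ultimately have "w \<in> ideal_insert y P" unfolding ideal_insert_def by blast
  then have "w \<in> Q0" using yQ0 by blast
  moreover obtain s t where "w = s * x ^ t" "s \<notin> Q" using w by (auto simp: W_def)
  ultimately show False
    using xQ0 Q0 by (auto simp: prime_ideal_mult_iff[OF Q0p] prime_ideal_power_iff[OF Q0p])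
qed

text \<open>The hypothesis says that, up to torsion, y^n has order at least k n for every k and a
  suitable n. If y is not nilpotent, a prime P avoiding its powers has m^b in (y) + P, hence m^(b n)
  in (y^n) + P, whereas y^n lies in m^((b + 1) n) modulo P. Nakayama's lemma then gives m^(b n) in P
  and so y in P.\<close>

lemma nilpotent_if_powers_deep:
  fixes m :: "'a::comm_ring_1 set"
  assumes noeth: "noetherian_ring TYPE('a)" and m: "local_ring m" and mgen: "m = ideal_gen xs"
    and y: "y \<in> m"
    and deep: "\<And>k. \<exists>n>0. \<exists>w\<in>ideal_pow m (k * n). \<exists>t. \<forall>x\<in>set xs. x ^ t * (y ^ n - w) = 0"
  shows "\<exists>n. y ^ n = 0"
proof (rule ccontr)
  assume neg: "\<nexists>n. y ^ n = 0"
  have "is_ideal {0::'a}" by (simp add: is_ideal_def)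
  then obtain P where P: "prime_ideal P" "y \<notin> P"
    and above: "\<And>J. is_ideal J \<Longrightarrow> P \<subset> J \<Longrightarrow> \<exists>n. y ^ n \<in> J"
    by (rule prime_ideal_avoiding_powers[OF noeth, of "{0}" y]) (use neg in auto)
  note Pi = prime_ideal_is_ideal[OF P(1)] and mi = local_ring_is_ideal[OF m]
  have "\<not> set xs \<subseteq> P" using ideal_gen_subset[OF Pi, of xs] mgen y P(2) by blast
  then obtain x where x: "x \<in> set xs" "x \<notin> P" by blast
  have "\<exists>b. ideal_pow m b \<subseteq> ideal_insert y P"
  proof (rule power_maximal_subset_if_primes_contain[OF noeth m P(1) y P(2)])
    fix J assume "prime_ideal J" "P \<subset> J"
    then show "y \<in> J" using above[of J] by (auto simp: prime_ideal_is_ideal prime_ideal_power_iff)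
  qed
  then obtain b where b: "ideal_pow m b \<subseteq> ideal_insert y P" by blast
  \<comment> \<open>Because n > 0, (b + 1) n exceeds b n, so w lies in m times m^(b n). The factor
    x^t is cancelled modulo P, as x is outside P.\<close>
  obtain n w t where n: "n > 0" "w \<in> ideal_pow m (Suc b * n)" "x ^ t * (y ^ n - w) = 0"
    using deep[of "Suc b"] x by blast
  have ynw: "y ^ n - w \<in> P"
    using n(3) x(2) ideal_zero[OF Pi] prime_ideal_mult_iff[OF P(1), of "x ^ t"] prime_ideal_power_iff[OF P(1)] by metis
  have pow: "ideal_pow m (b * i) \<subseteq> ideal_insert (y ^ i) P" for i
  proof (induction i)
    case 0
    have "1 \<in> ideal_insert 1 P" by (rule self_mem_ideal_insert[OF Pi])
    then show ?case using ideal_one_UNIV[OF is_ideal_ideal_insert[OF Pi]] by auto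
  next
    case (Suc i)
    have "ideal_pow m (b * i + b) \<subseteq> ideal_insert (y ^ Suc i) P"
    proof (rule ideal_pow_add_subset[OF is_ideal_ideal_insert[OF Pi]])
      fix u v assume "u \<in> ideal_pow m (b * i)" "v \<in> ideal_pow m b"
      then obtain p1 r1 p2 r2 where *: "u = p1 + r1 * y ^ i" "v = p2 + r2 * y" "p1 \<in> P" "p2 \<in> P"
        using Suc b unfolding ideal_insert_def by blast
      have "u * v = ((p2 + r2 * y) * p1 + r1 * y ^ i * p2) + (r1 * r2) * y ^ Suc i"
        using * by (simp add: algebra_simps)
      moreover have "(p2 + r2 * y) * p1 + r1 * y ^ i * p2 \<in> P"
        using * by (simp add: ideal_add[OF Pi] ideal_mult_left[OF Pi])
      ultimately show "u * v \<in> ideal_insert (y ^ Suc i) P" unfolding ideal_insert_def by blast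
    qed
    then show ?case by (simp add: add.commute)
  qed
  obtain gs where gs: "ideal_pow m (b * n) = icomb UNIV gs" "set gs \<subseteq> ideal_pow m (b * n)"
    using noetherian_fg[OF noeth is_ideal_ideal_pow] by metis
  have mgs: "ideal_pow m (Suc (b * n)) \<subseteq> icomb m gs"
    unfolding ideal_pow.simps(2)
  proof (rule ideal_span_minimal[OF is_ideal_icomb[OF mi]], clarify)
    fix u v assume u: "u \<in> ideal_pow m (b * n)" and v: "v \<in> m"
    have "icomb UNIV gs \<subseteq> {r. v * r \<in> icomb m gs}"
    proof (rule submod_lcomb_subset[of "\<lambda>x. x"])
      show "submod (\<lambda>x. x) {r. v * r \<in> icomb m gs}"
        using is_ideal_colon[OF is_ideal_icomb[OF mi], of "{v}" gs]
        by (simp add: submod_ident mult.commute)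
      show "set gs \<subseteq> {r. v * r \<in> icomb m gs}"
        using lcomb_mem[of _ gs v m "\<lambda>x. x"] v ideal_zero[OF mi] by auto
    qed
    then show "u * v \<in> icomb m gs" using u gs by (auto simp: mult.commute)
  qed
  have "set gs \<subseteq> P"
  proof (rule nakayama_saturated[OF local_ring_prime[OF m] Pi])
    fix s u assume "s \<notin> m" "s * u \<in> P"
    then show "u \<in> P"
      using prime_ideal_mult_iff[OF P(1)] local_ring_ideal_subset[OF m Pi] P(1)
      by (auto simp: prime_ideal_def)
  next
    fix g assume "g \<in> set gs"
    then have "g \<in> ideal_insert (y ^ n) P" using gs pow by blast
    then obtain z r where z: "z \<in> P" "g = z + r * y ^ n" by (auto simp: ideal_insert_def)
    have "g = (z + r * (y ^ n - w)) + r * w" using z by (simp add: algebra_simps)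
    moreover have "z + r * (y ^ n - w) \<in> P" using z ynw by (simp add: ideal_add[OF Pi] ideal_mult_left[OF Pi])
    moreover have "r * w \<in> icomb m gs"
    proof -
      have "w \<in> ideal_pow m (Suc (b * n))"
        using n by (intro ideal_pow_mono_mem[OF n(2)]) (simp add: algebra_simps)
      then show ?thesis using mgs ideal_mult_left[OF is_ideal_icomb[OF mi]] by blast
    qed
    ultimately show "\<exists>s j y. s \<notin> m \<and> j \<in> P \<and> y \<in> icomb m gs \<and> s * g = j + y"
      using local_ring_one[OF m] by (metis mult_1)
  qed
  then have "ideal_pow m (b * n) \<subseteq> P"
    unfolding gs(1) by (intro submod_lcomb_subset) (auto simp: submod_ident Pi)
  then have "y ^ (b * n) \<in> P" using ideal_power_mem_pow[OF mi y] by blast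
  then show False using P(2) prime_ideal_power_iff[OF P(1)] by blast
qed

section \<open>Sections over the punctured spectrum\<close>

lemma CHAR_eq_if_of_nat_eq_0:
  "prime p \<Longrightarrow> of_nat p = (0::'a::comm_ring_1) \<Longrightarrow> CHAR('a) = p"
  using of_nat_eq_0_iff_char_dvd[of p, where ?'a = 'a] prime_nat_iff[of p] CHAR_not_1[where ?'a = 'a]
  by auto

text \<open>\<open>S\<close> models the sections over the punctured spectrum, with
  \<open>\<phi>\<close> as restriction and \<phi> 1 as unit. \<open>separated\<close>,
  \<open>kernel\<close>, \<open>denominators\<close> and \<open>glue\<close> are the sheaf
  properties for the cover by the D(x) with x in \<open>xs\<close>; assuming them keeps the argument
  independent of how localizations are built.\<close>

locale punctured_sections =
  fixes m K :: "'a::comm_ring_1 set" and p :: nat and xs :: "'a list"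
    and \<phi> :: "'a \<Rightarrow> 'b::comm_ring_1" and S :: "'b set"
  assumes noeth: "noetherian_ring TYPE('a)"
    and local: "local_ring m"
    and complete: "madic_complete m"
    and coeff: "coefficient_field m K"
    and closed: "alg_closed_subfield K"
    and p_prime: "prime p"
    and char_a: "of_nat p = (0::'a)"
    and m_gen: "m = ideal_gen xs"
    and hom: "rhom \<phi>"
    and char_b: "of_nat p = (0::'b)"
    and S_submod: "submod \<phi> S"
    and S_mult: "\<And>s t. s \<in> S \<Longrightarrow> t \<in> S \<Longrightarrow> s * t \<in> S"
    and S_range: "range \<phi> \<subseteq> S"
    and S_one: "\<And>s. s \<in> S \<Longrightarrow> \<phi> 1 * s = s"
    and separated: "\<And>s N. s \<in> S \<Longrightarrow> (\<And>x. x \<in> set xs \<Longrightarrow> \<phi> x ^ N * s = 0) \<Longrightarrow> s = 0"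
    and kernel: "\<And>r. \<phi> r = 0 \<longleftrightarrow> (\<exists>t. \<forall>x\<in>set xs. x ^ t * r = 0)"
    and denominators: "\<And>s. s \<in> S \<Longrightarrow> \<exists>N. \<forall>x\<in>set xs. \<phi> x ^ N * s \<in> range \<phi>"
    and glue: "\<And>r N. cech_cocycle xs (r, N) \<Longrightarrow>
      \<exists>s\<in>S. \<exists>t. \<forall>i<length xs. \<phi> (xs ! i) ^ t * (\<phi> (xs ! i) ^ N * s - \<phi> (r i)) = 0"
    and nontrivial: "\<phi> 1 \<noteq> 0"
begin

lemma m_ideal: "is_ideal m" using local by (rule local_ring_is_ideal)

lemma gen_in_m: "x \<in> set xs \<Longrightarrow> x \<in> m" using m_gen ideal_gen_mem by auto

lemma p_pos: "p ^ e > 0" using p_prime prime_gt_0_nat by simp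

lemma frob_add: "((s::'b) + t) ^ p ^ e = s ^ p ^ e + t ^ p ^ e"
  using freshmans_dream'[where ?'a = 'b, of "p ^ e" e s t] CHAR_eq_if_of_nat_eq_0[OF p_prime char_b] p_prime
  by simp

lemma frob_add_a: "((s::'a) + t) ^ p ^ e = s ^ p ^ e + t ^ p ^ e"
  using freshmans_dream'[where ?'a = 'a, of "p ^ e" e s t] CHAR_eq_if_of_nat_eq_0[OF p_prime char_a] p_prime
  by simp

lemma frob_diff: "((s::'b) - t) ^ p ^ e = s ^ p ^ e - t ^ p ^ e"
  using frob_add[of "s - t" t e] by (simp add: algebra_simps)

lemma frob_diff_a: "((s::'a) - t) ^ p ^ e = s ^ p ^ e - t ^ p ^ e"
  using frob_add_a[of "s - t" t e] by (simp add: algebra_simps)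

lemma frob_sum: "(sum f I :: 'b) ^ p ^ e = (\<Sum>i\<in>I. f i ^ p ^ e)"
  using p_pos[of e] by (induction I rule: infinite_finite_induct) (auto simp: frob_add power_0_left)

lemma \<phi>_add: "\<phi> (a + b) = \<phi> a + \<phi> b" and \<phi>_mult: "\<phi> (a * b) = \<phi> a * \<phi> b"
  and \<phi>_zero: "\<phi> 0 = 0" and \<phi>_diff: "\<phi> (a - b) = \<phi> a - \<phi> b"
  and \<phi>_power: "n > 0 \<Longrightarrow> \<phi> (a ^ n) = \<phi> a ^ n"
  using rhom_add[OF hom] rhom_mult[OF hom] rhom_zero[OF hom] rhom_diff[OF hom] rhom_power[OF hom] by auto

lemma S_pow: "s \<in> S \<Longrightarrow> n > 0 \<Longrightarrow> s ^ n \<in> S"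
proof (induction n)
  case (Suc n)
  then show ?case by (cases n) (auto intro: S_mult)
qed auto

text \<open>The factor s absorbs the case n = 0, where \<phi> (a ^ 0) is \<phi> 1 and not 1.\<close>

lemma \<phi>_power_mult: "s \<in> S \<Longrightarrow> \<phi> (a ^ n) * s = \<phi> a ^ n * s"
  using S_one \<phi>_power[of n a] by (cases n) auto

lemma S_\<phi>: "\<phi> r \<in> S" using S_range by auto

lemma S_scale: "s \<in> S \<Longrightarrow> \<phi> r * s \<in> S" by (rule S_mult[OF S_\<phi>])

lemma S_scale_pow: "s \<in> S \<Longrightarrow> \<phi> r ^ n * s \<in> S"
  using S_scale[of s "r ^ n"] \<phi>_power_mult[of s r n] by simp

lemmas S_diff = submod_diff[OF S_submod] and S_add = submod_add[OF S_submod]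

lemma submod_range: "submod \<phi> (range \<phi>)"
  unfolding submod_def
  by (auto simp: \<phi>_diff[symmetric] \<phi>_mult[symmetric] \<phi>_zero[symmetric] simp del: \<phi>_diff)

lemmas range_diff = submod_diff[OF submod_range] and range_add = submod_add[OF submod_range]
  and range_mult = submod_mult[OF submod_range] and range_zero = submod_zero[OF submod_range]
  and range_sum = submod_sum[OF submod_range]

lemma range_pow: "s \<in> range \<phi> \<Longrightarrow> n > 0 \<Longrightarrow> s ^ n \<in> range \<phi>"
  using \<phi>_power by (metis imageE rangeI)

lemma range_frob_mono:
  assumes "s ^ p ^ e \<in> range \<phi>" "e \<le> e'"
  shows "s ^ p ^ e' \<in> range \<phi>"
proof -
  have "s ^ p ^ e' = (s ^ p ^ e) ^ p ^ (e' - e)"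
    using assms(2) by (simp add: power_mult[symmetric] power_add[symmetric])
  then show ?thesis using range_pow[OF assms(1) p_pos, of "e' - e"] by (simp only:)
qed

lemma scale_in_range_if_gens:
  assumes "\<And>x. x \<in> set xs \<Longrightarrow> \<phi> x * s \<in> range \<phi>" "r \<in> m"
  shows "\<phi> r * s \<in> range \<phi>"
proof -
  have "is_ideal {r. \<phi> r * s \<in> range \<phi>}"
    unfolding is_ideal_def
    using range_add range_mult range_zero
    by (auto simp: \<phi>_add \<phi>_mult \<phi>_zero distrib_right mult.assoc)
  then have "ideal_gen xs \<subseteq> {r. \<phi> r * s \<in> range \<phi>}"
    by (rule ideal_gen_subset) (use assms in auto)
  then show ?thesis using assms m_gen by auto
qed

lemma unit_cancel:
  assumes "submod \<phi> A" "s \<in> S" "r \<notin> m" "\<phi> r * s \<in> A"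
  shows "s \<in> A"
proof -
  obtain r' where "r * r' = 1" using local_ring_inverse[OF local assms(3)] .
  moreover have "\<phi> r' * (\<phi> r * s) = \<phi> (r * r') * s" by (simp only: \<phi>_mult ac_simps)
  ultimately have "\<phi> r' * (\<phi> r * s) = s" using S_one[OF assms(2)] by simp
  then show ?thesis using submod_mult[OF assms(1,4), of r'] by simp
qed

text \<open>Multiplication by \<phi> x ^ N maps A onto the image of an ideal of R, and its kernel
  needs one denominator fewer. With no \<open>ys\<close> left, the separation hypothesis makes A
  zero.\<close>

lemma fg_bounded_denominators:
  "submod \<phi> A \<Longrightarrow> A \<subseteq> S \<Longrightarrow> (\<And>s x. s \<in> A \<Longrightarrow> x \<in> set ys \<Longrightarrow> \<phi> x ^ N * s \<in> range \<phi>) \<Longrightarrow>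
    (\<And>s. s \<in> A \<Longrightarrow> (\<And>x. x \<in> set ys \<Longrightarrow> \<phi> x ^ N * s = 0) \<Longrightarrow> s = 0) \<Longrightarrow>
    \<exists>gs. set gs \<subseteq> A \<and> A \<subseteq> lcomb \<phi> UNIV gs"
proof (induction ys arbitrary: A)
  case Nil
  then show ?case by (intro exI[of _ "[]"]) auto
next
  case (Cons x ys)
  note A = Cons.prems(1)
  let ?A = "{s \<in> A. \<phi> x ^ N * s = 0}"
  have "\<exists>gs. set gs \<subseteq> ?A \<and> ?A \<subseteq> lcomb \<phi> UNIV gs"
  proof (rule Cons.IH)
    show "submod \<phi> ?A"
      using A unfolding submod_def by (auto simp: right_diff_distrib mult.left_commute)
    show "?A \<subseteq> S" using Cons.prems(2) by auto
    show "\<phi> y ^ N * s \<in> range \<phi>" if "s \<in> ?A" "y \<in> set ys" for s y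
      using Cons.prems(3) that by auto
    show "s = 0" if "s \<in> ?A" "\<And>y. y \<in> set ys \<Longrightarrow> \<phi> y ^ N * s = 0" for s
      using Cons.prems(4)[of s] that by auto
  qed
  then obtain gs where gs: "set gs \<subseteq> ?A" "?A \<subseteq> lcomb \<phi> UNIV gs" by blast
  define I where "I = {r. \<exists>s\<in>A. \<phi> r = \<phi> x ^ N * s}"
  have I: "is_ideal I"
    unfolding is_ideal_def
  proof (intro conjI ballI allI)
    show "0 \<in> I" unfolding I_def using submod_zero[OF A] \<phi>_zero by force
  next
    fix a b assume "a \<in> I" "b \<in> I"
    then obtain s t where "s \<in> A" "t \<in> A" "\<phi> a = \<phi> x ^ N * s" "\<phi> b = \<phi> x ^ N * t"
      by (auto simp: I_def)
    then show "a + b \<in> I" unfolding I_def using submod_add[OF A, of s t]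
      by (auto simp: \<phi>_add distrib_left intro!: bexI[of _ "s + t"])
  next
    fix r a assume "a \<in> I"
    then obtain s where "s \<in> A" "\<phi> a = \<phi> x ^ N * s" by (auto simp: I_def)
    then show "r * a \<in> I" unfolding I_def using submod_mult[OF A, of s r]
      by (auto simp: \<phi>_mult mult.left_commute intro!: bexI[of _ "\<phi> r * s"])
  qed
  obtain rs where rs: "I = icomb UNIV rs" "set rs \<subseteq> I" using noetherian_fg[OF noeth I] .
  have "\<forall>r\<in>set rs. \<exists>s\<in>A. \<phi> r = \<phi> x ^ N * s" using rs(2) by (auto simp: I_def)
  then obtain a where a: "\<And>r. r \<in> set rs \<Longrightarrow> a r \<in> A \<and> \<phi> r = \<phi> x ^ N * a r" by metis
  have lift: "\<exists>s'\<in>lcomb \<phi> UNIV (map a rs'). \<phi> r = \<phi> x ^ N * s'"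
    if "set rs' \<subseteq> set rs" "r \<in> icomb UNIV rs'" for r rs'
    using that
  proof (induction rs' arbitrary: r)
    case Nil
    then show ?case by (simp add: \<phi>_zero)
  next
    case (Cons r1 rs')
    from Cons.prems obtain q y where qy: "r = q * r1 + y" "y \<in> icomb UNIV rs'" by auto
    then obtain s' where s': "s' \<in> lcomb \<phi> UNIV (map a rs')" "\<phi> y = \<phi> x ^ N * s'"
      using Cons.IH Cons.prems by auto
    have "\<phi> r = \<phi> x ^ N * (\<phi> q * a r1 + s')"
      using qy s' a[of r1] Cons.prems by (simp add: \<phi>_add \<phi>_mult algebra_simps)
    then show ?case using s' by auto
  qed
  have "A \<subseteq> lcomb \<phi> UNIV (map a rs @ gs)"
  proof
    fix s assume s: "s \<in> A"
    then obtain r where r: "\<phi> x ^ N * s = \<phi> r" using Cons.prems(3)[of s x] by auto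
    then have "r \<in> I" unfolding I_def using s by (intro CollectI bexI[of _ s]) simp_all
    then obtain s' where s': "s' \<in> lcomb \<phi> UNIV (map a rs)" "\<phi> r = \<phi> x ^ N * s'"
      using lift[of rs r] rs by auto
    have "lcomb \<phi> UNIV (map a rs) \<subseteq> A" using a by (intro submod_lcomb_subset[OF A]) auto
    then have "s - s' \<in> ?A" using s s' r submod_diff[OF A] by (auto simp: right_diff_distrib)
    then have "s - s' \<in> lcomb \<phi> UNIV gs" using gs by blast
    moreover have sub: "lcomb \<phi> UNIV gs \<subseteq> lcomb \<phi> UNIV (map a rs @ gs)"
      "lcomb \<phi> UNIV (map a rs) \<subseteq> lcomb \<phi> UNIV (map a rs @ gs)"
    proof -
      have "set gs \<union> set (map a rs) \<subseteq> lcomb \<phi> UNIV (map a rs @ gs)"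
      proof
        fix g assume g: "g \<in> set gs \<union> set (map a rs)"
        then have "g \<in> S" using gs a Cons.prems(2) by auto
        then show "g \<in> lcomb \<phi> UNIV (map a rs @ gs)"
          using lcomb_mem[of g "map a rs @ gs" 1 UNIV \<phi>] g S_one \<phi>_zero by auto
      qed
      then show "lcomb \<phi> UNIV gs \<subseteq> lcomb \<phi> UNIV (map a rs @ gs)"
        "lcomb \<phi> UNIV (map a rs) \<subseteq> lcomb \<phi> UNIV (map a rs @ gs)"
        using submod_lcomb_subset[OF submod_lcomb[OF hom is_ideal_UNIV]] by blast+
    qed
    ultimately show "s \<in> lcomb \<phi> UNIV (map a rs @ gs)"
      using submod_add[OF submod_lcomb[OF hom is_ideal_UNIV], of "s - s'" "map a rs @ gs" s'] s' by auto
  qed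
  moreover have "set (map a rs @ gs) \<subseteq> A" using a gs by auto
  ultimately show ?case by blast
qed

lemma fg_bounded:
  assumes "submod \<phi> A" "A \<subseteq> S" "\<And>s x. s \<in> A \<Longrightarrow> x \<in> set xs \<Longrightarrow> \<phi> x ^ N * s \<in> range \<phi>"
  shows "\<exists>gs. set gs \<subseteq> A \<and> A \<subseteq> lcomb \<phi> UNIV gs"
  by (rule fg_bounded_denominators[where ys = xs and N = N]) (use assms separated in blast)+

subsection \<open>The first local cohomology module is Artinian\<close>

text \<open>Such A are the preimages of the submodules of H^1, so \<open>dcc M\<close> below is the
  descending chain condition for those inside M.\<close>

definition rsub :: "'b set \<Rightarrow> bool" where
  "rsub A \<longleftrightarrow> submod \<phi> A \<and> range \<phi> \<subseteq> A \<and> A \<subseteq> S"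

text \<open>The preimage of the part of H^1 killed by \<open>ys\<close>: the socle for
  \<open>xs\<close>, everything for the empty list.\<close>

definition annihilated :: "'a list \<Rightarrow> 'b set" where
  "annihilated ys = {s \<in> S. \<forall>x\<in>set ys. \<phi> x * s \<in> range \<phi>}"

definition dcc :: "'b set \<Rightarrow> bool" where
  "dcc M \<longleftrightarrow> (\<forall>A. (\<forall>i. rsub (A i) \<and> A i \<subseteq> M) \<and> (\<forall>i j. i \<le> j \<longrightarrow> A j \<subseteq> A i) \<longrightarrow> stationary A)"

lemma rsub_annihilated: "rsub (annihilated ys)"
proof -
  have "submod \<phi> (annihilated ys)"
    unfolding submod_def annihilated_def
    using submod_zero[OF S_submod] S_diff S_scale range_diff range_zero range_mult
    by (auto simp: right_diff_distrib mult.left_commute)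
  moreover have "range \<phi> \<subseteq> annihilated ys"
    unfolding annihilated_def using S_range range_mult by auto
  ultimately show ?thesis unfolding rsub_def annihilated_def by auto
qed

text \<open>Denominators in the socle are bounded by exponent 1, so it is finitely generated; as m
  multiplies it into R', it has finite length modulo R'.\<close>

lemma dcc_socle: "dcc (annihilated xs)"
  unfolding dcc_def
proof (intro allI impI)
  fix A :: "nat \<Rightarrow> 'b set"
  assume A: "(\<forall>i. rsub (A i) \<and> A i \<subseteq> annihilated xs) \<and> (\<forall>i j. i \<le> j \<longrightarrow> A j \<subseteq> A i)"
  have "\<exists>gs. set gs \<subseteq> annihilated xs \<and> annihilated xs \<subseteq> lcomb \<phi> UNIV gs"
    using rsub_annihilated[of xs]
    by (intro fg_bounded[of _ 1]) (auto simp: rsub_def annihilated_def)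
  then obtain gs where gs: "set gs \<subseteq> annihilated xs" "annihilated xs \<subseteq> lcomb \<phi> UNIV gs" by blast
  have "stationary (\<lambda>i. A i \<inter> set_plus (range \<phi>) (lcomb \<phi> UNIV gs))"
  proof (rule stationary_steps[where Q = m, OF hom])
    show "A j \<subseteq> A i" if "i \<le> j" for i j using A that by auto
    show "submod \<phi> (A i)" for i using A by (auto simp: rsub_def)
    show "a \<in> A i" if "r \<notin> m" "a \<in> A 0" "\<phi> r * a \<in> A i" for i r a
    proof (rule unit_cancel[OF _ _ that(1,3)])
      show "submod \<phi> (A i)" "a \<in> S" using A that by (auto simp: rsub_def)
    qed
    show "submod \<phi> (range \<phi>)" by (rule submod_range)
    show "\<phi> r * g \<in> range \<phi>" if "r \<in> m" "g \<in> set gs" for r g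
      by (rule scale_in_range_if_gens[OF _ that(1)]) (use that gs(1) in \<open>auto simp: annihilated_def\<close>)
    have "A i \<inter> range \<phi> = range \<phi>" for i using A unfolding rsub_def by blast
    then show "stationary (\<lambda>i. A i \<inter> range \<phi>)" by (simp add: stationary_def)
  qed
  moreover have "A i \<inter> set_plus (range \<phi>) (lcomb \<phi> UNIV gs) = A i" for i
  proof -
    have "A i \<subseteq> lcomb \<phi> UNIV gs" using A gs(2) by blast
    also have "\<dots> \<subseteq> set_plus (range \<phi>) (lcomb \<phi> UNIV gs)" by (rule set_plus_right[OF submod_range])
    finally show ?thesis by blast
  qed
  ultimately show "stationary A" by simp
qed

text \<open>If every element is killed by a power of x and the part killed by x is Artinian, then so
  is the whole: a chain is controlled by the layers x^k (A i \<inter> (0 : x^(k+1))), all inside the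
  part killed by x. The sets \<open>B i k\<close> are these layers, read modulo R'.\<close>

lemma dcc_step:
  assumes dcc: "dcc (annihilated (x # ys))" and x: "x \<in> set xs"
  shows "dcc (annihilated ys)"
  unfolding dcc_def
proof (intro allI impI)
  fix A :: "nat \<Rightarrow> 'b set"
  assume asm: "(\<forall>i. rsub (A i) \<and> A i \<subseteq> annihilated ys) \<and> (\<forall>i j. i \<le> j \<longrightarrow> A j \<subseteq> A i)"
  then have A: "submod \<phi> (A i)" and AR: "range \<phi> \<subseteq> A i" and AS: "A i \<subseteq> S"
    and Ay: "A i \<subseteq> annihilated ys" and anti: "i \<le> j \<Longrightarrow> A j \<subseteq> A i" for i j
    by (auto simp: rsub_def)
  define B where "B i k = {\<phi> x ^ k * a + r | a r. a \<in> A i \<and> \<phi> x ^ Suc k * a \<in> range \<phi> \<and> r \<in> range \<phi>}" for i k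
  have B_mono: "B j l \<subseteq> B i k" if ij: "i \<le> j" and kl: "k \<le> l" for i j k l
  proof
    fix b assume "b \<in> B j l"
    then obtain a r where a: "b = \<phi> x ^ l * a + r" "a \<in> A j" "\<phi> x ^ Suc l * a \<in> range \<phi>" "r \<in> range \<phi>"
      by (auto simp: B_def)
    let ?a = "\<phi> x ^ (l - k) * a"
    have "?a \<in> A i"
      using submod_mult[OF A[of i], of a "x ^ (l - k)"] \<phi>_power_mult[of a x "l - k"] a(2) anti[OF ij] AS[of j]
      by (metis subsetD)
    moreover have eq: "\<phi> x ^ k * ?a = \<phi> x ^ l * a"
      using kl by (simp add: mult.assoc[symmetric] power_add[symmetric])
    moreover have "\<phi> x ^ Suc k * ?a = \<phi> x ^ Suc l * a"
      by (simp only: power_Suc mult.assoc eq)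
    ultimately show "b \<in> B i k" unfolding B_def using a by force
  qed
  have B_rsub: "rsub (B i k) \<and> B i k \<subseteq> annihilated (x # ys)" for i k
  proof -
    have mem: "\<phi> x ^ k * a + r \<in> B i k" if "a \<in> A i" "\<phi> x ^ Suc k * a \<in> range \<phi>" "r \<in> range \<phi>" for a r
      using that by (auto simp: B_def)
    have "submod \<phi> (B i k)"
      unfolding submod_def
    proof (intro conjI ballI allI)
      show "0 \<in> B i k" using mem[of 0 0] submod_zero[OF A] range_zero by simp
    next
      fix b c assume "b \<in> B i k" "c \<in> B i k"
      then obtain a r a' r' where
        a: "b = \<phi> x ^ k * a + r" "a \<in> A i" "\<phi> x ^ Suc k * a \<in> range \<phi>" "r \<in> range \<phi>" and
        a': "c = \<phi> x ^ k * a' + r'" "a' \<in> A i" "\<phi> x ^ Suc k * a' \<in> range \<phi>" "r' \<in> range \<phi>"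
        by (auto simp: B_def)
      have "\<phi> x ^ k * (a - a') + (r - r') \<in> B i k"
      proof (rule mem)
        show "a - a' \<in> A i" using a a' submod_diff[OF A] by auto
        show "\<phi> x ^ Suc k * (a - a') \<in> range \<phi>"
          using range_diff[OF a(3) a'(3)] by (simp only: right_diff_distrib)
        show "r - r' \<in> range \<phi>" using range_diff a a' by auto
      qed
      then show "b - c \<in> B i k" using a(1) a'(1) by (simp add: algebra_simps)
    next
      fix q b assume "b \<in> B i k"
      then obtain a r where
        a: "b = \<phi> x ^ k * a + r" "a \<in> A i" "\<phi> x ^ Suc k * a \<in> range \<phi>" "r \<in> range \<phi>"
        by (auto simp: B_def)
      have "\<phi> x ^ k * (\<phi> q * a) + \<phi> q * r \<in> B i k"
      proof (rule mem)
        show "\<phi> q * a \<in> A i" using a submod_mult[OF A] by auto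
        show "\<phi> x ^ Suc k * (\<phi> q * a) \<in> range \<phi>"
          using range_mult[OF a(3), of q] by (simp only: mult.left_commute)
        show "\<phi> q * r \<in> range \<phi>" using range_mult a by auto
      qed
      then show "\<phi> q * b \<in> B i k" using a(1) by (simp add: distrib_left mult.left_commute)
    qed
    moreover have "range \<phi> \<subseteq> B i k"
      using mem[of 0] submod_zero[OF A] range_zero by (metis add_0 mult_zero_right subsetI)
    moreover have "B i k \<subseteq> annihilated (x # ys)"
    proof
      fix b assume "b \<in> B i k"
      then obtain a r where
        a: "b = \<phi> x ^ k * a + r" "a \<in> A i" "\<phi> x ^ Suc k * a \<in> range \<phi>" "r \<in> range \<phi>"
        by (auto simp: B_def)
      have aS: "a \<in> S" and ay: "\<And>y. y \<in> set ys \<Longrightarrow> \<phi> y * a \<in> range \<phi>"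
        using a(2) Ay by (auto simp: annihilated_def)
      have "b \<in> S" using a(1,4) S_scale_pow[OF aS] S_range S_add by auto
      moreover have "\<phi> x * b \<in> range \<phi>"
        using range_add[OF a(3) range_mult[OF a(4), of x]] a(1) by (simp add: distrib_left mult.assoc)
      moreover have "\<phi> y * b \<in> range \<phi>" if "y \<in> set ys" for y
      proof -
        have "\<phi> y * a \<in> S" using S_scale[OF aS] .
        then have "\<phi> x ^ k * (\<phi> y * a) \<in> range \<phi>"
          using range_mult[OF ay[OF that], of "x ^ k"] \<phi>_power_mult by auto
        then show ?thesis
          using range_add[OF _ range_mult[OF a(4), of y]] a(1) by (simp add: distrib_left mult.left_commute)
      qed
      ultimately show "b \<in> annihilated (x # ys)" by (auto simp: annihilated_def)
    qed
    ultimately show ?thesis unfolding rsub_def by (auto simp: annihilated_def)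
  qed
  have st: "stationary (\<lambda>i. B i k)" for k
    by (rule dcc[unfolded dcc_def, THEN spec, THEN mp]) (simp add: B_rsub B_mono)
  \<comment> \<open>The diagonal stabilizes at k0, which settles all k \<ge> k0 by squeezing; the
    finitely many k below k0 stabilize separately. One n thus serves every k.\<close>
  have "stationary (\<lambda>k. B k k)"
    by (rule dcc[unfolded dcc_def, THEN spec, THEN mp]) (simp add: B_rsub B_mono)
  then obtain k0 where k0: "\<And>k. k \<ge> k0 \<Longrightarrow> B k k = B k0 k0" unfolding stationary_def by blast
  from st obtain f where f: "\<And>k i. i \<ge> f k \<Longrightarrow> B i k = B (f k) k" unfolding stationary_def by metis
  define n where "n = Max (insert k0 (f ` {..<k0}))"
  have n: "n \<ge> k0" "\<And>k. k < k0 \<Longrightarrow> n \<ge> f k" unfolding n_def by (auto intro: Max_ge)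
  have Bn: "B i k = B n k" if "i \<ge> n" for i k
  proof (cases "k < k0")
    case True
    then show ?thesis using f n(2)[OF True] that by (metis order.trans)
  next
    case False
    have "B j k = B k0 k0" if "j \<ge> k0" for j
    proof
      show "B j k \<subseteq> B k0 k0" using that False by (intro B_mono) auto
      have "B (max j k) (max j k) \<subseteq> B j k" by (intro B_mono) auto
      then show "B k0 k0 \<subseteq> B j k" using k0[of "max j k"] that by auto
    qed
    then show ?thesis using that n(1) by auto
  qed
  \<comment> \<open>Induction on the power of x that moves a into R': equality of the layers
    supplies a' in A i with x^k a and x^k a' congruent modulo R', and a - a' needs one power
    less.\<close>
  have desc: "a \<in> A i" if "i \<ge> n" "a \<in> A n" "\<phi> x ^ k * a \<in> range \<phi>" for i k a
    using that(2,3)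
  proof (induction k arbitrary: a)
    case 0
    then show ?case using AR by auto
  next
    case (Suc k)
    have "\<phi> x ^ k * a + 0 \<in> B n k" unfolding B_def using Suc.prems range_zero by blast
    then have "\<phi> x ^ k * a \<in> B i k" using Bn[OF that(1)] by simp
    then obtain a' r where a': "\<phi> x ^ k * a = \<phi> x ^ k * a' + r" "a' \<in> A i" "r \<in> range \<phi>"
      unfolding B_def by blast
    have "a - a' \<in> A n" using Suc.prems(1) a'(2) anti[OF that(1)] submod_diff[OF A] by auto
    moreover have "\<phi> x ^ k * (a - a') \<in> range \<phi>" using a' by (simp add: right_diff_distrib)
    ultimately have "a - a' \<in> A i" by (rule Suc.IH)
    then show ?case using submod_add[OF A, of "a - a'" i a'] a'(2) by simp
  qed
  have "A i = A n" if "i \<ge> n" for i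
  proof
    show "A i \<subseteq> A n" by (rule anti[OF that])
    show "A n \<subseteq> A i"
    proof
      fix a assume a: "a \<in> A n"
      then obtain N where "\<phi> x ^ N * a \<in> range \<phi>" using denominators[of a] AS x by blast
      then show "a \<in> A i" using desc[OF that a] by blast
    qed
  qed
  then show "stationary A" unfolding stationary_def by blast
qed

lemma artinian: "dcc S"
proof -
  have "dcc (annihilated ys)" if "xs = zs @ ys" for ys zs
    using that
  proof (induction zs arbitrary: ys rule: rev_induct)
    case Nil
    then show ?case using dcc_socle by simp
  next
    case (snoc z zs)
    then show ?case using dcc_step[of z ys] by simp
  qed
  from this[of xs "[]"] have "dcc (annihilated [])" by simp
  moreover have "annihilated [] = S" by (auto simp: annihilated_def)
  ultimately show ?thesis by simp
qed


subsection \<open>Nilpotence of the Frobenius action\<close>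

text \<open>\<open>frob_nil\<close> is the preimage in \<open>S\<close> of the submodule of classes in \<open>H\<^sup>1\<close> that are killed by
  some power of Frobenius, and \<open>deep k\<close> stands for \<open>\<mm>\<^sup>k \<cdot> frob_nil\<close>.\<close>

definition frob_nil :: "'b set" where
  "frob_nil = {s \<in> S. \<exists>e. s ^ p ^ e \<in> range \<phi>}"

definition deep :: "nat \<Rightarrow> 'b set" where
  "deep k = {x. \<exists>zs. set zs \<subseteq> frob_nil \<and> x \<in> lcomb \<phi> (ideal_pow m k) zs}"

lemma submod_frob_level: "submod \<phi> {s \<in> S. s ^ p ^ e \<in> range \<phi>}"
  unfolding submod_def
proof (intro conjI ballI allI)
  show "0 \<in> {s \<in> S. s ^ p ^ e \<in> range \<phi>}"
    using submod_zero[OF S_submod] range_zero p_pos[of e] by (auto simp: power_0_left)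
next
  fix x y assume "x \<in> {s \<in> S. s ^ p ^ e \<in> range \<phi>}" "y \<in> {s \<in> S. s ^ p ^ e \<in> range \<phi>}"
  then show "x - y \<in> {s \<in> S. s ^ p ^ e \<in> range \<phi>}"
    using S_diff range_diff by (auto simp: frob_diff)
next
  fix r x assume "x \<in> {s \<in> S. s ^ p ^ e \<in> range \<phi>}"
  then have x: "x \<in> S" "x ^ p ^ e \<in> range \<phi>" by auto
  have "(\<phi> r * x) ^ p ^ e = \<phi> (r ^ p ^ e) * x ^ p ^ e"
    using p_pos by (simp add: power_mult_distrib \<phi>_power)
  then show "\<phi> r * x \<in> {s \<in> S. s ^ p ^ e \<in> range \<phi>}"
    using S_scale[OF x(1)] range_mult[OF x(2)] by auto
qed

lemma submod_frob_nil: "submod \<phi> frob_nil"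
  unfolding submod_def
proof (intro conjI ballI allI)
  show "0 \<in> frob_nil" using submod_zero[OF submod_frob_level[of 0]] unfolding frob_nil_def by blast
next
  fix x y assume "x \<in> frob_nil" "y \<in> frob_nil"
  then obtain e1 e2 where "x \<in> S" "y \<in> S" "x ^ p ^ e1 \<in> range \<phi>" "y ^ p ^ e2 \<in> range \<phi>"
    by (auto simp: frob_nil_def)
  then have "x \<in> {s \<in> S. s ^ p ^ max e1 e2 \<in> range \<phi>}" "y \<in> {s \<in> S. s ^ p ^ max e1 e2 \<in> range \<phi>}"
    using range_frob_mono by (auto intro: max.cobounded1 max.cobounded2)
  then have "x - y \<in> {s \<in> S. s ^ p ^ max e1 e2 \<in> range \<phi>}" by (rule submod_diff[OF submod_frob_level])
  then show "x - y \<in> frob_nil" by (auto simp: frob_nil_def)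
next
  fix r x assume "x \<in> frob_nil"
  then obtain e where "x \<in> {s \<in> S. s ^ p ^ e \<in> range \<phi>}" by (auto simp: frob_nil_def)
  then have "\<phi> r * x \<in> {s \<in> S. s ^ p ^ e \<in> range \<phi>}" by (rule submod_mult[OF submod_frob_level])
  then show "\<phi> r * x \<in> frob_nil" by (auto simp: frob_nil_def)
qed

lemma rsub_frob_nil: "rsub frob_nil"
proof -
  have "\<phi> r ^ p ^ 0 \<in> range \<phi>" for r by simp
  then have "range \<phi> \<subseteq> frob_nil" using S_range unfolding frob_nil_def by blast
  then show ?thesis using submod_frob_nil by (auto simp: rsub_def frob_nil_def)
qed

lemma deep_induct:
  assumes "submod \<phi> C" "\<And>a t. a \<in> ideal_pow m k \<Longrightarrow> t \<in> frob_nil \<Longrightarrow> \<phi> a * t \<in> C"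
  shows "deep k \<subseteq> C"
proof
  fix x assume "x \<in> deep k"
  then obtain zs where zs: "set zs \<subseteq> frob_nil" "x \<in> lcomb \<phi> (ideal_pow m k) zs" by (auto simp: deep_def)
  have "lcomb \<phi> (ideal_pow m k) zs \<subseteq> C"
    by (rule lcomb_subset) (use assms zs submod_zero submod_add in blast)+
  then show "x \<in> C" using zs by blast
qed

lemma deep_mem: "a \<in> ideal_pow m k \<Longrightarrow> t \<in> frob_nil \<Longrightarrow> \<phi> a * t \<in> deep k"
  unfolding deep_def using lcomb_mem[of t "[t]" a "ideal_pow m k" \<phi>] \<phi>_zero ideal_zero[OF is_ideal_ideal_pow]
  by (intro CollectI exI[of _ "[t]"]) auto

lemma lcomb_append: "\<phi> 0 = 0 \<Longrightarrow> 0 \<in> Q \<Longrightarrow> x \<in> lcomb \<phi> Q zs \<Longrightarrow> y \<in> lcomb \<phi> Q ws \<Longrightarrow> x + y \<in> lcomb \<phi> Q (zs @ ws)"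
proof (induction zs arbitrary: x)
  case (Cons z zs)
  then obtain q x' where *: "x = \<phi> q * z + x'" "q \<in> Q" "x' \<in> lcomb \<phi> Q zs" by auto
  then have "x + y = \<phi> q * z + (x' + y)" by (simp add: add.assoc)
  moreover have "x' + y \<in> lcomb \<phi> Q (zs @ ws)" using Cons *(3) by blast
  ultimately show ?case unfolding append_Cons lcomb.simps using *(2) by blast
qed auto

lemma submod_deep: "submod \<phi> (deep k)"
proof -
  have P: "is_ideal (ideal_pow m k)" by (rule is_ideal_ideal_pow)
  note L = submod_lcomb[OF hom P]
  have "0 \<in> deep k" unfolding deep_def by (intro CollectI exI[of _ "[]"]) auto
  moreover have "x - y \<in> deep k" if xy: "x \<in> deep k" "y \<in> deep k" for x y
  proof -
    obtain zs ws where zw: "set zs \<subseteq> frob_nil" "x \<in> lcomb \<phi> (ideal_pow m k) zs"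
      "set ws \<subseteq> frob_nil" "y \<in> lcomb \<phi> (ideal_pow m k) ws" using xy by (auto simp: deep_def)
    have "0 - y \<in> lcomb \<phi> (ideal_pow m k) ws"
      using submod_diff[OF L submod_zero[OF L] zw(4)] .
    then have "x + (0 - y) \<in> lcomb \<phi> (ideal_pow m k) (zs @ ws)"
      using zw(2) \<phi>_zero ideal_zero[OF P] by (intro lcomb_append)
    then show ?thesis unfolding deep_def using zw by (intro CollectI exI[of _ "zs @ ws"]) auto
  qed
  moreover have "\<phi> r * x \<in> deep k" if "x \<in> deep k" for r x
    using that submod_mult[OF L] unfolding deep_def by blast
  ultimately show ?thesis unfolding submod_def by blast
qed

lemma deep_subset: "deep k \<subseteq> frob_nil"
  by (rule deep_induct[OF submod_frob_nil]) (rule submod_mult[OF submod_frob_nil])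

lemma deep_0: "deep 0 = frob_nil"
proof
  show "frob_nil \<subseteq> deep 0"
  proof
    fix t assume t: "t \<in> frob_nil"
    then show "t \<in> deep 0" using deep_mem[of 1 0 t] S_one[of t] by (auto simp: frob_nil_def)
  qed
qed (rule deep_subset)

lemma deep_scale: assumes "a \<in> ideal_pow m j" "t \<in> deep k" shows "\<phi> a * t \<in> deep (j + k)"
proof -
  have "deep k \<subseteq> {t. \<phi> a * t \<in> deep (j + k)}"
  proof (rule deep_induct)
    show "submod \<phi> {t. \<phi> a * t \<in> deep (j + k)}"
      using submod_deep[of "j + k"] unfolding submod_def
      by (auto simp: right_diff_distrib mult.left_commute[of "\<phi> a"])
    show "\<phi> b * t \<in> {t. \<phi> a * t \<in> deep (j + k)}" if "b \<in> ideal_pow m k" "t \<in> frob_nil" for b t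
      using deep_mem[OF ideal_pow_mult[OF assms(1) that(1)] that(2)] by (simp add: \<phi>_mult mult.assoc)
  qed
  then show ?thesis using assms(2) by auto
qed

text \<open>T / (R' + m T) is a vector space over the residue field with the descending chain
  condition, hence of finite dimension: an infinite independent sequence f would make the spans
  \<open>A i\<close> of its tails strictly descending.\<close>

lemma frob_nil_fg_mod_deep:
  "\<exists>ts. set ts \<subseteq> frob_nil \<and> (\<forall>t\<in>frob_nil. \<exists>y\<in>lcomb \<phi> UNIV ts. t - y \<in> deep 1)"
proof -
  define B where "B = set_plus (range \<phi>) (deep 1)"
  have Bs: "submod \<phi> B" unfolding B_def by (intro submod_set_plus submod_range submod_deep)
  have BT: "B \<subseteq> frob_nil"
    unfolding B_def using rsub_frob_nil deep_subset by (intro set_plus_subset) (auto simp: rsub_def)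
  have RB: "range \<phi> \<subseteq> B" unfolding B_def by (rule set_plus_left[OF submod_deep])
  have DB: "deep 1 \<subseteq> B" unfolding B_def by (rule set_plus_right[OF submod_range])
  have L: "submod \<phi> (lcomb \<phi> UNIV gs)" for gs by (intro submod_lcomb hom is_ideal_UNIV)
  have "\<exists>ts. set ts \<subseteq> frob_nil \<and> frob_nil \<subseteq> set_plus B (lcomb \<phi> UNIV ts)"
  proof (rule ccontr)
    assume "\<not> ?thesis"
    then have "\<forall>ts. set ts \<subseteq> frob_nil \<longrightarrow> (\<exists>t. t \<in> frob_nil \<and> t \<notin> set_plus B (lcomb \<phi> UNIV ts))" by blast
    then obtain pick where pick: "\<And>ts. set ts \<subseteq> frob_nil \<Longrightarrow> pick ts \<in> frob_nil \<and> pick ts \<notin> set_plus B (lcomb \<phi> UNIV ts)"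
      by metis
    \<comment> \<open>Each new element depends on all earlier ones, hence the recursion on the list
      built so far.\<close>
    define F where "F n = rec_nat [] (\<lambda>_ l. l @ [pick l]) n" for n :: nat
    define f where "f n = pick (F n)" for n
    have F: "F n = map f [0..<n]" for n
      by (induction n) (auto simp: F_def f_def)
    have FT: "set (F n) \<subseteq> frob_nil" for n
      by (induction n) (use pick in \<open>auto simp: F_def\<close>)
    have f: "f n \<in> frob_nil" "f n \<notin> set_plus B (lcomb \<phi> UNIV (map f [0..<n]))" for n
      using pick[OF FT[of n]] F[of n] by (auto simp: f_def)
    define G where "G i k = set_plus B (lcomb \<phi> UNIV (map f [i..<k]))" for i k
    have Gs: "submod \<phi> (G i k)" for i k unfolding G_def by (intro submod_set_plus Bs L)
    have BG: "B \<subseteq> G i k" for i k unfolding G_def by (rule set_plus_left[OF L])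
    have fG: "f j \<in> G i k" if "i \<le> j" "j < k" for i j k
    proof -
      have "f j \<in> S" using f by (auto simp: frob_nil_def)
      then have "f j \<in> lcomb \<phi> UNIV (map f [i..<k])"
        using lcomb_mem[of "f j" "map f [i..<k]" 1 UNIV \<phi>] that S_one \<phi>_zero by auto
      then show ?thesis unfolding G_def using set_plus_right[OF Bs] by blast
    qed
    have Gsub: "G i k \<subseteq> C" if "submod \<phi> C" "B \<subseteq> C" "\<And>j. i \<le> j \<Longrightarrow> j < k \<Longrightarrow> f j \<in> C" for i k C
      unfolding G_def using that by (intro set_plus_subset submod_lcomb_subset) auto
    have Gmono: "G i k \<subseteq> G j l" if "j \<le> i" "k \<le> l" for i j k l
      using that by (intro Gsub Gs BG fG) auto
    define A where "A i = (\<Union>k. G i k)" for i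
    have As: "submod \<phi> (A i)" for i
      unfolding submod_def
    proof (intro conjI ballI allI)
      show "0 \<in> A i" unfolding A_def using submod_zero[OF Gs] by blast
    next
      fix x y assume "x \<in> A i" "y \<in> A i"
      then obtain k l where "x \<in> G i k" "y \<in> G i l" by (auto simp: A_def)
      then have "x \<in> G i (max k l)" "y \<in> G i (max k l)"
        using Gmono[of i i k "max k l"] Gmono[of i i l "max k l"] by auto
      then show "x - y \<in> A i" unfolding A_def using submod_diff[OF Gs] by blast
    next
      fix r x assume "x \<in> A i"
      then show "\<phi> r * x \<in> A i" unfolding A_def using submod_mult[OF Gs] by blast
    qed
    have AT: "A i \<subseteq> frob_nil" for i
      unfolding A_def using Gsub[OF submod_frob_nil BT] f by blast
    have AS: "A i \<subseteq> S" for i using AT by (auto simp: frob_nil_def)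
    have RA: "range \<phi> \<subseteq> A i" for i
      using subset_trans[OF RB BG[of i 0]] by (auto simp: A_def)
    have "stationary A"
    proof (rule artinian[unfolded dcc_def, THEN spec, THEN mp], intro conjI allI impI)
      show "rsub (A i)" "A i \<subseteq> S" for i
        using As AS RA by (simp_all add: rsub_def)
      show "A j \<subseteq> A i" if "i \<le> j" for i j
        unfolding A_def using Gmono[OF that order.refl] by blast
    qed
    then obtain i where i: "A (Suc i) = A i" unfolding stationary_def by (metis le_Suc_eq order.refl)
    have "f i \<in> A i" unfolding A_def using fG[of i i "Suc i"] by auto
    then obtain k where k: "f i \<in> G (Suc i) k" using i unfolding A_def by blast
    \<comment> \<open>In a relation expressing f i, a last coefficient q in m puts q f k into B, and
      a unit q puts f k into the span of the earlier terms, against its choice.\<close>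
    have "f i \<notin> G (Suc i) k" for k
    proof (induction k)
      case 0
      show ?case using f(2)[of i] unfolding G_def by (metis Gmono G_def le0 order.refl subsetD upt_0 upt_conv_Nil zero_order(1))
    next
      case (Suc k)
      show ?case
      proof
        assume "f i \<in> G (Suc i) (Suc k)"
        show False
        proof (cases "Suc i \<le> k")
          case False
          then have "G (Suc i) (Suc k) = G (Suc i) 0" unfolding G_def by simp
          then show False using \<open>f i \<in> G (Suc i) (Suc k)\<close> Suc Gmono[of "Suc i" "Suc i" 0 k] by auto
        next
          case True
          have "G (Suc i) (Suc k) \<subseteq> set_plus (G (Suc i) k) (lcomb \<phi> UNIV [f k])"
          proof (rule Gsub)
            show "submod \<phi> (set_plus (G (Suc i) k) (lcomb \<phi> UNIV [f k]))"
              by (intro submod_set_plus Gs L)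
            show "B \<subseteq> set_plus (G (Suc i) k) (lcomb \<phi> UNIV [f k])"
              using BG set_plus_left[OF L] by blast
            fix j assume j: "Suc i \<le> j" "j < Suc k"
            have "f k \<in> lcomb \<phi> UNIV [f k]"
              using lcomb_mem[of "f k" "[f k]" 1 UNIV \<phi>] S_one[of "f k"] f(1)[of k] \<phi>_zero
              by (auto simp: frob_nil_def)
            then have "f k \<in> set_plus (G (Suc i) k) (lcomb \<phi> UNIV [f k])"
              by (rule subsetD[OF set_plus_right[OF Gs]])
            moreover have "f j \<in> set_plus (G (Suc i) k) (lcomb \<phi> UNIV [f k])" if "j < k"
              using subsetD[OF set_plus_left[OF L] fG[of "Suc i" j k]] j that by blast
            ultimately show "f j \<in> set_plus (G (Suc i) k) (lcomb \<phi> UNIV [f k])"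
              using j by (cases "j = k") auto
          qed
          then obtain g q where gq: "f i = g + \<phi> q * f k" "g \<in> G (Suc i) k"
            using \<open>f i \<in> G (Suc i) (Suc k)\<close> by (auto elim!: set_plusE)
          show False
          proof (cases "q \<in> m")
            case True
            then have "q \<in> ideal_pow m 1" unfolding One_nat_def ideal_pow_one[OF m_ideal] .
            then have "\<phi> q * f k \<in> G (Suc i) k"
              by (intro subsetD[OF subset_trans[OF DB BG]] deep_mem f(1))
            then show False using gq Suc submod_add[OF Gs] by auto
          next
            case False
            have "f i \<in> G 0 k" "g \<in> G 0 k"
              using fG[of 0 i k] \<open>Suc i \<le> k\<close> gq(2) Gmono[of 0 "Suc i" k k] by auto
            then have "\<phi> q * f k \<in> G 0 k" using gq(1) submod_diff[OF Gs, of "f i" 0 k g] by simp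
            then have "f k \<in> G 0 k"
              using unit_cancel[OF Gs _ False] f(1) by (auto simp: frob_nil_def)
            then show False using f(2) unfolding G_def by blast
          qed
        qed
      qed
    qed
    then show False using k by blast
  qed
  then obtain ts where ts: "set ts \<subseteq> frob_nil" "frob_nil \<subseteq> set_plus B (lcomb \<phi> UNIV ts)" by blast
  show ?thesis
  \<comment> \<open>The extra generator \<phi> 1 absorbs the summand R' of B.\<close>
  proof (intro exI[of _ "\<phi> 1 # ts"] conjI ballI)
    show "set (\<phi> 1 # ts) \<subseteq> frob_nil" using ts rsub_frob_nil by (auto simp: rsub_def)
    fix t assume "t \<in> frob_nil"
    then obtain r d y where *: "t = (\<phi> r + d) + y" "d \<in> deep 1" "y \<in> lcomb \<phi> UNIV ts"
      using ts(2) unfolding B_def set_plus_def by blast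
    have "\<phi> r * \<phi> 1 + y \<in> lcomb \<phi> UNIV (\<phi> 1 # ts)" using * by auto
    moreover have "t - (\<phi> r * \<phi> 1 + y) = d" using * by (simp add: \<phi>_mult[symmetric])
    ultimately show "\<exists>y\<in>lcomb \<phi> UNIV (\<phi> 1 # ts). t - y \<in> deep 1" using * by metis
  qed
qed

lemma lcomb_UNIV_coeffs: "y \<in> lcomb \<phi> UNIV ts \<longleftrightarrow> (\<exists>c. y = (\<Sum>i<length ts. \<phi> (c i) * ts ! i))"
proof (induction ts arbitrary: y)
  case (Cons t ts)
  show ?case
  proof
    assume "y \<in> lcomb \<phi> UNIV (t # ts)"
    then obtain q z c where "y = \<phi> q * t + z" "z = (\<Sum>i<length ts. \<phi> (c i) * ts ! i)"
      using Cons by auto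
    then show "\<exists>c. y = (\<Sum>i<length (t # ts). \<phi> (c i) * (t # ts) ! i)"
      by (intro exI[of _ "case_nat q c"]) (simp add: sum.lessThan_Suc_shift del: sum.lessThan_Suc)
  next
    assume "\<exists>c. y = (\<Sum>i<length (t # ts). \<phi> (c i) * (t # ts) ! i)"
    then obtain c where c: "y = (\<Sum>i<length (t # ts). \<phi> (c i) * (t # ts) ! i)" by blast
    then have "y = \<phi> (c 0) * t + (\<Sum>i<length ts. \<phi> ((c \<circ> Suc) i) * ts ! i)"
      by (simp add: sum.lessThan_Suc_shift del: sum.lessThan_Suc)
    moreover have "(\<Sum>i<length ts. \<phi> ((c \<circ> Suc) i) * ts ! i) \<in> lcomb \<phi> UNIV ts"
      unfolding Cons by blast
    ultimately show "y \<in> lcomb \<phi> UNIV (t # ts)" unfolding lcomb.simps by blast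
  qed
qed auto

text \<open>Successive approximation: the correction at stage k has coefficients in m^k, so the
  coefficients converge by completeness. What remains lies in every m^k T; its vanishing does not
  follow from Krull's intersection theorem, since T is not known to be finitely generated.\<close>

lemma frob_nil_fg_mod_all_deep:
  "\<exists>ts. set ts \<subseteq> frob_nil \<and> (\<forall>t\<in>frob_nil. \<exists>y\<in>lcomb \<phi> UNIV ts. \<forall>k. t - y \<in> deep k)"
proof -
  obtain ts where ts: "set ts \<subseteq> frob_nil" "\<And>t. t \<in> frob_nil \<Longrightarrow> \<exists>y\<in>lcomb \<phi> UNIV ts. t - y \<in> deep 1"
    using frob_nil_fg_mod_deep by blast
  define n where "n = length ts"
  define comb where "comb c = (\<Sum>i<n. \<phi> (c i) * ts ! i)" for c
  have comb_diff: "comb c - comb d = comb (\<lambda>i. c i - d i)" for c d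
    by (simp add: comb_def \<phi>_diff left_diff_distrib sum_subtractf)
  have comb_scale: "\<phi> r * comb c = comb (\<lambda>i. r * c i)" for r c
    by (simp add: comb_def \<phi>_mult sum_distrib_left mult.assoc)
  have comb_deep: "comb c \<in> deep k" if "\<And>i. c i \<in> ideal_pow m k" for c k
    unfolding comb_def using ts(1) by (intro submod_sum[OF submod_deep] deep_mem that) (auto simp: n_def)
  \<comment> \<open>From depth k to k + 1: in each term a * t with a in m^k, replace t by its
    combination of \<open>ts\<close> modulo m T.\<close>
  have step: "\<exists>c. (\<forall>i. c i \<in> ideal_pow m k) \<and> z - comb c \<in> deep (Suc k)" if "z \<in> deep k" for z k
  proof -
    have P: "is_ideal (ideal_pow m k)" by (rule is_ideal_ideal_pow)
    have "deep k \<subseteq> {z. \<exists>c. (\<forall>i. c i \<in> ideal_pow m k) \<and> z - comb c \<in> deep (Suc k)}" (is "_ \<subseteq> ?C")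
    proof (rule deep_induct)
      show "submod \<phi> ?C"
        unfolding submod_def
      proof (intro conjI ballI allI)
        have "comb (\<lambda>_. 0) = 0" by (simp add: comb_def \<phi>_zero)
        then show "0 \<in> ?C" using ideal_zero[OF P] submod_zero[OF submod_deep]
          by (intro CollectI exI[of _ "\<lambda>_. 0"]) auto
      next
        fix x y assume "x \<in> ?C" "y \<in> ?C"
        then obtain c d where cd: "\<forall>i. c i \<in> ideal_pow m k" "x - comb c \<in> deep (Suc k)"
          "\<forall>i. d i \<in> ideal_pow m k" "y - comb d \<in> deep (Suc k)" by blast
        have "(x - comb c) - (y - comb d) \<in> deep (Suc k)" using cd submod_diff[OF submod_deep] by blast
        moreover have "(x - comb c) - (y - comb d) = (x - y) - (comb c - comb d)" by (simp add: algebra_simps)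
        ultimately have "(x - y) - comb (\<lambda>i. c i - d i) \<in> deep (Suc k)" by (simp only: comb_diff)
        then show "x - y \<in> ?C" using cd(1,3) ideal_diff[OF P]
          by (intro CollectI exI[of _ "\<lambda>i. c i - d i"]) simp
      next
        fix r x assume "x \<in> ?C"
        then obtain c where c: "\<forall>i. c i \<in> ideal_pow m k" "x - comb c \<in> deep (Suc k)" by blast
        have "\<phi> r * (x - comb c) \<in> deep (Suc k)" using c submod_mult[OF submod_deep] by blast
        then have "\<phi> r * x - comb (\<lambda>i. r * c i) \<in> deep (Suc k)" by (simp only: right_diff_distrib comb_scale)
        then show "\<phi> r * x \<in> ?C" using c(1) ideal_mult_left[OF P]
          by (intro CollectI exI[of _ "\<lambda>i. r * c i"]) simp
      qed
      fix a t assume a: "a \<in> ideal_pow m k" and t: "t \<in> frob_nil"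
      obtain y where y: "y \<in> lcomb \<phi> UNIV ts" "t - y \<in> deep 1" using ts(2)[OF t] by blast
      then obtain c where "y = comb c" unfolding lcomb_UNIV_coeffs comb_def n_def by blast
      with y have c: "t - comb c \<in> deep 1" by simp
      have "\<phi> a * (t - comb c) \<in> deep (k + 1)" by (rule deep_scale[OF a c])
      then have "\<phi> a * t - comb (\<lambda>i. a * c i) \<in> deep (Suc k)"
        by (simp only: right_diff_distrib comb_scale Suc_eq_plus1)
      then show "\<phi> a * t \<in> ?C" using ideal_mult_right[OF P a]
        by (intro CollectI exI[of _ "\<lambda>i. a * c i"]) simp
    qed
    then show ?thesis using that by blast
  qed
  have "\<exists>y\<in>lcomb \<phi> UNIV ts. \<forall>k. t - y \<in> deep k" if t: "t \<in> frob_nil" for t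
  proof -
    have "\<exists>a. \<forall>k. t - comb (a k) \<in> deep k \<and> (\<forall>i. a (Suc k) i - a k i \<in> ideal_pow m k)"
    proof (rule dependent_nat_choice)
      show "\<exists>c. t - comb c \<in> deep 0"
        using t by (intro exI[of _ "\<lambda>_. 0"]) (simp add: comb_def \<phi>_zero deep_0)
      fix c k assume "t - comb c \<in> deep k"
      then obtain d where d: "\<forall>i. d i \<in> ideal_pow m k" "(t - comb c) - comb d \<in> deep (Suc k)" using step by blast
      have "comb (\<lambda>i. c i + d i) = comb c + comb d"
        using comb_diff[of "\<lambda>i. c i + d i" c] by (simp add: algebra_simps)
      then have "t - comb (\<lambda>i. c i + d i) \<in> deep (Suc k)" using d(2) by (simp add: algebra_simps)
      then show "\<exists>c'. t - comb c' \<in> deep (Suc k) \<and> (\<forall>i. c' i - c i \<in> ideal_pow m k)"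
        using d(1) by (intro exI[of _ "\<lambda>i. c i + d i"]) auto
    qed
    then obtain a where a: "\<And>k. t - comb (a k) \<in> deep k" "\<And>k i. a (Suc k) i - a k i \<in> ideal_pow m k" by blast
    have "\<forall>i. \<exists>l. \<forall>k. l - a k i \<in> ideal_pow m k"
    proof
      fix i
      show "\<exists>l. \<forall>k. l - a k i \<in> ideal_pow m k"
        using complete[unfolded madic_complete_def, THEN spec, of "\<lambda>k. a k i"] a(2) by simp
    qed
    then obtain l where l: "\<And>i k. l i - a k i \<in> ideal_pow m k" by metis
    have "t - comb l \<in> deep k" for k
    proof -
      have "t - comb l = (t - comb (a k)) - comb (\<lambda>i. l i - a k i)"
        by (simp add: comb_diff[symmetric])
      moreover have "comb (\<lambda>i. l i - a k i) \<in> deep k" by (rule comb_deep) (rule l)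
      ultimately show ?thesis using submod_diff[OF submod_deep a(1)[of k]] by (simp only:)
    qed
    moreover have "comb l \<in> lcomb \<phi> UNIV ts" unfolding lcomb_UNIV_coeffs comb_def n_def by blast
    ultimately show ?thesis by blast
  qed
  then show ?thesis using ts(1) by blast
qed

text \<open>A sum of terms a * t with a in m^k becomes the sum of a^(p^e) * t^(p^e). Once e is
  large, every t^(p^e) lies in R', while the coefficients lie in m^(k p^e).\<close>

lemma deep_frob:
  assumes "z \<in> deep k"
  shows "\<exists>e0. \<forall>e\<ge>e0. \<exists>w\<in>ideal_pow m (k * p ^ e). z ^ p ^ e = \<phi> w"
proof -
  have "deep k \<subseteq> {z. \<exists>e0. \<forall>e\<ge>e0. \<exists>w\<in>ideal_pow m (k * p ^ e). z ^ p ^ e = \<phi> w}" (is "_ \<subseteq> ?C")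
  proof (rule deep_induct)
    have P: "is_ideal (ideal_pow m j)" for j by (rule is_ideal_ideal_pow)
    show "submod \<phi> ?C"
      unfolding submod_def
    proof (intro conjI ballI allI)
      show "0 \<in> ?C" using ideal_zero[OF P] p_pos \<phi>_zero
        by (intro CollectI exI[of _ 0] allI impI bexI[of _ 0]) (auto simp: power_0_left)
    next
      fix x y assume "x \<in> ?C" "y \<in> ?C"
      then obtain e1 e2 where e: "\<And>e. e \<ge> e1 \<Longrightarrow> \<exists>w\<in>ideal_pow m (k * p ^ e). x ^ p ^ e = \<phi> w"
        "\<And>e. e \<ge> e2 \<Longrightarrow> \<exists>w\<in>ideal_pow m (k * p ^ e). y ^ p ^ e = \<phi> w" by blast
      have "\<exists>w\<in>ideal_pow m (k * p ^ e). (x - y) ^ p ^ e = \<phi> w" if "e \<ge> max e1 e2" for e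
      proof -
        have "e1 \<le> e" "e2 \<le> e" using that by auto
        then obtain v w where "v \<in> ideal_pow m (k * p ^ e)" "x ^ p ^ e = \<phi> v"
          "w \<in> ideal_pow m (k * p ^ e)" "y ^ p ^ e = \<phi> w" using e by blast
        then show ?thesis using ideal_diff[OF P] by (intro bexI[of _ "v - w"]) (auto simp: frob_diff \<phi>_diff)
      qed
      then show "x - y \<in> ?C" by blast
    next
      fix r x assume "x \<in> ?C"
      then obtain e1 where e: "\<And>e. e \<ge> e1 \<Longrightarrow> \<exists>w\<in>ideal_pow m (k * p ^ e). x ^ p ^ e = \<phi> w" by blast
      have "\<exists>w\<in>ideal_pow m (k * p ^ e). (\<phi> r * x) ^ p ^ e = \<phi> w" if ge: "e \<ge> e1" for e
      proof -
        obtain w where "w \<in> ideal_pow m (k * p ^ e)" "x ^ p ^ e = \<phi> w" using e[OF ge] by blast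
        then show ?thesis using ideal_mult_left[OF P] p_pos
          by (intro bexI[of _ "r ^ p ^ e * w"]) (auto simp: power_mult_distrib \<phi>_mult \<phi>_power)
      qed
      then show "\<phi> r * x \<in> ?C" by blast
    qed
    fix a t assume a: "a \<in> ideal_pow m k" and "t \<in> frob_nil"
    then obtain e0 where e0: "t ^ p ^ e0 \<in> range \<phi>" by (auto simp: frob_nil_def)
    have "\<exists>w\<in>ideal_pow m (k * p ^ e). (\<phi> a * t) ^ p ^ e = \<phi> w" if ge: "e \<ge> e0" for e
    proof -
      obtain r where "t ^ p ^ e = \<phi> r" using range_frob_mono[OF e0 ge] by blast
      then show ?thesis using ideal_mult_right[OF P ideal_pow_power[OF a]] p_pos
        by (intro bexI[of _ "a ^ p ^ e * r"]) (auto simp: power_mult_distrib \<phi>_mult \<phi>_power)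
    qed
    then show "\<phi> a * t \<in> ?C" by blast
  qed
  then show ?thesis using assms by blast
qed

text \<open>A Frobenius power of z comes from some y in R, and \<open>deep_frob\<close> shows that
  y^n has order k n for every k, with n a power of p; the kernel of \<phi> is the torsion allowed in
  \<open>nilpotent_if_powers_deep\<close>.\<close>

lemma nilpotent_if_deep:
  assumes "\<And>k. z \<in> deep k"
  shows "\<exists>n. z ^ n = 0"
proof -
  obtain e y where ey: "z ^ p ^ e = \<phi> y"
    using assms[of 0] deep_0 by (auto simp: frob_nil_def)
  have *: "\<exists>n>0. \<exists>w\<in>ideal_pow m (k * n). \<phi> (y ^ n - w) = 0" for k
  proof -
    obtain e0 where e0: "\<And>e. e \<ge> e0 \<Longrightarrow> \<exists>w\<in>ideal_pow m (k * p ^ e). z ^ p ^ e = \<phi> w"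
      using deep_frob[OF assms[of k]] by blast
    define e1 where "e1 = max e e0"
    obtain w where w: "w \<in> ideal_pow m (k * p ^ e1)" "z ^ p ^ e1 = \<phi> w" using e0[of e1] by (auto simp: e1_def)
    let ?n = "p ^ (e1 - e)"
    have "p ^ e1 = p ^ e * ?n" by (simp add: power_add[symmetric] e1_def)
    then have "\<phi> w = \<phi> (y ^ ?n)" using w(2) ey \<phi>_power[OF p_pos, of y "e1 - e"] by (simp add: power_mult)
    moreover have "w \<in> ideal_pow m (k * ?n)"
    proof (rule ideal_pow_mono_mem[OF w(1)])
      have "1 * ?n \<le> p ^ e * ?n" using p_pos[of e] by (intro mult_right_mono) auto
      then show "k * ?n \<le> k * p ^ e1" using \<open>p ^ e1 = p ^ e * ?n\<close> by simp
    qed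
    ultimately show ?thesis using p_pos by (intro exI[of _ ?n] conjI bexI[of _ w]) (auto simp: \<phi>_diff)
  qed
  \<comment> \<open>If y were a unit, then so would be y^n - w with w in m; as \<phi> kills it,
    \<phi> 1 = 0 would follow.\<close>
  have "y \<in> m"
  proof (rule ccontr)
    assume y: "y \<notin> m"
    obtain n w where n: "n > 0" "w \<in> ideal_pow m (1 * n)" "\<phi> (y ^ n - w) = 0" using *[of 1] by blast
    have mp: "prime_ideal m" by (rule local_ring_prime[OF local])
    have "w \<in> m" using ideal_pow_mono_mem[OF n(2), of "Suc 0"] n(1) ideal_pow_one[OF m_ideal] by auto
    then have "y ^ n - w \<notin> m"
      using y n(1) ideal_add[OF m_ideal, of "y ^ n - w" w] by (auto simp: prime_ideal_power_iff[OF mp])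
    then obtain v where "(y ^ n - w) * v = 1" using local_ring_inverse[OF local] by blast
    then have "\<phi> 1 = \<phi> (y ^ n - w) * \<phi> v" using \<phi>_mult by metis
    then show False using n(3) nontrivial by simp
  qed
  then have "\<exists>n. y ^ n = 0"
    by (rule nilpotent_if_powers_deep[OF noeth local m_gen]) (use * kernel in blast)
  then obtain n where n: "y ^ n = 0" by blast
  then have "n > 0" by (cases n) auto
  then have "(z ^ p ^ e) ^ n = 0" using n ey \<phi>_power \<phi>_zero by metis
  then show ?thesis by (metis power_mult)
qed

text \<open>In characteristic p the elements with r^(p^e) = 0 form an ideal, so an exponent that
  serves finitely many generators of the nilradical serves all of it.\<close>

lemma uniform_nilpotence_base: "\<exists>e. \<forall>r::'a. (\<exists>n. r ^ n = 0) \<longrightarrow> r ^ p ^ e = 0"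
proof -
  have frob_zero: "r ^ p ^ e = 0" if "r ^ n = 0" "n \<le> p ^ e" for r :: 'a and n e
    using that by (metis le_add_diff_inverse mult_zero_left power_add)
  have bound: "n \<le> p ^ n" for n :: nat
    using p_prime prime_ge_2_nat[of p] by (meson less_imp_le less_exp order.trans power_mono zero_le)
  define N where "N = {r::'a. \<exists>n. r ^ n = 0}"
  have E: "is_ideal {r::'a. r ^ p ^ e = 0}" for e
    unfolding is_ideal_def using p_pos[of e] by (auto simp: frob_add_a power_mult_distrib power_0_left)
  have N_eq: "N = (\<Union>e. {r::'a. r ^ p ^ e = 0})"
    unfolding N_def using frob_zero[OF _ bound] by blast
  have mono: "{r::'a. r ^ p ^ e = 0} \<subseteq> {r. r ^ p ^ e' = 0}" if "e \<le> e'" for e e'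
    using frob_zero[of _ "p ^ e" e'] power_increasing[OF that, of p] prime_ge_1_nat[OF p_prime] by auto
  have "is_ideal N"
    unfolding is_ideal_def
  proof (intro conjI ballI allI)
    show "0 \<in> N" unfolding N_eq using ideal_zero[OF E] by blast
  next
    fix x y assume "x \<in> N" "y \<in> N"
    then obtain e1 e2 where "x \<in> {r. r ^ p ^ e1 = 0}" "y \<in> {r. r ^ p ^ e2 = 0}" unfolding N_eq by blast
    then have "x \<in> {r. r ^ p ^ max e1 e2 = 0}" "y \<in> {r. r ^ p ^ max e1 e2 = 0}"
      using mono[of e1 "max e1 e2"] mono[of e2 "max e1 e2"] by auto
    then show "x + y \<in> N" unfolding N_eq using ideal_add[OF E] by blast
  next
    fix r x assume "x \<in> N"
    then show "r * x \<in> N" unfolding N_eq using ideal_mult_left[OF E] by blast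
  qed
  then obtain gs where gs: "N = icomb UNIV gs" "set gs \<subseteq> N" using noetherian_fg[OF noeth] by metis
  have "\<forall>g\<in>set gs. \<exists>e. g ^ p ^ e = 0" using gs(2) N_eq by blast
  then obtain f where f: "\<And>g. g \<in> set gs \<Longrightarrow> g ^ p ^ f g = 0" by metis
  define e where "e = Max (insert 0 (f ` set gs))"
  have "set gs \<subseteq> {r. r ^ p ^ e = 0}"
  proof
    fix g assume g: "g \<in> set gs"
    then have "f g \<le> e" unfolding e_def by (intro Max_ge) auto
    then show "g \<in> {r. r ^ p ^ e = 0}" using mono[of "f g" e] f[OF g] by auto
  qed
  then have "N \<subseteq> {r. r ^ p ^ e = 0}"
    unfolding gs(1) using E[of e] by (intro submod_lcomb_subset) (auto simp: submod_ident)
  then show ?thesis unfolding N_def by blast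
qed

lemma uniform_nilpotence: "\<exists>e. \<forall>s\<in>S. (\<exists>n. s ^ n = 0) \<longrightarrow> s ^ p ^ e = 0"
proof -
  obtain e where e: "\<And>r::'a. \<exists>n. r ^ n = 0 \<Longrightarrow> r ^ p ^ e = 0" using uniform_nilpotence_base by blast
  have "s ^ p ^ e = 0" if s: "s \<in> S" and n: "s ^ n = 0" for s n
  proof -
    have sn: "s ^ Suc n = 0" using n by simp
    obtain N where N: "\<And>x. x \<in> set xs \<Longrightarrow> \<phi> x ^ N * s \<in> range \<phi>" using denominators[OF s] by blast
    have "\<phi> x ^ (p ^ e * (Suc N)) * s ^ p ^ e = 0" if x: "x \<in> set xs" for x
    proof -
      obtain r where r: "\<phi> x ^ N * s = \<phi> r" using N[OF x] by auto
      have "\<phi> (r ^ Suc n) = (\<phi> x ^ N * s) ^ Suc n" by (simp only: \<phi>_power r zero_less_Suc)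
      also have "\<dots> = 0" by (simp only: power_mult_distrib sn mult_zero_right)
      finally obtain t where "x ^ t * r ^ Suc n = 0" using kernel x by blast
      \<comment> \<open>Since \<phi> sees R only up to torsion, r need not be nilpotent; multiplying
        by x makes it so.\<close>
      moreover have "(x * r) ^ (t + Suc n) = (x ^ Suc n * r ^ t) * (x ^ t * r ^ Suc n)"
        by (simp only: power_mult_distrib power_add ac_simps)
      ultimately have "(x * r) ^ (t + Suc n) = 0" by (simp only: mult_zero_right)
      then have "(x * r) ^ p ^ e = 0" using e by blast
      then have "\<phi> (x * r) ^ p ^ e = 0" using \<phi>_power[OF p_pos, of "x * r" e] \<phi>_zero by simp
      moreover have "\<phi> (x * r) = \<phi> x ^ Suc N * s" by (simp add: \<phi>_mult r[symmetric] mult.assoc)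
      ultimately show ?thesis by (simp only: power_mult_distrib power_mult[symmetric] mult.commute[of "p ^ e"])
    qed
    then show ?thesis by (rule separated[OF S_pow[OF s p_pos]])
  qed
  then show ?thesis by blast
qed

text \<open>The Hartshorne--Speiser--Lyubeznik theorem for \<open>H\<^sup>1\<close>.\<close>

theorem uniform_frob_nil: "\<exists>e. \<forall>s\<in>frob_nil. s ^ p ^ e \<in> range \<phi>"
proof -
  obtain ts where ts: "set ts \<subseteq> frob_nil"
    "\<And>t. t \<in> frob_nil \<Longrightarrow> \<exists>y\<in>lcomb \<phi> UNIV ts. \<forall>k. t - y \<in> deep k"
    using frob_nil_fg_mod_all_deep by blast
  obtain e0 where e0: "\<And>s n. s \<in> S \<Longrightarrow> s ^ n = 0 \<Longrightarrow> s ^ p ^ e0 = 0" using uniform_nilpotence by blast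
  have "\<forall>t\<in>set ts. \<exists>e. t ^ p ^ e \<in> range \<phi>" using ts(1) by (auto simp: frob_nil_def)
  then obtain f where f: "\<And>t. t \<in> set ts \<Longrightarrow> t ^ p ^ f t \<in> range \<phi>" by metis
  define e where "e = Max (insert e0 (f ` set ts))"
  let ?C = "{s \<in> S. s ^ p ^ e \<in> range \<phi>}"
  have "e0 \<le> e" unfolding e_def by (intro Max_ge) auto
  have "lcomb \<phi> UNIV ts \<subseteq> ?C"
  proof (rule submod_lcomb_subset[OF submod_frob_level], rule subsetI)
    fix t assume t: "t \<in> set ts"
    then have "f t \<le> e" unfolding e_def by (intro Max_ge) auto
    then show "t \<in> ?C" using range_frob_mono[OF f[OF t]] t ts(1) by (auto simp: frob_nil_def)
  qed
  moreover have "z \<in> ?C" if "\<And>k. z \<in> deep k" for z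
  proof -
    have zS: "z \<in> S" using that[of 0] deep_0 by (auto simp: frob_nil_def)
    then have "z ^ p ^ e0 = 0" using nilpotent_if_deep[OF that] e0 by blast
    then show ?thesis using range_frob_mono[of z e0 e] range_zero \<open>e0 \<le> e\<close> zS by simp
  qed
  ultimately have "t \<in> ?C" if "t \<in> frob_nil" for t
    using ts(2)[OF that] submod_add[OF submod_frob_level, of _ e] by (metis (no_types, lifting) diff_add_cancel subsetD)
  then show ?thesis by blast
qed


subsection \<open>The coefficient field\<close>

lemma K_zero: "0 \<in> K" and K_one: "1 \<in> K"
  and K_add: "x \<in> K \<Longrightarrow> y \<in> K \<Longrightarrow> x + y \<in> K"
  and K_diff: "x \<in> K \<Longrightarrow> y \<in> K \<Longrightarrow> x - y \<in> K"
  and K_mult: "x \<in> K \<Longrightarrow> y \<in> K \<Longrightarrow> x * y \<in> K"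
  and K_inverse: "x \<in> K \<Longrightarrow> x \<noteq> 0 \<Longrightarrow> \<exists>y\<in>K. x * y = 1"
  using coeff by (simp_all add: coefficient_field_def)

lemma K_residue: "\<exists>k\<in>K. r - k \<in> m"
  using coeff by (auto simp: coefficient_field_def)

lemma K_uminus: "x \<in> K \<Longrightarrow> - x \<in> K"
  using K_diff[OF K_zero] by fastforce

lemma K_power: "x \<in> K \<Longrightarrow> x ^ n \<in> K"
  by (induction n) (auto simp: K_one K_mult)

lemma K_sum: "(\<And>i. i \<in> I \<Longrightarrow> f i \<in> K) \<Longrightarrow> sum f I \<in> K"
  by (induction I rule: infinite_finite_induct) (auto simp: K_zero K_add)

lemma K_not_m: "k \<in> K \<Longrightarrow> k \<noteq> 0 \<Longrightarrow> k \<notin> m"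
proof
  assume k: "k \<in> K" "k \<noteq> 0" "k \<in> m"
  then obtain y where "k * y = 1" using K_inverse by blast
  then show False using ideal_mult_right[OF m_ideal k(3), of y] local_ring_one[OF local] by simp
qed

lemma K_power_nonzero: "k \<in> K \<Longrightarrow> k \<noteq> 0 \<Longrightarrow> k ^ n \<noteq> 0"
  using K_not_m prime_ideal_power_iff[OF local_ring_prime[OF local], of k n] ideal_zero[OF m_ideal]
  by (metis power_0 zero_neq_one gr_zeroI)

lemma K_root:
  assumes "n > 0" "\<And>i. i < n \<Longrightarrow> c i \<in> K"
  shows "\<exists>x\<in>K. x ^ n + (\<Sum>i<n. c i * x ^ i) = 0"
  using closed[unfolded alg_closed_subfield_def, THEN spec, of "map c [0..<n]"] assms by auto

lemma K_nth_root: assumes "n > 0" "k \<in> K" shows "\<exists>x\<in>K. x ^ n = k"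
proof -
  define c where "c i = (if i = 0 then - k else 0)" for i :: nat
  have c: "c i \<in> K" for i using assms K_uminus K_zero by (simp add: c_def)
  obtain x where x: "x \<in> K" "x ^ n + (\<Sum>i<n. c i * x ^ i) = 0"
    using K_root[of n c] assms(1) c by blast
  have "(\<Sum>i<n. c i * x ^ i) = (\<Sum>i<n. if i = 0 then - k else 0)"
    by (intro sum.cong) (auto simp: c_def)
  also have "\<dots> = - k" using assms(1) by (simp add: sum.delta)
  finally show ?thesis using x by (auto simp: add_eq_0_iff2)
qed

lemma K_artin_schreier: assumes "\<alpha> \<in> K" "k \<in> K" shows "\<exists>x\<in>K. x ^ p - \<alpha> * x = k"
proof -
  have p: "1 < p" using p_prime prime_gt_1_nat by blast
  define c where "c i = (if i = 0 then - k else 0) + (if i = 1 then - \<alpha> else 0)" for i :: nat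
  have c: "c i \<in> K" for i using assms K_uminus K_zero K_add by (simp add: c_def)
  have "0 < p" using p by simp
  obtain x where x: "x \<in> K" "x ^ p + (\<Sum>i<p. c i * x ^ i) = 0"
    using K_root[of p c] \<open>0 < p\<close> c by blast
  have "(\<Sum>i<p. c i * x ^ i) = (\<Sum>i<p. (if i = 0 then - k else 0) + (if i = 1 then - \<alpha> * x else 0))"
    by (intro sum.cong) (auto simp: c_def)
  also have "\<dots> = - k - \<alpha> * x" using p by (simp add: sum.distrib sum.delta)
  finally have eq: "(\<Sum>i<p. c i * x ^ i) = - k - \<alpha> * x" .
  have "x ^ p - \<alpha> * x = (x ^ p + (- k - \<alpha> * x)) + k" by simp
  also have "\<dots> = k" using x(2) unfolding eq by (simp only: add_0)
  finally show ?thesis using x(1) by blast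
qed

lemma \<phi>_K_cancel:
  assumes "k \<in> K" "k \<noteq> 0" "s \<in> S" "\<phi> k * s = 0"
  shows "s = 0"
  using unit_cancel[of "{0}" s k] K_not_m[OF assms(1,2)] assms by (auto simp: submod_def)

subsection \<open>Semilinear operators\<close>

text \<open>Right division of a twisted polynomial in T by T - \<alpha>, where T turns a scalar k
  into k^d; the remainder of T^i is \<alpha> to the power 1 + d + ... + d^(i-1). It is applied to
  Frobenius with d = p and to multiplication by a section with d = 1.\<close>

lemma semilinear_division:
  assumes T_add: "\<And>x y. T (x + y) = T x + (T y :: 'b)" and T_mult: "\<And>k y. T (\<phi> k * y) = \<phi> (k ^ d) * T y"
    and \<alpha>: "\<alpha> \<in> K" and "\<And>i. a i \<in> K"
  shows "\<exists>b. (\<forall>i. b i \<in> K) \<and> b n = a (Suc n) \<and>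
    (\<forall>c. (\<Sum>i\<le>Suc n. \<phi> (a i) * (T ^^ i) c) =
      (\<Sum>i\<le>n. \<phi> (b i) * (T ^^ i) (T c - \<phi> \<alpha> * c)) + \<phi> (\<Sum>i\<le>Suc n. a i * \<alpha> ^ (\<Sum>l<i. d ^ l)) * c)"
  using assms(4)
proof (induction n arbitrary: a)
  case 0
  show ?case
    by (rule exI[of _ "\<lambda>_. a 1"]) (simp add: 0 \<phi>_add \<phi>_mult algebra_simps)
next
  case (Suc n)
  have T_iter: "(T ^^ i) (x + y) = (T ^^ i) x + (T ^^ i) y" for i x y
    by (induction i) (auto simp: T_add)
  have T_iter_mult: "(T ^^ i) (\<phi> k * y) = \<phi> (k ^ d ^ i) * (T ^^ i) y" for i k y
  proof (induction i)
    case (Suc i)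
    then show ?case by (simp add: T_mult power_mult[symmetric] mult.commute[of "d ^ i" d])
  qed simp
  \<comment> \<open>The top term a T^(n+2) equals a T^(n+1) (T - \<alpha>) plus a \<alpha>^(d^(n+1))
    T^(n+1); the second part is absorbed into the next lower coefficient.\<close>
  define a' where "a' = a(Suc n := a (Suc n) + a (Suc (Suc n)) * \<alpha> ^ d ^ Suc n)"
  have "a' i \<in> K" for i using Suc.prems \<alpha> by (auto simp: a'_def K_add K_mult K_power)
  from Suc.IH[of a', OF this] obtain b where b: "\<And>i. b i \<in> K" and
    eq: "\<And>c. (\<Sum>i\<le>Suc n. \<phi> (a' i) * (T ^^ i) c) =
      (\<Sum>i\<le>n. \<phi> (b i) * (T ^^ i) (T c - \<phi> \<alpha> * c)) + \<phi> (\<Sum>i\<le>Suc n. a' i * \<alpha> ^ (\<Sum>l<i. d ^ l)) * c"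
    by blast
  let ?N = "\<lambda>i. \<Sum>l<i. d ^ l"
  have rem: "(\<Sum>i\<le>Suc (Suc n). a i * \<alpha> ^ ?N i) = (\<Sum>i\<le>Suc n. a' i * \<alpha> ^ ?N i)"
    by (simp add: a'_def power_add algebra_simps)
  show ?case
  proof (intro exI[of _ "b(Suc n := a (Suc (Suc n)))"] conjI allI)
    show "(b(Suc n := a (Suc (Suc n)))) i \<in> K" for i using b Suc.prems by auto
    show "(b(Suc n := a (Suc (Suc n)))) (Suc n) = a (Suc (Suc n))" by simp
    fix c
    let ?c' = "T c - \<phi> \<alpha> * c"
    have "(T ^^ Suc (Suc n)) c = (T ^^ Suc n) (?c' + \<phi> \<alpha> * c)" by (simp add: funpow_swap1)
    also have "\<dots> = (T ^^ Suc n) ?c' + \<phi> (\<alpha> ^ d ^ Suc n) * (T ^^ Suc n) c"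
      by (simp only: T_iter T_iter_mult)
    finally have top: "(T ^^ Suc (Suc n)) c = (T ^^ Suc n) ?c' + \<phi> (\<alpha> ^ d ^ Suc n) * (T ^^ Suc n) c" .
    have "(\<Sum>i\<le>Suc (Suc n). \<phi> (a i) * (T ^^ i) c) =
        (\<Sum>i\<le>Suc n. \<phi> (a i) * (T ^^ i) c) + \<phi> (a (Suc (Suc n))) * (T ^^ Suc (Suc n)) c"
      by (rule sum.atMost_Suc)
    also have "\<dots> = (\<Sum>i\<le>Suc n. \<phi> (a' i) * (T ^^ i) c) + \<phi> (a (Suc (Suc n))) * (T ^^ Suc n) ?c'"
      unfolding top by (simp add: a'_def \<phi>_add \<phi>_mult algebra_simps del: funpow.simps)
    finally show "(\<Sum>i\<le>Suc (Suc n). \<phi> (a i) * (T ^^ i) c) =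
        (\<Sum>i\<le>Suc n. \<phi> ((b(Suc n := a (Suc (Suc n)))) i) * (T ^^ i) ?c') +
        \<phi> (\<Sum>i\<le>Suc (Suc n). a i * \<alpha> ^ ?N i) * c"
      unfolding rem eq by (simp del: funpow.simps)
  qed
qed

text \<open>The remainder of the division is a monic polynomial in \<alpha>, because the exponents
  \<open>N i\<close> increase strictly; a root in K makes it vanish.\<close>

lemma semilinear_factor:
  assumes T_add: "\<And>x y. T (x + y) = T x + (T y :: 'b)" and T_mult: "\<And>k y. T (\<phi> k * y) = \<phi> (k ^ d) * T y"
    and d: "d > 0" and a: "\<And>i. a i \<in> K" "a (Suc n) = 1"
  shows "\<exists>\<alpha>\<in>K. \<exists>b. (\<forall>i. b i \<in> K) \<and> b n = 1 \<and>
    (\<forall>c. (\<Sum>i\<le>Suc n. \<phi> (a i) * (T ^^ i) c) = (\<Sum>i\<le>n. \<phi> (b i) * (T ^^ i) (T c - \<phi> \<alpha> * c)))"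
proof -
  define N where "N i = (\<Sum>l<i. d ^ l)" for i
  have mono: "N i < N j" if "i < j" for i j
    using that by (rule lift_Suc_mono_less[rotated]) (use d in \<open>simp add: N_def\<close>)
  \<comment> \<open>Coefficients re-indexed by exponent, to match the dense form of
    \<open>K_root\<close>.\<close>
  define c where "c k = sum a {i \<in> {..<Suc n}. N i = k}" for k
  have c: "c k \<in> K" for k unfolding c_def by (rule K_sum) (rule a)
  have "0 < N (Suc n)" using mono[of 0 "Suc n"] by simp
  then obtain \<alpha> where \<alpha>: "\<alpha> \<in> K" "\<alpha> ^ N (Suc n) + (\<Sum>k<N (Suc n). c k * \<alpha> ^ k) = 0"
    using K_root[of "N (Suc n)" c] c by blast
  have "(\<Sum>k<N (Suc n). c k * \<alpha> ^ k) = (\<Sum>k<N (Suc n). \<Sum>i\<in>{i \<in> {..<Suc n}. N i = k}. a i * \<alpha> ^ N i)"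
    by (intro sum.cong) (auto simp: sum_distrib_right c_def)
  also have "\<dots> = (\<Sum>i<Suc n. a i * \<alpha> ^ N i)"
    by (intro sum.group) (auto intro: mono)
  finally have "(\<Sum>i\<le>Suc n. a i * \<alpha> ^ N i) = 0"
    using \<alpha>(2) a(2) by (simp add: lessThan_Suc_atMost add.commute)
  then have rem0: "\<phi> (\<Sum>i\<le>Suc n. a i * \<alpha> ^ (\<Sum>l<i. d ^ l)) = 0" by (simp only: N_def \<phi>_zero)
  obtain b where "\<forall>i. b i \<in> K" "b n = a (Suc n)" and
    "\<And>c. (\<Sum>i\<le>Suc n. \<phi> (a i) * (T ^^ i) c) =
      (\<Sum>i\<le>n. \<phi> (b i) * (T ^^ i) (T c - \<phi> \<alpha> * c)) + \<phi> (\<Sum>i\<le>Suc n. a i * \<alpha> ^ (\<Sum>l<i. d ^ l)) * c"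
    using semilinear_division[of T d \<alpha> a n, OF T_add T_mult \<alpha>(1) a(1)] by blast
  then show ?thesis using \<alpha>(1) a(2) unfolding rem0 by (intro bexI[of _ \<alpha>] exI[of _ b]) auto
qed

subsection \<open>The stable part\<close>

text \<open>The preimage in \<open>S\<close> of the intersection of all F^e(H^1); likewise
  \<open>fixed\<close> is the preimage of the Frobenius-fixed classes.\<close>

definition stable :: "'b set" where
  "stable = {s \<in> S. \<forall>e. \<exists>t\<in>S. s - t ^ p ^ e \<in> range \<phi>}"

definition fixed :: "'b set" where
  "fixed = {s \<in> S. s ^ p - s \<in> range \<phi>}"

text \<open>The preimage of the K-span of the classes of W in H^1, which is why the base case is all
  of R' and not just 0.\<close>

inductive_set kspan :: "'b set \<Rightarrow> 'b set" for W where
  base: "r \<in> range \<phi> \<Longrightarrow> r \<in> kspan W"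
| step: "k \<in> K \<Longrightarrow> w \<in> W \<Longrightarrow> y \<in> kspan W \<Longrightarrow> \<phi> k * w + y \<in> kspan W"

lemma kspan_subset: "W \<subseteq> S \<Longrightarrow> kspan W \<subseteq> S"
proof
  fix x assume "W \<subseteq> S" "x \<in> kspan W"
  from this(2,1) show "x \<in> S"
    by induction (use S_\<phi> S_scale S_add in blast)+
qed

lemma kspan_mono: "V \<subseteq> W \<Longrightarrow> kspan V \<subseteq> kspan W"
proof
  fix x assume "V \<subseteq> W" "x \<in> kspan V"
  from this(2,1) show "x \<in> kspan W" by induction (auto intro: kspan.intros)
qed

lemma kspan_add: "x \<in> kspan W \<Longrightarrow> y \<in> kspan W \<Longrightarrow> x + y \<in> kspan W"
proof (induction rule: kspan.induct)
  case (base r)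
  from base(2,1) show ?case
  proof (induction rule: kspan.induct)
    case (base r')
    then show ?case using range_add by (blast intro: kspan.base)
  next
    case (step k w y)
    then have "\<phi> k * w + (r + y) \<in> kspan W" by (blast intro: kspan.step)
    then show ?case by (simp add: algebra_simps)
  qed
next
  case (step k w x)
  then have "\<phi> k * w + (x + y) \<in> kspan W" by (blast intro: kspan.step)
  then show ?case by (simp add: algebra_simps)
qed

lemma kspan_mult: "x \<in> kspan W \<Longrightarrow> k \<in> K \<Longrightarrow> \<phi> k * x \<in> kspan W"
proof (induction rule: kspan.induct)
  case (base r)
  then show ?case using range_mult by (blast intro: kspan.base)
next
  case (step l w x)
  then have "\<phi> (k * l) * w + \<phi> k * x \<in> kspan W" by (blast intro: kspan.step K_mult)
  then show ?case by (simp add: \<phi>_mult algebra_simps)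
qed

lemma kspan_diff: "W \<subseteq> S \<Longrightarrow> x \<in> kspan W \<Longrightarrow> y \<in> kspan W \<Longrightarrow> x - y \<in> kspan W"
proof -
  assume W: "W \<subseteq> S" and x: "x \<in> kspan W" and y: "y \<in> kspan W"
  have "\<phi> (- 1) * y = - y"
    using S_one[of y] kspan_subset[OF W] y rhom_uminus[OF hom, of 1] by auto
  then show ?thesis using kspan_add[OF x kspan_mult[OF y K_uminus[OF K_one]]] by simp
qed

lemma kspan_insertE:
  assumes "x \<in> kspan (insert w W)"
  shows "\<exists>k\<in>K. \<exists>y\<in>kspan W. x = \<phi> k * w + y"
  using assms
proof (induction rule: kspan.induct)
  case (base r)
  then show ?case using K_zero \<phi>_zero by (intro bexI[of _ 0] bexI[of _ r]) (auto intro: kspan.base)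
next
  case (step k v x)
  then obtain l y where ly: "l \<in> K" "y \<in> kspan W" "x = \<phi> l * w + y" by blast
  show ?case
  proof (cases "v = w")
    case True
    then have "\<phi> k * v + x = \<phi> (k + l) * w + y" using ly by (simp add: \<phi>_add algebra_simps)
    then show ?thesis using ly step K_add by blast
  next
    case False
    then have "\<phi> k * v + y \<in> kspan W" using step ly by (blast intro: kspan.step)
    moreover have "\<phi> k * v + x = \<phi> l * w + (\<phi> k * v + y)" using ly by (simp add: algebra_simps)
    ultimately show ?thesis using ly by blast
  qed
qed

lemma kspan_kspan: "V \<subseteq> kspan W \<Longrightarrow> kspan V \<subseteq> kspan W"
proof
  fix x assume "V \<subseteq> kspan W" "x \<in> kspan V"
  from this(2,1) show "x \<in> kspan W"
    by induction (blast intro: kspan.base kspan_add kspan_mult)+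
qed

lemma kspan_finite:
  assumes "finite W" "W \<subseteq> S" "x \<in> kspan W"
  shows "\<exists>k. (\<forall>w. k w \<in> K) \<and> x - (\<Sum>w\<in>W. \<phi> (k w) * w) \<in> range \<phi>"
  using assms
proof (induction W arbitrary: x)
  case empty
  have "x \<in> range \<phi>" using empty(2) by (induction rule: kspan.induct) auto
  then show ?case using K_zero by auto
next
  case (insert w W)
  obtain l y where ly: "l \<in> K" "y \<in> kspan W" "x = \<phi> l * w + y" using kspan_insertE insert.prems by blast
  obtain k where k: "\<forall>w. k w \<in> K" "y - (\<Sum>w\<in>W. \<phi> (k w) * w) \<in> range \<phi>"
    using insert.IH[OF _ ly(2)] insert.prems by blast
  have "(\<Sum>v\<in>W. \<phi> ((k(w := l)) v) * v) = (\<Sum>v\<in>W. \<phi> (k v) * v)"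
    using insert.hyps by (intro sum.cong) auto
  then have "x - (\<Sum>v\<in>insert w W. \<phi> ((k(w := l)) v) * v) = y - (\<Sum>w\<in>W. \<phi> (k w) * w)"
    using ly insert.hyps by simp
  then have "x - (\<Sum>v\<in>insert w W. \<phi> ((k(w := l)) v) * v) \<in> range \<phi>" using k(2) by (simp only:)
  moreover have "\<forall>v. (k(w := l)) v \<in> K" using k(1) ly(1) by simp
  ultimately show ?case by blast
qed

lemma stable_subset: "stable \<subseteq> S" by (auto simp: stable_def)

lemma stable_range: "range \<phi> \<subseteq> stable"
proof
  fix s assume "s \<in> range \<phi>"
  then have "s \<in> S \<and> s - 0 ^ p ^ e \<in> range \<phi>" for e
    using S_range p_pos[of e] by (auto simp: power_0_left)
  then show "s \<in> stable" unfolding stable_def using submod_zero[OF S_submod] by blast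
qed

lemma stable_add: assumes "s \<in> stable" "t \<in> stable" shows "s + t \<in> stable"
proof -
  have "\<exists>w\<in>S. (s + t) - w ^ p ^ e \<in> range \<phi>" for e
  proof -
    obtain v w where vw: "v \<in> S" "s - v ^ p ^ e \<in> range \<phi>" "w \<in> S" "t - w ^ p ^ e \<in> range \<phi>"
      using assms unfolding stable_def by blast
    have "(s + t) - (v + w) ^ p ^ e = (s - v ^ p ^ e) + (t - w ^ p ^ e)" by (simp add: frob_add)
    then show ?thesis using vw S_add range_add by metis
  qed
  then show ?thesis using assms S_add by (auto simp: stable_def)
qed

text \<open>K is perfect: if k = l^(p^e) and s is congruent to v^(p^e), then k s is congruent to (l
  v)^(p^e).\<close>

lemma stable_mult: assumes "s \<in> stable" "k \<in> K" shows "\<phi> k * s \<in> stable"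
proof -
  have "\<exists>w\<in>S. \<phi> k * s - w ^ p ^ e \<in> range \<phi>" for e
  proof -
    obtain v where v: "v \<in> S" "s - v ^ p ^ e \<in> range \<phi>" using assms unfolding stable_def by blast
    obtain l where l: "l ^ p ^ e = k" using K_nth_root[OF p_pos assms(2)] by blast
    have "\<phi> k * s - (\<phi> l * v) ^ p ^ e = \<phi> k * (s - v ^ p ^ e)"
      using l by (simp add: power_mult_distrib \<phi>_power[OF p_pos, symmetric] right_diff_distrib)
    then show ?thesis using range_mult[OF v(2), of k] S_scale[OF v(1)] by metis
  qed
  then show ?thesis using assms S_scale by (auto simp: stable_def)
qed

lemma stable_diff: assumes "s \<in> stable" "t \<in> stable" shows "s - t \<in> stable"
proof -
  have "\<phi> (- 1) * t = - t"
    using S_one[of t] stable_subset assms rhom_uminus[OF hom, of 1] by auto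
  then show ?thesis using stable_add[OF assms(1) stable_mult[OF assms(2) K_uminus[OF K_one]]] by simp
qed

lemma stable_frob: assumes "s \<in> stable" shows "s ^ p \<in> stable"
proof -
  have "\<exists>w\<in>S. s ^ p - w ^ p ^ e \<in> range \<phi>" for e
  proof -
    obtain v where v: "v \<in> S" "s - v ^ p ^ e \<in> range \<phi>" using assms unfolding stable_def by blast
    have "s ^ p - (v ^ p) ^ p ^ e = (s - v ^ p ^ e) ^ p ^ 1"
      by (simp only: frob_diff) (simp add: power_mult[symmetric] mult.commute)
    then have "s ^ p - (v ^ p) ^ p ^ e \<in> range \<phi>" using range_pow[OF v(2) p_pos, of 1] by (simp only:)
    then show ?thesis using S_pow[OF v(1) p_pos[of 1]] by (simp only: power_one_right) blast
  qed
  then show ?thesis using assms S_pow p_pos[of 1] by (auto simp: stable_def)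
qed

lemma fixed_frob: assumes "s \<in> fixed" shows "s ^ p ^ e - s \<in> range \<phi>"
proof (induction e)
  case 0
  show ?case using range_zero by simp
next
  case (Suc e)
  have "s ^ p ^ Suc e - s = (s ^ p ^ e - s) ^ p ^ 1 + (s ^ p - s)"
    by (simp only: frob_diff) (simp add: power_mult[symmetric] mult.commute)
  moreover have "s ^ p - s \<in> range \<phi>" using assms by (simp add: fixed_def)
  ultimately show ?case
    using range_add[OF range_pow[OF Suc p_pos, of 1]] by (simp only:)
qed

lemma fixed_stable: "fixed \<subseteq> stable"
proof
  fix s assume s: "s \<in> fixed"
  have "s - s ^ p ^ e \<in> range \<phi>" for e
    using range_diff[OF range_zero fixed_frob[OF s, of e]] by simp
  then show "s \<in> stable" using s unfolding stable_def fixed_def by blast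
qed

lemma kspan_fixed_stable: "kspan fixed \<subseteq> stable"
proof
  fix x assume "x \<in> kspan fixed"
  then show "x \<in> stable"
    by induction (use stable_range fixed_stable stable_add stable_mult in blast)+
qed

text \<open>Write the class of s as F^e(t) with e the uniform bound of
  \<open>uniform_frob_nil\<close>: if F(s) vanishes, t is Frobenius-nilpotent, so F^e(t) vanishes
  already.\<close>

lemma stable_frob_inj: assumes "s \<in> stable" "s ^ p \<in> range \<phi>" shows "s \<in> range \<phi>"
proof -
  obtain e where e: "\<And>t. t \<in> frob_nil \<Longrightarrow> t ^ p ^ e \<in> range \<phi>" using uniform_frob_nil by blast
  obtain t where t: "t \<in> S" "s - t ^ p ^ e \<in> range \<phi>" using assms(1) unfolding stable_def by blast
  have "s ^ p - t ^ p ^ Suc e = (s - t ^ p ^ e) ^ p ^ 1"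
    by (simp only: frob_diff) (simp add: power_mult[symmetric] mult.commute)
  then have "s ^ p - t ^ p ^ Suc e \<in> range \<phi>" using range_pow[OF t(2) p_pos, of 1] by simp
  then have "t ^ p ^ Suc e \<in> range \<phi>" using range_diff[OF assms(2), of "s ^ p - t ^ p ^ Suc e"] by simp
  then have "t \<in> frob_nil" using t(1) unfolding frob_nil_def by blast
  then have "t ^ p ^ e \<in> range \<phi>" by (rule e)
  then show ?thesis using range_add[OF t(2)] by force
qed

text \<open>On multiples l w of a fixed class w, the operator F - \<alpha> sends the coefficient l
  to l^p - \<alpha> l, so the equation is solved one coefficient at a time by Artin-Schreier roots
  in K.\<close>

lemma kspan_fixed_solve:
  assumes "y \<in> kspan fixed" "\<alpha> \<in> K"
  shows "\<exists>d\<in>kspan fixed. d ^ p - \<phi> \<alpha> * d - y \<in> range \<phi>"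
  using assms(1)
proof (induction rule: kspan.induct)
  case (base r)
  then show ?case
    using range_diff[OF range_zero base] kspan.base[OF range_zero] p_pos[of 1]
    by (intro bexI[of _ 0]) (auto simp: power_0_left)
next
  case (step k w y)
  then obtain d where d: "d \<in> kspan fixed" "d ^ p - \<phi> \<alpha> * d - y \<in> range \<phi>" by blast
  obtain l where l: "l \<in> K" "l ^ p - \<alpha> * l = k" using K_artin_schreier[OF assms(2) step(1)] by blast
  have w: "w ^ p - w \<in> range \<phi>" using step by (auto simp: fixed_def)
  have "(\<phi> l * w + d) ^ p = \<phi> (l ^ p) * w ^ p + d ^ p"
    using frob_add[of "\<phi> l * w" d 1] p_pos[of 1] by (simp add: power_mult_distrib \<phi>_power)
  moreover have "\<phi> k = \<phi> (l ^ p) - \<phi> \<alpha> * \<phi> l" unfolding l(2)[symmetric] \<phi>_diff \<phi>_mult ..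
  ultimately have "(\<phi> l * w + d) ^ p - \<phi> \<alpha> * (\<phi> l * w + d) - (\<phi> k * w + y)
      = \<phi> (l ^ p) * (w ^ p - w) + (d ^ p - \<phi> \<alpha> * d - y)"
    by (simp only:) (simp add: algebra_simps)
  also have "\<dots> \<in> range \<phi>" using range_add[OF range_mult[OF w] d(2)] .
  finally show ?case using kspan.step[OF l(1) step(2) d(1)] by blast
qed

text \<open>A nontrivial Frobenius relation lets one split off a factor \<open>F - \<alpha>\<close> on the right; the equation
  \<open>(F - \<alpha>) c = c'\<close> is then solved first inside the span of the fixed classes.\<close>

lemma stable_relation_kspan_fixed:
  assumes "c \<in> stable" "\<And>i. a i \<in> K" "a n = 1" "(\<Sum>i\<le>n. \<phi> (a i) * c ^ p ^ i) \<in> range \<phi>"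
  shows "c \<in> kspan fixed"
  using assms
proof (induction n arbitrary: a c)
  case 0
  then have "\<phi> 1 * c \<in> range \<phi>" by simp
  then have "c \<in> range \<phi>" using S_one[OF subsetD[OF stable_subset 0(1)]] by (simp only:)
  then show ?case by (rule kspan.base)
next
  case (Suc n)
  define T where "T = (\<lambda>y::'b. y ^ p)"
  have p: "p > 0" using p_pos[of 1] by simp
  have T_iter: "(T ^^ i) y = y ^ p ^ i" for i y
    by (induction i) (auto simp: T_def power_mult[symmetric] mult.commute)
  have T_add: "T (x + y) = T x + T y" for x y using frob_add[of x y 1] by (simp add: T_def)
  have T_mult: "T (\<phi> k * y) = \<phi> (k ^ p) * T y" for k y
    using \<phi>_power[OF p] by (simp add: T_def power_mult_distrib)
  obtain \<alpha> b where \<alpha>: "\<alpha> \<in> K" and b: "\<And>i. b i \<in> K" "b n = 1"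
    and eq: "\<And>c. (\<Sum>i\<le>Suc n. \<phi> (a i) * (T ^^ i) c) = (\<Sum>i\<le>n. \<phi> (b i) * (T ^^ i) (T c - \<phi> \<alpha> * c))"
    using semilinear_factor[of T p a n, OF T_add T_mult p Suc.prems(2,3)] by blast
  let ?c' = "c ^ p - \<phi> \<alpha> * c"
  have c': "?c' \<in> stable" using stable_diff[OF stable_frob stable_mult] Suc.prems(1) \<alpha> by blast
  have "(\<Sum>i\<le>n. \<phi> (b i) * ?c' ^ p ^ i) = (\<Sum>i\<le>Suc n. \<phi> (a i) * c ^ p ^ i)"
    using eq[of c] by (simp only: T_iter) (simp add: T_def)
  then have "?c' \<in> kspan fixed" using Suc.IH[OF c', of b, OF b] Suc.prems(4) by simp
  then obtain d where d: "d \<in> kspan fixed" "d ^ p - \<phi> \<alpha> * d - ?c' \<in> range \<phi>"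
    using kspan_fixed_solve \<alpha> by blast
  \<comment> \<open>The difference is stable and killed by F - \<alpha> in H^1. For \<alpha> = 0 it
    vanishes by injectivity of F; otherwise a scalar \<beta> with \<beta>^(p-1) inverse to \<alpha>
    makes \<beta> g a fixed class.\<close>
  define g where "g = c - d"
  have g: "g \<in> stable" using stable_diff Suc.prems(1) d(1) kspan_fixed_stable by (auto simp: g_def)
  have gS: "g \<in> S" using g stable_subset by auto
  have "g ^ p - \<phi> \<alpha> * g = - (d ^ p - \<phi> \<alpha> * d - ?c')"
    using frob_diff[of c d 1] by (simp add: g_def algebra_simps)
  then have g_eq: "g ^ p - \<phi> \<alpha> * g \<in> range \<phi>"
    using range_diff[OF range_zero d(2)] by simp
  have "g \<in> kspan fixed"
  proof (cases "\<alpha> = 0")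
    case True
    then have "g \<in> range \<phi>" using g_eq stable_frob_inj[OF g] by (simp add: \<phi>_zero)
    then show ?thesis by (rule kspan.base)
  next
    case False
    then obtain \<gamma> where \<gamma>: "\<gamma> \<in> K" "\<alpha> * \<gamma> = 1" using K_inverse \<alpha> by blast
    have p1: "p - 1 > 0" using prime_gt_1_nat[OF p_prime] by simp
    obtain \<beta> where \<beta>: "\<beta> \<in> K" "\<beta> ^ (p - 1) = \<gamma>" using K_nth_root[OF p1 \<gamma>(1)] by blast
    have "\<beta> ^ p = \<beta> * \<gamma>" using \<beta>(2) p1 by (metis Suc_pred' power_Suc p)
    moreover have "\<beta> * \<gamma> * \<alpha> = \<beta> * (\<alpha> * \<gamma>)" by (simp only: ac_simps)
    ultimately have \<beta>p: "\<beta> ^ p * \<alpha> = \<beta>" using \<gamma>(2) by simp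
    have "\<beta> \<noteq> 0" using \<beta>(2) \<gamma>(2) p1 by (auto simp: power_0_left)
    then obtain \<delta> where \<delta>: "\<delta> \<in> K" "\<beta> * \<delta> = 1" using K_inverse \<beta>(1) by blast
    have "(\<phi> \<beta> * g) ^ p - \<phi> \<beta> * g = \<phi> (\<beta> ^ p) * g ^ p - \<phi> (\<beta> ^ p * \<alpha>) * g"
      using \<beta>p \<phi>_power[OF p] by (simp add: power_mult_distrib)
    also have "\<dots> = \<phi> (\<beta> ^ p) * (g ^ p - \<phi> \<alpha> * g)"
      by (simp add: \<phi>_mult algebra_simps)
    finally have "\<phi> \<beta> * g \<in> fixed"
      unfolding fixed_def using range_mult[OF g_eq] S_scale[OF gS] by simp
    then have "\<phi> \<delta> * (\<phi> \<beta> * g) + 0 \<in> kspan fixed"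
      by (intro kspan.step \<delta>(1) kspan.base range_zero)
    moreover have "\<phi> \<delta> * (\<phi> \<beta> * g) = \<phi> (\<beta> * \<delta>) * g" by (simp only: \<phi>_mult ac_simps)
    ultimately show ?thesis using \<delta>(2) S_one[OF gS] by simp
  qed
  then show ?case using kspan_add[OF _ d(1), of g] by (simp add: g_def)
qed


subsection \<open>The stable part is spanned by fixed classes\<close>

lemma ideal_pow_subset_if_only_prime:
  assumes I: "is_ideal I" and only: "\<And>P. prime_ideal P \<Longrightarrow> I \<subseteq> P \<Longrightarrow> P = m"
  shows "\<exists>b. ideal_pow m b \<subseteq> I"
proof -
  obtain Ps where Ps: "\<And>J. J \<in> set Ps \<Longrightarrow> prime_ideal J \<and> I \<subseteq> J"
    "\<And>as. list_all2 (\<in>) as Ps \<Longrightarrow> prod_list as \<in> I"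
    using ideal_contains_prime_product[OF noeth I] by metis
  have "ideal_pow m (length Ps) \<subseteq> I"
  proof (rule ideal_pow_subset_if_products[OF I])
    fix as assume "length as = length Ps" "set as \<subseteq> m"
    then have "list_all2 (\<in>) as Ps"
      using Ps(1) only by (auto simp: list_all2_conv_all_nth) (metis in_mono nth_mem)
    then show "prod_list as \<in> I" by (rule Ps(2))
  qed
  then show ?thesis by blast
qed

text \<open>Bounded denominators make this module A finitely generated, and its image in H^1 is
  killed by some m^b. As R = K + m, each layer m^j A / m^(j+1) A is spanned over K by products of
  generators of m^j with generators of A.\<close>

lemma bounded_denominators_kspan:
  "\<exists>ws. set ws \<subseteq> S \<and> {s \<in> S. \<forall>x\<in>set xs. \<phi> x ^ N * s \<in> range \<phi>} \<subseteq> kspan (set ws)"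
proof -
  let ?A = "{s \<in> S. \<forall>x\<in>set xs. \<phi> x ^ N * s \<in> range \<phi>}"
  have "submod \<phi> ?A"
    unfolding submod_def
    using submod_zero[OF S_submod] S_diff S_scale range_diff range_zero range_mult
    by (auto simp: right_diff_distrib mult.left_commute)
  then have "\<exists>gs. set gs \<subseteq> ?A \<and> ?A \<subseteq> lcomb \<phi> UNIV gs"
    by (intro fg_bounded[of _ N]) auto
  then obtain gs where gs: "set gs \<subseteq> ?A" "?A \<subseteq> lcomb \<phi> UNIV gs" by blast
  define I where "I = {r. \<forall>g\<in>set gs. \<phi> r * g \<in> range \<phi>}"
  have I: "is_ideal I"
    unfolding is_ideal_def I_def using range_zero range_add range_mult
    by (simp add: \<phi>_zero \<phi>_add \<phi>_mult distrib_right mult.assoc)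
  have "\<exists>b. ideal_pow m b \<subseteq> I"
  proof (rule ideal_pow_subset_if_only_prime[OF I])
    fix P assume P: "prime_ideal P" "I \<subseteq> P"
    have "set xs \<subseteq> P"
    proof
      fix x assume x: "x \<in> set xs"
      have "\<phi> (x ^ N) * g \<in> range \<phi>" if "g \<in> set gs" for g
      proof -
        have "g \<in> S" "\<phi> x ^ N * g \<in> range \<phi>" using gs(1) x that by blast+
        then show ?thesis using \<phi>_power_mult[of g x N] by (simp only:)
      qed
      then have "x ^ N \<in> I" unfolding I_def by blast
      then show "x \<in> P" using P(2) prime_ideal_power_iff[OF P(1), of x N] by blast
    qed
    then have "m \<subseteq> P" using ideal_gen_subset[OF prime_ideal_is_ideal[OF P(1)]] m_gen by blast
    moreover have "P \<subseteq> m" using local_ring_ideal_subset[OF local] P(1) by (simp add: prime_ideal_def)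
    ultimately show "P = m" by blast
  qed
  then obtain b where b: "ideal_pow m b \<subseteq> I" by blast
  have gS: "set gs \<subseteq> S" using gs(1) by auto
  have Pz: "0 \<in> ideal_pow m j" for j by (rule ideal_zero[OF is_ideal_ideal_pow])
  have "\<exists>ws. set ws \<subseteq> S \<and> lcomb \<phi> (ideal_pow m 0) gs \<subseteq> kspan (set ws)"
  proof (rule inc_induct[of 0 b])
    have "lcomb \<phi> (ideal_pow m b) gs \<subseteq> range \<phi>"
      by (rule lcomb_subset) (use range_zero range_add b I_def in blast)+
    then show "\<exists>ws. set ws \<subseteq> S \<and> lcomb \<phi> (ideal_pow m b) gs \<subseteq> kspan (set ws)"
      by (intro exI[of _ "[]"]) (auto intro: kspan.base)
  next
    fix j assume "\<exists>ws. set ws \<subseteq> S \<and> lcomb \<phi> (ideal_pow m (Suc j)) gs \<subseteq> kspan (set ws)"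
    then obtain ws where ws: "set ws \<subseteq> S" "lcomb \<phi> (ideal_pow m (Suc j)) gs \<subseteq> kspan (set ws)" by blast
    obtain hs where hs: "ideal_pow m j = icomb UNIV hs" "set hs \<subseteq> ideal_pow m j"
      using noetherian_fg[OF noeth is_ideal_ideal_pow] by metis
    let ?ws = "ws @ concat (map (\<lambda>h. map (\<lambda>g. \<phi> h * g) gs) hs)"
    have wsS: "set ?ws \<subseteq> S" using ws(1) gS S_scale by auto
    have mono: "kspan (set ws) \<subseteq> kspan (set ?ws)" by (rule kspan_mono) auto
    have elem: "\<phi> a * g \<in> kspan (set ?ws)" if g: "g \<in> set gs" and a: "a \<in> ideal_pow m j" for a g
    proof -
      have "icomb UNIV hs \<subseteq> {a. \<phi> a * g \<in> kspan (set ?ws)}"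
      proof (rule lcomb_subset)
        show "0 \<in> {a. \<phi> a * g \<in> kspan (set ?ws)}"
          using kspan.base[OF range_zero] by (simp add: \<phi>_zero)
        show "x + y \<in> {a. \<phi> a * g \<in> kspan (set ?ws)}"
          if "x \<in> {a. \<phi> a * g \<in> kspan (set ?ws)}" "y \<in> {a. \<phi> a * g \<in> kspan (set ?ws)}" for x y
          using kspan_add that by (simp add: \<phi>_add distrib_right)
        fix r h assume h: "h \<in> set hs"
        \<comment> \<open>Split r into its residue in K and an element of m; the latter drops to the
          next layer, whose span is already available.\<close>
        obtain k where k: "k \<in> K" "r - k \<in> m" using K_residue by blast
        have "h * (r - k) \<in> ideal_pow m (Suc j)" using hs(2) h k(2) by (intro ideal_pow_Suc_mem) auto
        then have "\<phi> (h * (r - k)) * g \<in> kspan (set ?ws)"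
          using lcomb_mem[OF g, of _ "ideal_pow m (Suc j)" \<phi>, OF _ \<phi>_zero Pz] ws(2) mono by blast
        moreover have "\<phi> h * g \<in> set ?ws" using g h by auto
        ultimately have "\<phi> k * (\<phi> h * g) + \<phi> (h * (r - k)) * g \<in> kspan (set ?ws)"
          by (intro kspan.step k(1))
        moreover have "\<phi> k * (\<phi> h * g) + \<phi> (h * (r - k)) * g = \<phi> (r * h) * g"
          by (simp add: \<phi>_mult \<phi>_diff algebra_simps)
        ultimately show "r * h \<in> {a. \<phi> a * g \<in> kspan (set ?ws)}" by simp
      qed
      then show ?thesis using a hs(1) by blast
    qed
    have "lcomb \<phi> (ideal_pow m j) gs \<subseteq> kspan (set ?ws)"
      by (rule lcomb_subset) (use kspan.base[OF range_zero] kspan_add elem in blast)+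
    then show "\<exists>ws. set ws \<subseteq> S \<and> lcomb \<phi> (ideal_pow m j) gs \<subseteq> kspan (set ws)" using wsS by blast
  qed simp
  then show ?thesis using gs(2) by (simp only: ideal_pow.simps(1)) blast
qed

text \<open>Induction on \<open>ws\<close>: a pivot f j with nonzero coefficient at w eliminates w
  from all later members of the sequence. Infinitely many members remain, and the index j stays free
  for the pivot.\<close>

lemma kspan_dependent:
  fixes f :: "nat \<Rightarrow> 'b"
  assumes "set ws \<subseteq> S" "\<And>i. f i \<in> kspan (set ws)"
  shows "\<exists>I a. finite I \<and> (\<forall>i. a i \<in> K) \<and> (\<exists>i\<in>I. a i \<noteq> 0) \<and> (\<Sum>i\<in>I. \<phi> (a i) * f i) \<in> range \<phi>"
  using assms
proof (induction ws arbitrary: f)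
  case Nil
  have "f 0 \<in> range \<phi>" using Nil(2)[of 0] by (induction rule: kspan.induct) auto
  then have "\<phi> 1 * f 0 \<in> range \<phi>" by (rule range_mult)
  then show ?case using K_one by (intro exI[of _ "{0}"] exI[of _ "\<lambda>_. 1"]) simp
next
  case (Cons w ws)
  have "\<forall>i. \<exists>k y. k \<in> K \<and> y \<in> kspan (set ws) \<and> f i = \<phi> k * w + y"
    using kspan_insertE Cons.prems(2) by fastforce
  then obtain k y where ky: "\<And>i. k i \<in> K" "\<And>i. y i \<in> kspan (set ws)" "\<And>i. f i = \<phi> (k i) * w + y i"
    by metis
  have wsS: "set ws \<subseteq> S" using Cons.prems by auto
  show ?case
  proof (cases "\<forall>i. k i = 0")
    case True
    then have "f i \<in> kspan (set ws)" for i using ky(2,3) \<phi>_zero by simp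
    then show ?thesis using Cons.IH[OF wsS] by blast
  next
    case False
    then obtain j where "k j \<noteq> 0" by blast
    then obtain l where l: "l \<in> K" "k j * l = 1" using K_inverse ky(1) by blast
    define c where "c i = k (i + Suc j) * l" for i
    have cK: "c i \<in> K" for i using ky(1) l(1) by (simp add: c_def K_mult)
    define g where "g i = f (i + Suc j) - \<phi> (c i) * f j" for i
    have "g i \<in> kspan (set ws)" for i
    proof -
      have "c i * k j = k (i + Suc j) * (k j * l)" by (simp only: c_def ac_simps)
      then have "c i * k j = k (i + Suc j)" using l(2) by simp
      then have "\<phi> (c i) * (\<phi> (k j) * w) = \<phi> (k (i + Suc j)) * w"
        by (simp add: \<phi>_mult[symmetric] mult.assoc[symmetric])
      then have "g i = y (i + Suc j) - \<phi> (c i) * y j"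
        unfolding g_def ky(3) by (simp add: distrib_left)
      then show ?thesis using kspan_diff[OF wsS ky(2) kspan_mult[OF ky(2) cK]] by simp
    qed
    then obtain I a where I: "finite I" "\<And>i. a i \<in> K" "\<exists>i\<in>I. a i \<noteq> 0" "(\<Sum>i\<in>I. \<phi> (a i) * g i) \<in> range \<phi>"
      using Cons.IH[OF wsS, of g] by blast
    define b where "b i = (if i = j then - (\<Sum>i\<in>I. a i * c i) else a (i - Suc j))" for i
    let ?I = "insert j ((\<lambda>i. i + Suc j) ` I)"
    have jn: "j \<notin> (\<lambda>i. i + Suc j) ` I" by auto
    have "(\<Sum>i\<in>?I. \<phi> (b i) * f i) = \<phi> (b j) * f j + (\<Sum>i\<in>I. \<phi> (b (i + Suc j)) * f (i + Suc j))"
      using I(1) jn by (simp add: sum.reindex inj_on_def)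
    also have "\<dots> = (\<Sum>i\<in>I. \<phi> (a i) * g i)"
      by (simp add: b_def g_def rhom_uminus[OF hom] rhom_sum[OF hom] \<phi>_mult sum_subtractf
          right_diff_distrib sum_distrib_right mult.assoc)
    finally have rel: "(\<Sum>i\<in>?I. \<phi> (b i) * f i) \<in> range \<phi>" using I(4) by (simp only:)
    have bK: "b i \<in> K" for i
      using I(2) cK by (simp add: b_def K_uminus K_sum K_mult)
    have nz: "\<exists>i\<in>?I. b i \<noteq> 0"
    proof -
      obtain i where "i \<in> I" "a i \<noteq> 0" using I(3) by blast
      then show ?thesis by (intro bexI[of _ "i + Suc j"]) (auto simp: b_def)
    qed
    show ?thesis
      by (rule exI[of _ ?I], rule exI[of _ b]) (simp only: rel bK nz I(1) finite_insert finite_imageI simp_thms)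
  qed
qed

lemma stable_relation:
  assumes c: "c \<in> stable"
  shows "\<exists>n a. (\<forall>i. a i \<in> K) \<and> a n = 1 \<and> (\<Sum>i\<le>n. \<phi> (a i) * c ^ p ^ i) \<in> range \<phi>"
proof -
  have cS: "c \<in> S" using c stable_subset by blast
  obtain e0 where e0: "\<And>t. t \<in> frob_nil \<Longrightarrow> t ^ p ^ e0 \<in> range \<phi>" using uniform_frob_nil by blast
  obtain E where E: "\<And>x. x \<in> set xs \<Longrightarrow> \<phi> x ^ E * c \<in> range \<phi>" using denominators[OF cS] by blast
  have large: "E \<le> p ^ (e + e0 + E)" for e
  proof -
    have "E \<le> 2 ^ E" by (simp add: less_imp_le)
    also have "\<dots> \<le> p ^ E" using prime_ge_2_nat[OF p_prime] by (intro power_mono) auto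
    also have "\<dots> \<le> p ^ (e + e0 + E)" using prime_ge_1_nat[OF p_prime] by (intro power_increasing) auto
    finally show ?thesis .
  qed
  \<comment> \<open>In the exponent, e numbers the root, e0 is held back so that \<theta> e =
    t^(p^e0) loses its Frobenius-nilpotent part, and E makes q = p^(e + e0 + E) at least E, so that
    x^E c in R' yields (x t)^q in R'.\<close>
  have "\<forall>e. \<exists>t. t \<in> S \<and> c - t ^ p ^ (e + e0 + E) \<in> range \<phi>" using c unfolding stable_def by blast
  then obtain t where t: "\<And>e. t e \<in> S" "\<And>e. c - t e ^ p ^ (e + e0 + E) \<in> range \<phi>" by metis
  define \<theta> where "\<theta> e = t e ^ p ^ e0" for e
  have \<theta>_pow: "\<theta> e ^ p ^ (e + E) = t e ^ p ^ (e + e0 + E)" for e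
    by (simp add: \<theta>_def power_mult[symmetric] power_add[symmetric] ac_simps)
  have "\<theta> e \<in> {s \<in> S. \<forall>x\<in>set xs. \<phi> x ^ p ^ e0 * s \<in> range \<phi>}" for e
  proof -
    have "\<phi> x ^ p ^ e0 * \<theta> e \<in> range \<phi>" if x: "x \<in> set xs" for x
    proof -
      let ?q = "p ^ (e + e0 + E)"
      have "\<phi> (x ^ (?q - E)) * (\<phi> x ^ E * c) \<in> range \<phi>" by (rule range_mult[OF E[OF x]])
      moreover have "\<phi> (x ^ (?q - E)) * (\<phi> x ^ E * c) = \<phi> x ^ ?q * c"
        using large[of e] \<phi>_power_mult[of "\<phi> x ^ E * c" x "?q - E"] S_scale_pow[OF cS, of x E]
        by (simp add: mult.assoc[symmetric] power_add[symmetric])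
      ultimately have 1: "\<phi> x ^ ?q * c \<in> range \<phi>" by simp
      have "\<phi> (x ^ ?q) * (c - t e ^ ?q) \<in> range \<phi>" by (rule range_mult[OF t(2)])
      then have 2: "\<phi> x ^ ?q * (c - t e ^ ?q) \<in> range \<phi>" using \<phi>_power[OF p_pos] by (simp only:)
      have "(\<phi> x * t e) ^ ?q = \<phi> x ^ ?q * c - \<phi> x ^ ?q * (c - t e ^ ?q)"
        by (simp add: power_mult_distrib right_diff_distrib)
      then have "(\<phi> x * t e) ^ ?q \<in> range \<phi>" using range_diff[OF 1 2] by (simp only:)
      then have "\<phi> x * t e \<in> frob_nil" unfolding frob_nil_def using S_scale[OF t(1)] by blast
      then have "(\<phi> x * t e) ^ p ^ e0 \<in> range \<phi>" by (rule e0)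
      then show ?thesis by (simp only: power_mult_distrib \<theta>_def)
    qed
    moreover have "\<theta> e \<in> S" unfolding \<theta>_def by (rule S_pow[OF t(1) p_pos])
    ultimately show ?thesis by blast
  qed
  then obtain ws where ws: "set ws \<subseteq> S" "\<And>e. \<theta> e \<in> kspan (set ws)"
    using bounded_denominators_kspan[of "p ^ e0"] by blast
  obtain I a where I: "finite I" "\<And>i. a i \<in> K" "\<exists>i\<in>I. a i \<noteq> 0" "(\<Sum>i\<in>I. \<phi> (a i) * \<theta> i) \<in> range \<phi>"
    using kspan_dependent[of ws \<theta>, OF ws] by blast
  define N where "N = Max I"
  have IN: "i \<le> N" if "i \<in> I" for i using I(1) that by (simp add: N_def)
  \<comment> \<open>This power sends \<theta> i to c^(p^(N - i)) modulo R', so every index i \<le> N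
    gives a nonnegative Frobenius exponent on c.\<close>
  let ?Q = "p ^ (E + N)"
  have \<theta>Q: "c ^ p ^ (N - i) - \<theta> i ^ ?Q \<in> range \<phi>" if i: "i \<in> I" for i
  proof -
    have "\<theta> i ^ ?Q = (t i ^ p ^ (i + e0 + E)) ^ p ^ (N - i)"
      unfolding \<theta>_pow[symmetric] using IN[OF i]
      by (simp add: power_mult[symmetric] power_add[symmetric] ac_simps)
    then have "c ^ p ^ (N - i) - \<theta> i ^ ?Q = (c - t i ^ p ^ (i + e0 + E)) ^ p ^ (N - i)"
      by (simp only: frob_diff)
    then show ?thesis using range_pow[OF t(2) p_pos] by (simp only:)
  qed
  have "(\<Sum>i\<in>I. \<phi> (a i) * \<theta> i) ^ ?Q \<in> range \<phi>" by (rule range_pow[OF I(4) p_pos])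
  then have 1: "(\<Sum>i\<in>I. \<phi> (a i ^ ?Q) * \<theta> i ^ ?Q) \<in> range \<phi>"
    by (simp only: frob_sum power_mult_distrib \<phi>_power[OF p_pos])
  have 2: "(\<Sum>i\<in>I. \<phi> (a i ^ ?Q) * (c ^ p ^ (N - i) - \<theta> i ^ ?Q)) \<in> range \<phi>"
    by (intro range_sum range_mult \<theta>Q)
  have "(\<Sum>i\<in>I. \<phi> (a i ^ ?Q) * c ^ p ^ (N - i)) \<in> range \<phi>"
    using range_add[OF 1 2] by (simp only: sum.distrib[symmetric] distrib_left[symmetric]) simp
  define b where "b j = (if N - j \<in> I \<and> j \<le> N then a (N - j) ^ ?Q else 0)" for j
  have bK: "b j \<in> K" for j using I(2) by (simp add: b_def K_power K_zero)
  have "(\<Sum>j\<le>N. \<phi> (b j) * c ^ p ^ j) = (\<Sum>j\<in>(\<lambda>i. N - i) ` I. \<phi> (b j) * c ^ p ^ j)"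
  proof (rule sum.mono_neutral_right)
    show "\<forall>j\<in>{..N} - (\<lambda>i. N - i) ` I. \<phi> (b j) * c ^ p ^ j = 0"
    proof
      fix j assume j: "j \<in> {..N} - (\<lambda>i. N - i) ` I"
      then have "N - j \<notin> I" by (metis DiffE atMost_iff diff_diff_cancel image_eqI)
      then show "\<phi> (b j) * c ^ p ^ j = 0" by (simp add: b_def \<phi>_zero)
    qed
  qed auto
  also have "\<dots> = (\<Sum>i\<in>I. \<phi> (b (N - i)) * c ^ p ^ (N - i))"
  proof (subst sum.reindex)
    show "inj_on (\<lambda>i. N - i) I" using IN by (auto simp: inj_on_def) (metis diff_diff_cancel)
  qed simp
  also have "\<dots> = (\<Sum>i\<in>I. \<phi> (a i ^ ?Q) * c ^ p ^ (N - i))"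
    using IN by (intro sum.cong) (auto simp: b_def)
  finally have rel: "(\<Sum>j\<le>N. \<phi> (b j) * c ^ p ^ j) \<in> range \<phi>"
    using \<open>(\<Sum>i\<in>I. \<phi> (a i ^ ?Q) * c ^ p ^ (N - i)) \<in> range \<phi>\<close> by (simp only:)
  \<comment> \<open>Truncating at the highest nonzero coefficient and dividing by it makes the
    relation monic.\<close>
  define J where "J = {j. j \<le> N \<and> b j \<noteq> 0}"
  have "J \<noteq> {}"
  proof -
    obtain i where "i \<in> I" "a i \<noteq> 0" using I(3) by blast
    then have "N - i \<in> J" using IN K_power_nonzero[OF I(2)] by (auto simp: J_def b_def)
    then show ?thesis by blast
  qed
  define n where "n = Max J"
  have J: "finite J" by (simp add: J_def)
  have n: "n \<in> J" unfolding n_def by (rule Max_in[OF J \<open>J \<noteq> {}\<close>])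
  have above: "b j = 0" if "j \<le> N" "n < j" for j
    using that Max_ge[OF J, of j] unfolding n_def J_def by fastforce
  have "(\<Sum>j\<le>N. \<phi> (b j) * c ^ p ^ j) = (\<Sum>j\<le>n. \<phi> (b j) * c ^ p ^ j)"
    using n above by (intro sum.mono_neutral_right) (auto simp: J_def \<phi>_zero)
  then have rel': "(\<Sum>j\<le>n. \<phi> (b j) * c ^ p ^ j) \<in> range \<phi>" using rel by (simp only:)
  obtain l where l: "l \<in> K" "b n * l = 1" using K_inverse[OF bK, of n] n by (auto simp: J_def)
  have "\<phi> l * (\<Sum>j\<le>n. \<phi> (b j) * c ^ p ^ j) \<in> range \<phi>" by (rule range_mult[OF rel'])
  then have "(\<Sum>j\<le>n. \<phi> (l * b j) * c ^ p ^ j) \<in> range \<phi>"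
    by (simp only: sum_distrib_left \<phi>_mult mult.assoc)
  then show ?thesis using l bK
    by (intro exI[of _ n] exI[of _ "\<lambda>j. l * b j"]) (simp add: K_mult mult.commute)
qed

lemma stable_kspan_fixed: "stable \<subseteq> kspan fixed"
proof
  fix c assume c: "c \<in> stable"
  from stable_relation[OF c] obtain n a where a: "\<And>i. a i \<in> K" "a n = 1"
    "(\<Sum>i\<le>n. \<phi> (a i) * c ^ p ^ i) \<in> range \<phi>" by blast
  show "c \<in> kspan fixed" by (rule stable_relation_kspan_fixed[OF c, of a n]) (rule a)+
qed

subsection \<open>Idempotents\<close>

text \<open>Split r into a constant, handled in K, and x in m, for which the series -(x + x^p +
  x^(p^2) + ...) telescopes. Its limit solves the equation up to an element of every m^n, which is
  nilpotent; this is enough, since a Frobenius power removes it later.\<close>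

lemma artin_schreier:
  "\<exists>t z. t ^ p - t = r + z \<and> (\<exists>n. z ^ n = (0::'a))"
proof -
  obtain k where k: "k \<in> K" "r - k \<in> m" using K_residue by blast
  obtain \<kappa> where \<kappa>: "\<kappa> ^ p - \<kappa> = k" using K_artin_schreier[OF K_one k(1)] by auto
  define x where "x = r - k"
  define a where "a n = - (\<Sum>i<n. x ^ p ^ i)" for n
  have xm: "x \<in> m" using k(2) by (simp add: x_def)
  have frob1: "(s + t) ^ p = s ^ p + t ^ p" "(s - t) ^ p = s ^ p - t ^ p" for s t :: 'a
    using frob_add_a[of s t 1] frob_diff_a[of s t 1] by simp_all
  have p0: "p > 0" using p_pos[of 1] by simp
  have P: "is_ideal (ideal_pow m n)" for n by (rule is_ideal_ideal_pow)
  have n_le: "n \<le> p ^ n" for n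
  proof -
    have "n \<le> 2 ^ n" by (simp add: less_imp_le)
    also have "\<dots> \<le> p ^ n" using prime_ge_2_nat[OF p_prime] by (intro power_mono) auto
    finally show ?thesis .
  qed
  have xpow: "x ^ p ^ n \<in> ideal_pow m n" for n
    by (rule ideal_pow_mono_mem[OF ideal_power_mem_pow[OF m_ideal xm] n_le])
  have "a (Suc n) - a n \<in> ideal_pow m n" for n
    using ideal_uminus[OF P xpow] by (simp add: a_def)
  then obtain l where l: "\<And>n. l - a n \<in> ideal_pow m n"
    using complete[unfolded madic_complete_def, THEN spec, of a] by blast
  have a_eq: "a n ^ p - a n = x - x ^ p ^ n" for n
  proof (induction n)
    case 0
    show ?case using p0 by (simp add: a_def power_0_left)
  next
    case (Suc n)
    have "a (Suc n) = a n - x ^ p ^ n" by (simp add: a_def)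
    then have "a (Suc n) ^ p - a (Suc n) = (a n ^ p - a n) - (x ^ p ^ n) ^ p + x ^ p ^ n"
      by (simp add: frob1)
    then show ?case using Suc by (simp add: power_mult[symmetric] mult.commute)
  qed
  define z where "z = l ^ p - l - x"
  have z: "z \<in> ideal_pow m n" for n
  proof -
    have "z = (l - a n) ^ p - (l - a n) - x ^ p ^ n"
      using a_eq[of n] by (simp add: z_def frob1 algebra_simps)
    then show ?thesis
      using ideal_diff[OF P ideal_diff[OF P ideal_power[OF P l p0] l] xpow, of n] by (simp only:)
  qed
  have "\<exists>n. z ^ n = 0"
  proof (rule nilpotent_if_powers_deep[OF noeth local m_gen])
    show "z \<in> m" using z[of "Suc 0"] ideal_pow_one[OF m_ideal] by blast
    show "\<exists>n>0. \<exists>w\<in>ideal_pow m (k * n). \<exists>t. \<forall>x\<in>set xs. x ^ t * (z ^ n - w) = 0" for k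
      using z[of "k * 1"] by (intro exI[of _ "1::nat"] conjI bexI[of _ z]) simp_all
  qed
  moreover have "(\<kappa> + l) ^ p - (\<kappa> + l) = r + z"
  proof -
    have "(\<kappa> + l) ^ p - (\<kappa> + l) = (\<kappa> ^ p - \<kappa>) + (l ^ p - l)" by (simp add: frob1)
    then show ?thesis unfolding \<kappa> by (simp add: z_def x_def)
  qed
  ultimately show ?thesis by blast
qed

text \<open>Subtracting an Artin-Schreier solution leaves s' with s'^p - s' nilpotent. A Frobenius
  power makes this 0 and alters s' only by an element of R', because the class of s' is
  fixed.\<close>

lemma fixed_lift:
  assumes s: "s \<in> fixed"
  shows "\<exists>\<sigma>\<in>S. \<sigma> ^ p = \<sigma> \<and> s - \<sigma> \<in> range \<phi>"
proof -
  have frob1: "(x - y) ^ p = x ^ p - y ^ p" for x y :: 'b using frob_diff[of x y 1] by simp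
  have p0: "p > 0" using p_pos[of 1] by simp
  have sS: "s \<in> S" and "s ^ p - s \<in> range \<phi>" using s unfolding fixed_def by blast+
  then obtain r where r: "s ^ p - s = \<phi> r" by blast
  obtain t z n where tz: "t ^ p - t = r + z" "z ^ n = 0" using artin_schreier by blast
  define s' where "s' = s - \<phi> t"
  have s'S: "s' \<in> S" unfolding s'_def by (rule S_diff[OF sS S_\<phi>])
  have "s' ^ p - s' = (s ^ p - s) - (\<phi> t ^ p - \<phi> t)" by (simp add: s'_def frob1)
  also have "\<phi> t ^ p - \<phi> t = \<phi> r + \<phi> z"
    unfolding \<phi>_power[OF p0, symmetric] \<phi>_diff[symmetric] tz(1) \<phi>_add ..
  finally have s': "s' ^ p - s' = - \<phi> z" using r by simp
  obtain e where e: "\<And>r::'a. \<exists>n. r ^ n = 0 \<Longrightarrow> r ^ p ^ e = 0" using uniform_nilpotence_base by blast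
  define \<sigma> where "\<sigma> = s' ^ p ^ e"
  have "\<sigma> ^ p - \<sigma> = (s' ^ p - s') ^ p ^ e"
    unfolding frob_diff \<sigma>_def by (simp add: power_mult[symmetric] mult.commute)
  also have "\<dots> = (0 - \<phi> z) ^ p ^ e" using s' by simp
  also have "\<dots> = - \<phi> (z ^ p ^ e)" unfolding frob_diff using p_pos \<phi>_power by (simp add: power_0_left)
  also have "\<dots> = 0"
  proof -
    have "z ^ p ^ e = 0" using e tz(2) by blast
    then show ?thesis by (simp only: \<phi>_zero minus_zero)
  qed
  finally have "\<sigma> ^ p = \<sigma>" by simp
  have fix': "s' \<in> fixed" unfolding fixed_def using s'S s' rhom_uminus[OF hom, of z] by (metis (mono_tags, lifting) mem_Collect_eq rangeI)
  have "s - \<sigma> = \<phi> t - (\<sigma> - s')" by (simp add: s'_def)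
  moreover have "\<phi> t - (\<sigma> - s') \<in> range \<phi>"
    unfolding \<sigma>_def by (intro range_diff[OF rangeI fixed_frob[OF fix']])
  ultimately have "s - \<sigma> \<in> range \<phi>" by (simp only:)
  moreover have "\<sigma> \<in> S" unfolding \<sigma>_def by (rule S_pow[OF s'S p_pos])
  ultimately show ?thesis using \<open>\<sigma> ^ p = \<sigma>\<close> by blast
qed

section \<open>Decomposition into primitive idempotents\<close>

definition idem :: "'b set" where
  "idem = {e \<in> S. e * e = e}"

definition primitive :: "'b set" where
  "primitive = {e \<in> idem. e \<noteq> 0 \<and> (\<forall>f\<in>idem. f * e = 0 \<or> f * e = e)}"

lemma idem_mult: "e \<in> idem \<Longrightarrow> f \<in> idem \<Longrightarrow> e * f \<in> idem"
proof -
  assume "e \<in> idem" "f \<in> idem"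
  moreover have "e * f * (e * f) = (e * e) * (f * f)" by (simp only: ac_simps)
  ultimately show ?thesis using S_mult by (simp add: idem_def)
qed

lemma idem_diff: "e \<in> idem \<Longrightarrow> f \<in> idem \<Longrightarrow> f * e = f \<Longrightarrow> e - f \<in> idem"
  using S_diff by (simp add: idem_def algebra_simps)

lemma idem_one: "\<phi> 1 \<in> idem"
  using S_\<phi> by (simp add: idem_def \<phi>_mult[symmetric])

lemma idem_zero: "0 \<in> idem"
  using submod_zero[OF S_submod] by (simp add: idem_def)

lemma idem_one_mult: "e \<in> idem \<Longrightarrow> e * \<phi> 1 = e"
  using S_one[of e] by (simp add: idem_def mult.commute)

text \<open>The Noetherian property is available for R, so idempotents are compared by their
  annihilators in R. If f below e had the same annihilator, each numerator of e - f would kill f,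
  hence e, and e - f would vanish by separation.\<close>

lemma idem_wf: "wf {(f, e). f \<in> idem \<and> e \<in> idem \<and> f * e = f \<and> f \<noteq> e}"
proof (rule wfI_min)
  fix e0 Q assume e0: "(e0 :: 'b) \<in> Q"
  let ?r = "{(f, e). f \<in> idem \<and> e \<in> idem \<and> f * e = f \<and> f \<noteq> e}"
  define I where "I e = {r. \<phi> r * e = 0}" for e
  have I: "is_ideal (I e)" for e
    unfolding is_ideal_def I_def by (simp add: \<phi>_zero \<phi>_add \<phi>_mult distrib_right mult.assoc)
  show "\<exists>e\<in>Q. \<forall>f. (f, e) \<in> ?r \<longrightarrow> f \<notin> Q"
  proof (cases "Q \<subseteq> idem")
    case False
    then show ?thesis by blast
  next
    case True
    obtain J where J: "J \<in> I ` Q" and max: "\<And>J'. J' \<in> I ` Q \<Longrightarrow> J \<subseteq> J' \<Longrightarrow> J' = J"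
      by (rule noetherian_maximal[OF noeth, of "I ` Q" "I e0"]) (use e0 I in auto)
    then obtain e where e: "e \<in> Q" "J = I e" by blast
    have "f \<notin> Q" if fe: "(f, e) \<in> ?r" for f
    proof
      assume fQ: "f \<in> Q"
      have f: "f \<in> idem" "e \<in> idem" "f * e = f" "f \<noteq> e" using fe by auto
      have "I e \<subseteq> I f"
      proof
        fix r assume "r \<in> I e"
        then have "\<phi> r * e * f = 0" by (simp add: I_def)
        moreover have "\<phi> r * e * f = \<phi> r * f" using f(3) by (simp add: mult.assoc mult.commute[of e])
        ultimately show "r \<in> I f" by (simp add: I_def)
      qed
      then have eq: "I f = I e" using max[of "I f"] fQ e by auto
      have dS: "e - f \<in> S" using f S_diff by (auto simp: idem_def)
      obtain N where N: "\<And>x. x \<in> set xs \<Longrightarrow> \<phi> x ^ N * (e - f) \<in> range \<phi>" using denominators[OF dS] by blast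
      have "e - f = 0"
      proof (rule separated[OF dS, of N])
        fix x assume x: "x \<in> set xs"
        obtain r where r: "\<phi> x ^ N * (e - f) = \<phi> r" using N[OF x] by blast
        have "(e - f) * f = f * e - f * f" by (simp add: algebra_simps)
        then have "(e - f) * f = 0" using f by (simp add: idem_def)
        then have "\<phi> r * f = 0" unfolding r[symmetric] by (simp add: mult.assoc)
        then have "\<phi> r * e = 0" using eq by (auto simp: I_def)
        moreover have "(e - f) * e = e - f" using f by (simp add: idem_def left_diff_distrib)
        then have "\<phi> r * e = \<phi> x ^ N * (e - f)" unfolding r[symmetric] by (simp add: mult.assoc)
        ultimately show "\<phi> x ^ N * (e - f) = 0" by simp
      qed
      then show False using f(4) by simp
    qed
    then show ?thesis using e(1) by blast
  qed
qed

lemma primitive_mult: "e \<in> primitive \<Longrightarrow> f \<in> primitive \<Longrightarrow> e \<noteq> f \<Longrightarrow> e * f = 0"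
proof (rule ccontr)
  assume *: "e \<in> primitive" "f \<in> primitive" "e \<noteq> f" "e * f \<noteq> 0"
  then have "e * f = f" "f * e = 0 \<or> f * e = e" unfolding primitive_def by blast+
  then show False using *(3,4) by (simp add: mult.commute)
qed

lemma primitive_sum_mult:
  assumes "P \<subseteq> primitive" "finite P" "f \<in> primitive"
  shows "f * (\<Sum>P) = (if f \<in> P then f else 0)"
proof -
  have "f * (\<Sum>P) = (\<Sum>g\<in>P. if g = f then f else 0)"
    unfolding sum_distrib_left
  proof (rule sum.cong)
    fix g assume "g \<in> P"
    then show "f * g = (if g = f then f else 0)"
      using assms primitive_mult[of f g] by (auto simp: primitive_def idem_def)
  qed simp
  then show ?thesis using assms(2) by (simp add: sum.delta)
qed

lemma idem_sum_primitive: "e \<in> idem \<Longrightarrow> \<exists>P\<subseteq>primitive. finite P \<and> \<Sum>P = e"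
proof (induction e rule: wf_induct_rule[OF idem_wf])
  case (1 e)
  show ?case
  proof (cases "e = 0 \<or> e \<in> primitive")
    case True
    then show ?thesis by (auto intro: exI[of _ "{}"] exI[of _ "{e}"])
  next
    case False
    then obtain f where f: "f \<in> idem" "f * e \<noteq> 0" "f * e \<noteq> e"
      using "1.prems" unfolding primitive_def by blast
    let ?g = "f * e"
    have ee: "e * e = e" using "1.prems" by (simp add: idem_def)
    have g: "?g \<in> idem" "?g * e = ?g" using idem_mult[OF f(1) "1.prems"] ee by (simp_all add: mult.assoc)
    have h: "e - ?g \<in> idem" "(e - ?g) * e = e - ?g"
      using idem_diff[OF "1.prems" g] g(2) ee by (simp_all add: left_diff_distrib)
    obtain P Q where P: "P \<subseteq> primitive" "finite P" "\<Sum>P = ?g" and Q: "Q \<subseteq> primitive" "finite Q" "\<Sum>Q = e - ?g"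
      using "1.IH"[of ?g] "1.IH"[of "e - ?g"] g h f "1.prems" by auto
    have "P \<inter> Q = {}"
    proof (rule ccontr)
      assume "P \<inter> Q \<noteq> {}"
      then obtain q where q: "q \<in> P" "q \<in> Q" by blast
      then have "q * ?g = q" "q * (e - ?g) = q"
        using primitive_sum_mult[OF P(1,2), of q] primitive_sum_mult[OF Q(1,2), of q] P Q by auto
      then have "q = q * ?g * (e - ?g)" by (simp only:)
      also have "\<dots> = q * (?g * e - ?g * ?g)" by (simp only: mult.assoc right_diff_distrib)
      also have "\<dots> = 0" using g by (simp add: idem_def)
      finally show False using q P by (auto simp: primitive_def)
    qed
    then have "\<Sum>(P \<union> Q) = e" using P Q by (simp add: sum.union_disjoint)
    then show ?thesis using P Q by (intro exI[of _ "P \<union> Q"]) auto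
  qed
qed

text \<open>Every primitive f occurs in a decomposition of \<phi> 1, since f = f * \<phi> 1 is
  nonzero while f is orthogonal to all other primitives.\<close>

lemma finite_primitive: "finite primitive" and sum_primitive: "\<Sum>primitive = \<phi> 1"
proof -
  obtain P where P: "P \<subseteq> primitive" "finite P" "\<Sum>P = \<phi> 1" using idem_sum_primitive[OF idem_one] by blast
  have "primitive \<subseteq> P"
  proof
    fix f assume f: "f \<in> primitive"
    then have "f * (\<Sum>P) = f" using P(3) idem_one_mult by (auto simp: primitive_def)
    then show "f \<in> P" using primitive_sum_mult[OF P(1,2) f] f by (auto simp: primitive_def split: if_splits)
  qed
  then have "primitive = P" using P by blast
  then show "finite primitive" "\<Sum>primitive = \<phi> 1" using P by auto
qed

lemma primitive_nonempty: "primitive \<noteq> {}"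
  using sum_primitive nontrivial by force

text \<open>A monic polynomial in \<sigma> kills c. Splitting off linear factors over K, the last
  nonzero vector is an eigenvector, and multiplication by e still fixes it.\<close>

lemma eigenvector:
  assumes "\<sigma> \<in> S" "c \<in> S" "c \<noteq> 0" "c * e = c" "\<And>i. a i \<in> K" "a n = 1"
    "(\<Sum>i\<le>n. \<phi> (a i) * (((*) \<sigma>) ^^ i) c) = 0"
  shows "\<exists>k\<in>K. \<exists>d\<in>S. d \<noteq> 0 \<and> d * e = d \<and> \<sigma> * d = \<phi> k * d"
  using assms
proof (induction n arbitrary: a c)
  case 0
  then have "\<phi> 1 * c = 0" by simp
  then show ?case using S_one[OF 0(2)] 0(3) by simp
next
  case (Suc n)
  have "((*) \<sigma>) (x + y) = ((*) \<sigma>) x + ((*) \<sigma>) y" for x y by (simp add: distrib_left)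
  moreover have "((*) \<sigma>) (\<phi> k * y) = \<phi> (k ^ 1) * ((*) \<sigma>) y" for k y by (simp add: mult.left_commute)
  ultimately have "\<exists>\<alpha>\<in>K. \<exists>b. (\<forall>i. b i \<in> K) \<and> b n = 1 \<and>
    (\<forall>c. (\<Sum>i\<le>Suc n. \<phi> (a i) * (((*) \<sigma>) ^^ i) c) = (\<Sum>i\<le>n. \<phi> (b i) * (((*) \<sigma>) ^^ i) (\<sigma> * c - \<phi> \<alpha> * c)))"
    by (rule semilinear_factor[where d = 1]) (use Suc.prems in auto)
  then obtain \<alpha> b where \<alpha>: "\<alpha> \<in> K" and b: "\<And>i. b i \<in> K" "b n = 1" and
    eq: "(\<Sum>i\<le>Suc n. \<phi> (a i) * (((*) \<sigma>) ^^ i) c) = (\<Sum>i\<le>n. \<phi> (b i) * (((*) \<sigma>) ^^ i) (\<sigma> * c - \<phi> \<alpha> * c))"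
    by blast
  let ?c = "\<sigma> * c - \<phi> \<alpha> * c"
  show ?case
  proof (cases "?c = 0")
    case True
    then show ?thesis using \<alpha> Suc.prems by auto
  next
    case False
    have "?c \<in> S" using S_diff[OF S_mult S_scale] Suc.prems by blast
    moreover have "?c * e = ?c" using Suc.prems(4) by (simp add: left_diff_distrib mult.assoc)
    moreover have "(\<Sum>i\<le>n. \<phi> (b i) * (((*) \<sigma>) ^^ i) ?c) = 0" using eq Suc.prems(7) by (simp only:)
    ultimately show ?thesis using Suc.IH[OF Suc.prems(1), of ?c b] False b by blast
  qed
qed

text \<open>As a root of X^p - X, \<sigma> has an eigenvector d in the component of e, with an
  eigenvalue k satisfying k^p = k. Then \<tau> = (\<sigma> - k) e satisfies \<tau>^p = \<tau>, so
  \<tau>^(p-1) is an idempotent below e; it kills d, so it is 0 and not e.\<close>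

lemma primitive_scalar:
  assumes \<sigma>: "\<sigma> \<in> S" "\<sigma> ^ p = \<sigma>" and e: "e \<in> primitive"
  shows "\<exists>k\<in>K. \<sigma> * e = \<phi> k * e"
proof -
  have eS: "e \<in> S" "e * e = e" "e \<noteq> 0" using e by (auto simp: primitive_def idem_def)
  have p1: "1 < p" using prime_gt_1_nat[OF p_prime] .
  have frob1: "(x - y) ^ p = x ^ p - y ^ p" for x y :: 'b using frob_diff[of x y 1] by simp
  define a :: "nat \<Rightarrow> 'a" where "a i = (if i = p then 1 else if i = 1 then - 1 else 0)" for i
  have "(\<Sum>i\<le>p. \<phi> (a i) * (((*) \<sigma>) ^^ i) e) = 0"
  proof -
    have iter: "(((*) \<sigma>) ^^ i) e = \<sigma> ^ i * e" for i by (induction i) (auto simp: mult.assoc)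
    have "(\<Sum>i\<le>p. \<phi> (a i) * (((*) \<sigma>) ^^ i) e) = (\<Sum>i\<in>{1, p}. \<phi> (a i) * (((*) \<sigma>) ^^ i) e)"
      using p1 by (intro sum.mono_neutral_right) (auto simp: a_def \<phi>_zero)
    also have "\<dots> = \<phi> (- 1) * (\<sigma> * e) + \<phi> 1 * (\<sigma> ^ p * e)"
      unfolding iter using p1 by (simp add: a_def)
    also have "\<dots> = 0" using \<sigma>(2) by (simp add: rhom_uminus[OF hom])
    finally show ?thesis .
  qed
  moreover have "a i \<in> K" for i using K_zero K_one K_uminus by (simp add: a_def)
  moreover have "a p = 1" by (simp add: a_def)
  ultimately obtain k d where kd: "k \<in> K" "d \<in> S" "d \<noteq> 0" "d * e = d" "\<sigma> * d = \<phi> k * d"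
    using eigenvector[OF \<sigma>(1) eS(1,3,2), of a p] by blast
  have pow: "\<sigma> ^ i * d = \<phi> k ^ i * d" for i
  proof (induction i)
    case (Suc i)
    have "\<sigma> ^ Suc i * d = \<phi> k ^ i * (\<sigma> * d)" using Suc by (simp add: mult.assoc mult.left_commute)
    then show ?case unfolding kd(5) by (simp add: mult.assoc mult.left_commute)
  qed simp
  have "\<phi> (k ^ p - k) * d = \<sigma> ^ p * d - \<sigma> * d"
    using p1 by (simp add: \<phi>_diff \<phi>_power left_diff_distrib pow kd(5))
  then have "\<phi> (k ^ p - k) * d = 0" using \<sigma>(2) by simp
  then have kp: "k ^ p = k"
    using \<phi>_K_cancel[of "k ^ p - k" d] K_diff[OF K_power[OF kd(1)] kd(1)] kd(2,3) by auto
  define \<tau> where "\<tau> = (\<sigma> - \<phi> k) * e"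
  have \<tau>S: "\<tau> \<in> S" unfolding \<tau>_def by (intro S_mult S_diff \<sigma>(1) S_\<phi> eS(1))
  have e_pow: "e ^ i = e" if "i > 0" for i using that
  proof (induction i)
    case (Suc i)
    then show ?case using eS(2) by (cases i) auto
  qed simp
  have \<tau>p: "\<tau> ^ p = \<tau>"
    using \<sigma>(2) kp p1 e_pow[of p] \<phi>_power[of p k] by (simp add: \<tau>_def power_mult_distrib frob1)
  define f where "f = \<tau> ^ (p - 1)"
  have f\<tau>: "f * \<tau> = \<tau>" unfolding f_def using \<tau>p p1 by (metis One_nat_def Suc_pred mult.commute power_Suc zero_less_one order.strict_trans)
  have "f * \<tau> ^ i = \<tau> ^ i" if "i > 0" for i
    using that f\<tau> by (cases i) (auto simp: mult.assoc[symmetric])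
  then have "f * f = f" using p1 by (simp add: f_def)
  moreover have "f \<in> S" unfolding f_def using p1 by (intro S_pow[OF \<tau>S]) auto
  ultimately have "f \<in> idem" by (simp add: idem_def)
  moreover have fe: "f * e = f"
  proof -
    have "\<tau> * e = \<tau>" using eS(2) by (simp add: \<tau>_def mult.assoc)
    then have "\<tau> ^ i * e = \<tau> ^ i" if "i > 0" for i using that
      by (cases i) (simp_all add: power_Suc2 mult.assoc del: power_Suc)
    then show ?thesis using p1 by (simp add: f_def)
  qed
  ultimately have "f = 0 \<or> f = e" using e by (auto simp: primitive_def)
  moreover have "f \<noteq> e"
  proof
    assume "f = e"
    have "\<tau> * d = (\<sigma> * d - \<phi> k * d) * e" by (simp add: \<tau>_def algebra_simps)
    then have "\<tau> * d = 0" using kd(5) by simp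
    then have "\<tau> ^ i * d = 0" if "i > 0" for i using that
      by (cases i) (simp_all add: power_Suc2 mult.assoc del: power_Suc)
    then have "f * d = 0" using p1 by (simp add: f_def)
    then show False using \<open>f = e\<close> kd(3,4) by (simp add: mult.commute)
  qed
  ultimately have "\<tau> = 0" using f\<tau> by simp
  then have "\<sigma> * e = \<phi> k * e" by (simp add: \<tau>_def left_diff_distrib)
  then show ?thesis using kd(1) by blast
qed

theorem stable_spanned:
  assumes "c \<in> stable"
  shows "\<exists>k. (\<forall>e. k e \<in> K) \<and> c - (\<Sum>e\<in>primitive. \<phi> (k e) * e) \<in> range \<phi>"
proof -
  have prS: "primitive \<subseteq> S" by (auto simp: primitive_def idem_def)
  have "fixed \<subseteq> kspan primitive"
  proof
    fix s assume "s \<in> fixed"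
    then obtain \<sigma> where \<sigma>: "\<sigma> \<in> S" "\<sigma> ^ p = \<sigma>" "s - \<sigma> \<in> range \<phi>" using fixed_lift by blast
    have "\<forall>e\<in>primitive. \<exists>k. k \<in> K \<and> \<sigma> * e = \<phi> k * e" using primitive_scalar[OF \<sigma>(1,2)] by blast
    then obtain k where k: "\<And>e. e \<in> primitive \<Longrightarrow> k e \<in> K \<and> \<sigma> * e = \<phi> (k e) * e" by metis
    have "\<sigma> = \<sigma> * (\<Sum>primitive)" using sum_primitive S_one[OF \<sigma>(1)] by (simp add: mult.commute)
    also have "\<dots> = (\<Sum>e\<in>primitive. \<phi> (k e) * e)"
      unfolding sum_distrib_left using k by (intro sum.cong) auto
    also have "\<dots> \<in> kspan primitive"
    proof -
      have "(\<Sum>e\<in>P. \<phi> (k e) * e) \<in> kspan primitive" if "finite P" "P \<subseteq> primitive" for P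
        using that
      proof (induction P)
        case empty
        then show ?case using kspan.base[OF range_zero] by simp
      next
        case (insert e P)
        then show ?case using k[of e] by (auto intro: kspan.step)
      qed
      then show ?thesis using finite_primitive by blast
    qed
    finally have "(s - \<sigma>) + \<sigma> \<in> kspan primitive" by (intro kspan_add kspan.base[OF \<sigma>(3)])
    then show "s \<in> kspan primitive" by simp
  qed
  then have "c \<in> kspan primitive" using stable_kspan_fixed assms kspan_kspan by blast
  then show ?thesis using kspan_finite[OF finite_primitive prS] by blast
qed

lemma primitive_stable: "primitive \<subseteq> stable"
proof
  fix e assume "e \<in> primitive"
  then have e: "e \<in> S" "e * e = e" by (auto simp: primitive_def idem_def)
  have "e ^ i = e" if "i > 0" for i using that
  proof (induction i)
    case (Suc i)
    then show ?case using e(2) by (cases i) auto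
  qed simp
  then have "e - e ^ p ^ i \<in> range \<phi>" for i using p_pos range_zero by simp
  then show "e \<in> stable" unfolding stable_def using e(1) by blast
qed

text \<open>If \<open>\<Sum> k\<^sub>e e\<close> comes from \<open>r \<in> R\<close> with residue \<open>k\<^sub>0\<close>, then the unit \<open>(k\<^sub>e - k\<^sub>0) - (r - k\<^sub>0)\<close> would
  annihilate \<open>e\<close> whenever \<open>k\<^sub>e \<noteq> k\<^sub>0\<close>.\<close>

theorem primitive_independent:
  assumes k: "\<And>e. e \<in> primitive \<Longrightarrow> k e \<in> K" and sum: "(\<Sum>e\<in>primitive. \<phi> (k e) * e) \<in> range \<phi>"
  shows "\<exists>k0. \<forall>e\<in>primitive. k e = k0"
proof -
  obtain r where r: "(\<Sum>e\<in>primitive. \<phi> (k e) * e) = \<phi> r" using sum by blast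
  obtain k0 where k0: "k0 \<in> K" "r - k0 \<in> m" using K_residue by blast
  have "k e = k0" if e: "e \<in> primitive" for e
  proof (rule ccontr)
    assume ne: "k e \<noteq> k0"
    have eS: "e \<in> S" "e * e = e" "e \<noteq> 0" using e by (auto simp: primitive_def idem_def)
    have "\<phi> r * e = (\<Sum>f\<in>primitive. \<phi> (k f) * (f * e))"
      unfolding r[symmetric] sum_distrib_right by (simp add: mult.assoc)
    also have "\<dots> = (\<Sum>f\<in>primitive. if f = e then \<phi> (k e) * e else 0)"
      using primitive_mult[OF _ e] eS(2) by (intro sum.cong) auto
    also have "\<dots> = \<phi> (k e) * e" using e finite_primitive by (simp add: sum.delta)
    finally have "\<phi> (k e - r) * e = 0" by (simp add: \<phi>_diff left_diff_distrib)
    moreover have "k e - r \<notin> m"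
    proof
      assume "k e - r \<in> m"
      then have "(k e - r) + (r - k0) \<in> m" using k0(2) ideal_add[OF m_ideal] by blast
      then show False using K_not_m[OF K_diff[OF k[OF e] k0(1)]] ne by simp
    qed
    ultimately have "e \<in> {0}" by (intro unit_cancel[OF _ eS(1)]) (auto simp: submod_def)
    then show False using eS(3) by simp
  qed
  then show ?thesis by blast
qed

end

section \<open>Connected components of the punctured spectrum\<close>

text \<open>Products s * t describe intersections: a prime misses some s * t exactly when it misses
  some s and some t.\<close>

lemma openin_zariski_punctured:
  "openin (zariski_punctured m) U \<longleftrightarrow> (\<exists>S. U = punctured_spec m - {P. S \<subseteq> P})"
proof -
  let ?open = "\<lambda>U. \<exists>S. U = punctured_spec m - {P. S \<subseteq> P}"
  have "istopology ?open"
    unfolding istopology_def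
  proof (intro conjI allI impI)
    fix U V assume "?open U" "?open V"
    then obtain S T where ST: "U = punctured_spec m - {P. S \<subseteq> P}" "V = punctured_spec m - {P. T \<subseteq> P}" by blast
    have "U \<inter> V = punctured_spec m - {P. {s * t | s t. s \<in> S \<and> t \<in> T} \<subseteq> P}"
    proof (intro set_eqI iffI)
      fix P assume "P \<in> U \<inter> V"
      then obtain s t where *: "P \<in> punctured_spec m" "s \<in> S" "s \<notin> P" "t \<in> T" "t \<notin> P" unfolding ST by blast
      then have "s * t \<notin> P" by (simp add: punctured_spec_def prime_ideal_mult_iff)
      then show "P \<in> punctured_spec m - {P. {s * t | s t. s \<in> S \<and> t \<in> T} \<subseteq> P}" using * by blast
    next
      fix P assume P: "P \<in> punctured_spec m - {P. {s * t | s t. s \<in> S \<and> t \<in> T} \<subseteq> P}"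
      then obtain s t where *: "s \<in> S" "t \<in> T" "s * t \<notin> P" by blast
      have "prime_ideal P" using P by (simp add: punctured_spec_def)
      then have "s \<notin> P" "t \<notin> P" using * by (auto simp: prime_ideal_mult_iff)
      then show "P \<in> U \<inter> V" unfolding ST using P * by blast
    qed
    then show "?open (U \<inter> V)" by blast
  next
    fix \<U> assume "\<forall>U\<in>\<U>. ?open U"
    then obtain S where S: "\<And>U. U \<in> \<U> \<Longrightarrow> U = punctured_spec m - {P. S U \<subseteq> P}" by metis
    have "\<Union>\<U> = punctured_spec m - {P. (\<Union>U\<in>\<U>. S U) \<subseteq> P}"
      using S by blast
    then show "?open (\<Union>\<U>)" by blast
  qed
  then show ?thesis by (simp add: zariski_punctured_def)
qed

lemma topspace_zariski_punctured: "topspace (zariski_punctured m) = punctured_spec m"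
proof -
  have "openin (zariski_punctured m) (punctured_spec m)"
    unfolding openin_zariski_punctured
    by (intro exI[of _ UNIV]) (auto simp: punctured_spec_def prime_ideal_def)
  moreover have "topspace (zariski_punctured m) \<subseteq> punctured_spec m"
    unfolding topspace_def openin_zariski_punctured by blast
  ultimately show ?thesis by (meson openin_subset subset_antisym)
qed

text \<open>Each member is clopen because its complement is the union of the other members.\<close>

lemma connected_components_of_open_partition:
  assumes opn: "\<And>U. U \<in> \<U> \<Longrightarrow> openin X U" and conn: "\<And>U. U \<in> \<U> \<Longrightarrow> connectedin X U"
    and ne: "{} \<notin> \<U>" and disj: "\<And>U V. U \<in> \<U> \<Longrightarrow> V \<in> \<U> \<Longrightarrow> U \<noteq> V \<Longrightarrow> U \<inter> V = {}"
    and cover: "\<Union>\<U> = topspace X"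
  shows "connected_components_of X = \<U>"
proof -
  have comp: "Collect (connected_component_of X x) = U" if "U \<in> \<U>" "x \<in> U" for U x
  proof
    have "V \<inter> U = {}" if "V \<in> \<U> - {U}" for V using disj[of V U] that \<open>U \<in> \<U>\<close> by auto
    then have "topspace X - U = \<Union>(\<U> - {U})" unfolding cover[symmetric] by auto
    then have "openin X (topspace X - U)" using opn by auto
    then have "closedin X U" using opn[OF that(1)] by (simp add: closedin_def openin_subset)
    moreover have "x \<in> Collect (connected_component_of X x)"
      using that cover by (auto simp: connected_component_of_refl)
    ultimately show "Collect (connected_component_of X x) \<subseteq> U"
      using connectedin_clopen_cases[OF connectedin_connected_component_of, of X U x] opn[OF that(1)] that(2)
      by (auto simp: disjnt_iff)
    show "U \<subseteq> Collect (connected_component_of X x)"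
      by (rule connected_component_of_maximal[OF conn[OF that(1)] that(2)])
  qed
  show ?thesis
  proof
    show "connected_components_of X \<subseteq> \<U>"
    proof
      fix C assume "C \<in> connected_components_of X"
      then obtain x where x: "x \<in> topspace X" "C = Collect (connected_component_of X x)"
        by (auto simp: connected_components_of_def)
      then obtain U where "U \<in> \<U>" "x \<in> U" unfolding cover[symmetric] by blast
      then show "C \<in> \<U>" using comp x(2) by simp
    qed
    show "\<U> \<subseteq> connected_components_of X"
    proof
      fix U assume U: "U \<in> \<U>"
      then have "U \<noteq> {}" using ne by auto
      then obtain x where "x \<in> U" by blast
      moreover have "x \<in> topspace X" using U \<open>x \<in> U\<close> unfolding cover[symmetric] by blast
      ultimately show "U \<in> connected_components_of X"
        unfolding connected_components_of_def using comp[OF U, of x] by blast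
    qed
  qed
qed

section \<open>Idempotents as clopen subsets\<close>

context punctured_sections
begin

text \<open>The points where the germ of e is 1: the condition says that e becomes 1 after inverting
  the elements outside P.\<close>

definition support :: "'b \<Rightarrow> 'a set set" where
  "support e = {P \<in> punctured_spec m. \<exists>r. r \<notin> P \<and> \<phi> r * e = \<phi> r}"

lemma punctured_prime: "P \<in> punctured_spec m \<Longrightarrow> prime_ideal P"
  by (simp add: punctured_spec_def)

lemma punctured_gen: assumes "P \<in> punctured_spec m" shows "\<exists>x\<in>set xs. x \<notin> P"
proof (rule ccontr)
  assume "\<not> ?thesis"
  then have "m \<subseteq> P"
    using ideal_gen_subset[OF prime_ideal_is_ideal[OF punctured_prime[OF assms]], of xs] m_gen by blast
  moreover have "P \<subseteq> m"
    using local_ring_ideal_subset[OF local] punctured_prime[OF assms] by (simp add: prime_ideal_def)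
  ultimately show False using assms by (simp add: punctured_spec_def)
qed

lemma kernel_in_punctured: assumes "P \<in> punctured_spec m" "\<phi> r = 0" shows "r \<in> P"
proof -
  obtain x t where "x \<notin> P" "x ^ t * r = 0" using kernel assms punctured_gen by blast
  then have "x ^ t * r \<in> P" using ideal_zero[OF prime_ideal_is_ideal[OF punctured_prime[OF assms(1)]]] by simp
  then show ?thesis
    using \<open>x \<notin> P\<close> punctured_prime[OF assms(1)] by (simp add: prime_ideal_mult_iff prime_ideal_power_iff)
qed

lemma openin_support: "openin (zariski_punctured m) (support e)"
  unfolding openin_zariski_punctured support_def
  by (intro exI[of _ "{r. \<phi> r * e = \<phi> r}"]) blast

lemma support_disjoint:
  assumes "e * f = 0" shows "support e \<inter> support f = {}"
proof (rule ccontr)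
  assume "support e \<inter> support f \<noteq> {}"
  then obtain P r s where P: "P \<in> punctured_spec m" and rs: "r \<notin> P" "\<phi> r * e = \<phi> r" "s \<notin> P" "\<phi> s * f = \<phi> s"
    by (auto simp: support_def)
  have "\<phi> (r * s) = (\<phi> r * e) * (\<phi> s * f)" using rs by (simp add: \<phi>_mult)
  also have "\<dots> = \<phi> r * \<phi> s * (e * f)" by (simp only: ac_simps)
  finally have "r * s \<in> P" using assms kernel_in_punctured[OF P] by simp
  then show False using rs punctured_prime[OF P] by (simp add: prime_ideal_mult_iff)
qed

lemma idem_numerator:
  assumes "e \<in> idem" "x \<in> set xs"
  shows "\<exists>N r. \<phi> x ^ N * e = \<phi> r \<and> \<phi> r * e = \<phi> r"
proof -
  obtain N r where Nr: "\<phi> x ^ N * e = \<phi> r" using denominators[of e] assms by (auto simp: idem_def)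
  then have "\<phi> r * e = \<phi> x ^ N * (e * e)" by (metis mult.assoc)
  then show ?thesis using Nr assms by (auto simp: idem_def)
qed

lemma support_add:
  assumes e: "e \<in> idem" and f: "f \<in> idem" and ef: "e * f = 0"
  shows "support (e + f) = support e \<union> support f"
proof
  have sub: "support g \<subseteq> support (g + h)" if "g \<in> idem" "g * h = 0" for g h
  proof
    fix P assume "P \<in> support g"
    then obtain r where r: "P \<in> punctured_spec m" "r \<notin> P" "\<phi> r * g = \<phi> r" by (auto simp: support_def)
    have "\<phi> r * (g + h) = \<phi> r * g + \<phi> r * g * h" using r(3) by (simp add: distrib_left)
    moreover have "\<phi> r * g * h = 0" using that(2) by (simp only: mult.assoc mult_zero_right)
    ultimately have "\<phi> r * (g + h) = \<phi> r" using r(3) by simp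
    then show "P \<in> support (g + h)" using r by (auto simp: support_def)
  qed
  show "support e \<union> support f \<subseteq> support (e + f)"
    using sub[OF e ef] sub[OF f, of e] ef by (simp add: mult.commute add.commute)
  show "support (e + f) \<subseteq> support e \<union> support f"
  proof
    fix P assume "P \<in> support (e + f)"
    then obtain r where r: "P \<in> punctured_spec m" "r \<notin> P" "\<phi> r * (e + f) = \<phi> r" by (auto simp: support_def)
    obtain x where x: "x \<in> set xs" "x \<notin> P" using punctured_gen[OF r(1)] by blast
    obtain N a M b where a: "\<phi> x ^ N * e = \<phi> a" "\<phi> a * e = \<phi> a" and b: "\<phi> x ^ M * f = \<phi> b" "\<phi> b * f = \<phi> b"
      using idem_numerator[OF e x(1)] idem_numerator[OF f x(1)] by blast
    have Pp: "prime_ideal P" by (rule punctured_prime[OF r(1)])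
    \<comment> \<open>With a / x^N for e and b / x^M for f on D(x), this is e + f = 1 near P with
      denominators cleared. As x^(N + M) * r is outside P, so is a or b.\<close>
    have "\<phi> (x ^ M * a * r + x ^ N * b * r) = \<phi> x ^ (N + M) * (\<phi> r * (e + f))"
    proof -
      have "\<phi> (x ^ M * a * r) = \<phi> x ^ M * (\<phi> a * \<phi> r)"
        using \<phi>_power_mult[OF S_\<phi>, of x M "a * r"] by (simp add: \<phi>_mult mult.assoc)
      moreover have "\<phi> (x ^ N * b * r) = \<phi> x ^ N * (\<phi> b * \<phi> r)"
        using \<phi>_power_mult[OF S_\<phi>, of x N "b * r"] by (simp add: \<phi>_mult mult.assoc)
      ultimately show ?thesis
        unfolding a(1)[symmetric] b(1)[symmetric] by (simp add: \<phi>_add power_add algebra_simps)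
    qed
    also have "\<dots> = \<phi> (x ^ (N + M) * r)"
      unfolding r(3) using \<phi>_power_mult[OF S_\<phi>, of x "N + M" r] by (simp add: \<phi>_mult)
    finally have "x ^ M * a * r + x ^ N * b * r - x ^ (N + M) * r \<in> P"
      by (intro kernel_in_punctured[OF r(1)]) (simp only: \<phi>_diff diff_self)
    moreover have "x ^ (N + M) * r \<notin> P"
      using x(2) r(2) Pp by (simp add: prime_ideal_mult_iff prime_ideal_power_iff)
    moreover have "x ^ M * a * r + x ^ N * b * r - (x ^ M * a * r + x ^ N * b * r - x ^ (N + M) * r) = x ^ (N + M) * r"
      by simp
    ultimately have "x ^ M * a * r + x ^ N * b * r \<notin> P"
      using ideal_diff[OF prime_ideal_is_ideal[OF Pp]] by metis
    then have "x ^ M * a * r \<notin> P \<or> x ^ N * b * r \<notin> P"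
      using ideal_add[OF prime_ideal_is_ideal[OF Pp]] by blast
    then have "a \<notin> P \<or> b \<notin> P" using Pp by (auto simp: prime_ideal_mult_iff)
    then show "P \<in> support e \<union> support f" using a(2) b(2) r(1) by (auto simp: support_def)
  qed
qed

lemma support_zero: "support 0 = {}"
  using kernel_in_punctured by (auto simp: support_def)

lemma support_one: "support (\<phi> 1) = punctured_spec m"
proof -
  have "\<phi> 1 * \<phi> 1 = \<phi> 1" by (simp add: \<phi>_mult[symmetric])
  then show ?thesis using prime_ideal_one[OF punctured_prime] by (auto simp: support_def)
qed

lemma support_mult:
  assumes "e \<in> idem" "f \<in> idem"
  shows "support (e * f) = support e \<inter> support f"
proof
  show "support (e * f) \<subseteq> support e \<inter> support f"
  proof
    fix P assume "P \<in> support (e * f)"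
    then obtain r where r: "P \<in> punctured_spec m" "r \<notin> P" "\<phi> r * (e * f) = \<phi> r" by (auto simp: support_def)
    have "\<phi> r * e = \<phi> r * ((e * e) * f)" "\<phi> r * f = \<phi> r * (e * (f * f))"
      using r(3) by (metis mult.assoc mult.commute)+
    then show "P \<in> support e \<inter> support f" using r assms by (auto simp: support_def idem_def)
  qed
  show "support e \<inter> support f \<subseteq> support (e * f)"
  proof
    fix P assume "P \<in> support e \<inter> support f"
    then obtain r s where *: "P \<in> punctured_spec m" "r \<notin> P" "\<phi> r * e = \<phi> r" "s \<notin> P" "\<phi> s * f = \<phi> s"
      by (auto simp: support_def)
    have "r * s \<notin> P" using * punctured_prime by (simp add: prime_ideal_mult_iff)
    moreover have "\<phi> (r * s) * (e * f) = (\<phi> r * e) * (\<phi> s * f)" by (simp only: \<phi>_mult ac_simps)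
    then have "\<phi> (r * s) * (e * f) = \<phi> (r * s)" using * by (simp add: \<phi>_mult)
    ultimately show "P \<in> support (e * f)" using * by (auto simp: support_def)
  qed
qed

lemma nilpotent_if_in_punctured:
  assumes "\<And>P. P \<in> punctured_spec m \<Longrightarrow> r \<in> P" "r \<in> m"
  shows "\<exists>n. r ^ n = 0"
proof -
  have "is_ideal {0::'a}" by (simp add: is_ideal_def)
  then have "\<exists>n. r ^ n \<in> {0}"
    by (rule nilpotent_if_in_all_primes[OF noeth]) (use assms in \<open>auto simp: punctured_spec_def\<close>)
  then show ?thesis by simp
qed

text \<open>If the support were empty, each numerator of e would lie in all primes of the punctured
  spectrum. Multiplied by x it also lies in m, hence is nilpotent; a Frobenius power, which fixes e,
  then shows that e is torsion.\<close>

lemma support_nonempty: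
  assumes e: "e \<in> idem" "e \<noteq> 0" shows "support e \<noteq> {}"
proof
  assume emp: "support e = {}"
  have eS: "e \<in> S" "e * e = e" using e by (auto simp: idem_def)
  obtain N where N: "\<And>x. x \<in> set xs \<Longrightarrow> \<phi> x ^ N * e \<in> range \<phi>" using denominators[OF eS(1)] by blast
  obtain k where k: "\<And>r::'a. \<exists>n. r ^ n = 0 \<Longrightarrow> r ^ p ^ k = 0" using uniform_nilpotence_base by blast
  have e_pow: "e ^ i = e" if "i > 0" for i using that
  proof (induction i)
    case (Suc i)
    then show ?case using eS(2) by (cases i) auto
  qed simp
  have "e = 0"
  proof (rule separated[OF eS(1), of "Suc N * p ^ k"])
    fix x assume x: "x \<in> set xs"
    obtain r where r: "\<phi> x ^ N * e = \<phi> r" using N[OF x] by blast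
    have "\<phi> r * e = \<phi> r" unfolding r[symmetric] using eS(2) by (simp add: mult.assoc)
    then have "r \<in> P" if "P \<in> punctured_spec m" for P using emp that by (auto simp: support_def)
    then have "x * r \<in> P" if "P \<in> punctured_spec m" for P
      using that ideal_mult_left[OF prime_ideal_is_ideal[OF punctured_prime]] by blast
    then have "(x * r) ^ p ^ k = 0"
      using k nilpotent_if_in_punctured[of "x * r"] ideal_mult_right[OF m_ideal gen_in_m[OF x]] by blast
    then have "\<phi> (x * r) ^ p ^ k = 0" using \<phi>_power[OF p_pos, of "x * r" k] \<phi>_zero by simp
    moreover have "\<phi> (x * r) = \<phi> x ^ Suc N * e" by (simp add: \<phi>_mult r[symmetric] mult.assoc)
    ultimately have "(\<phi> x ^ Suc N) ^ p ^ k * e ^ p ^ k = 0" by (simp only: power_mult_distrib)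
    then show "\<phi> x ^ (Suc N * p ^ k) * e = 0" by (simp only: power_mult[symmetric] e_pow[OF p_pos])
  qed
  then show False using e(2) by simp
qed

text \<open>On \<open>D(x)\<close> the idempotent is \<open>a\<^sup>q / x\<^sup>t\<^sup>q\<close> where \<open>x\<^sup>t = a + b\<close> with \<open>a\<close> and \<open>b\<close> vanishing on the two
  pieces; \<open>ab\<close> is nilpotent there, and a large power \<open>q\<close> of \<open>p\<close> kills it.\<close>

lemma clopen_idem:
  assumes U: "openin (zariski_punctured m) U" and V: "openin (zariski_punctured m) V"
    and UV: "U \<inter> V = {}" "U \<union> V = punctured_spec m"
  shows "\<exists>e\<in>idem. support e = U"
proof -
  \<comment> \<open>The vanishing ideal of W. A prime other than m containing both I V and I U would
    lie in neither U nor V; hence powers of the generators lie in the sum.\<close>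
  define I where "I W = \<Inter>W" for W :: "'a set set"
  have Ii: "is_ideal (I W)" if "W \<subseteq> punctured_spec m" for W
  proof -
    have "is_ideal P" if "P \<in> W" for P
      using that \<open>W \<subseteq> punctured_spec m\<close> by (auto intro: prime_ideal_is_ideal[OF punctured_prime])
    then show ?thesis unfolding I_def by (rule is_ideal_Inter)
  qed
  have UX: "U \<subseteq> punctured_spec m" and VX: "V \<subseteq> punctured_spec m" using UV by auto
  obtain A where A: "U = punctured_spec m - {P. A \<subseteq> P}" using U by (auto simp: openin_zariski_punctured)
  obtain B where B: "V = punctured_spec m - {P. B \<subseteq> P}" using V by (auto simp: openin_zariski_punctured)
  have AI: "A \<subseteq> I V" and BI: "B \<subseteq> I U" using A B UV unfolding I_def by blast+
  let ?J = "set_plus (I V) (I U)"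
  have sub: "submod (\<lambda>x. x) (I V)" "submod (\<lambda>x. x) (I U)" using Ii UX VX by (simp_all add: submod_ident)
  have Ji: "is_ideal ?J" using submod_set_plus[OF sub] by (simp add: submod_ident)
  have IJ: "I V \<subseteq> ?J" "I U \<subseteq> ?J" using set_plus_left[OF sub(2)] set_plus_right[OF sub(1)] by blast+
  have "\<exists>t. x ^ t \<in> ?J" if x: "x \<in> set xs" for x
  proof (rule nilpotent_if_in_all_primes[OF noeth Ji])
    fix P assume P: "prime_ideal P" "?J \<subseteq> P"
    show "x \<in> P"
    proof (cases "P = m")
      case True
      then show ?thesis using gen_in_m[OF x] by simp
    next
      case False
      then have "P \<in> punctured_spec m" using P(1) by (simp add: punctured_spec_def)
      then have "P \<in> U \<union> V" using UV by simp
      moreover have "A \<subseteq> P" "B \<subseteq> P" using AI BI IJ P(2) by blast+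
      ultimately show ?thesis using A B by blast
    qed
  qed
  then obtain tt where tt: "\<And>x. x \<in> set xs \<Longrightarrow> x ^ tt x \<in> ?J" by metis
  define t where "t = Max (insert 0 (tt ` set xs))"
  have "x ^ t \<in> ?J" if x: "x \<in> set xs" for x
  proof -
    have "tt x \<le> t" unfolding t_def using x by (intro Max_ge) auto
    then have "x ^ t = x ^ (t - tt x) * x ^ tt x" by (simp add: power_add[symmetric])
    then show ?thesis using ideal_mult_left[OF Ji tt[OF x]] by simp
  qed
  then have "\<forall>x\<in>set xs. \<exists>a b. x ^ t = a + b \<and> a \<in> I V \<and> b \<in> I U" unfolding set_plus_def by blast
  then obtain a b where ab: "\<And>x. x \<in> set xs \<Longrightarrow> x ^ t = a x + b x \<and> a x \<in> I V \<and> b x \<in> I U" by metis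
  obtain k where k: "\<And>r::'a. \<exists>n. r ^ n = 0 \<Longrightarrow> r ^ p ^ k = 0" using uniform_nilpotence_base by blast
  let ?q = "p ^ k"
  \<comment> \<open>Primes of V contain a x and primes of U contain b y, so z * (a x * b y) lies in
    all primes, m being covered by the factor z.\<close>
  have \<phi>ab: "\<phi> (a x ^ ?q) * \<phi> (b y ^ ?q) = 0" if x: "x \<in> set xs" and y: "y \<in> set xs" for x y
  proof (rule separated[of _ "?q"])
    show "\<phi> (a x ^ ?q) * \<phi> (b y ^ ?q) \<in> S" by (intro S_mult S_\<phi>)
    fix z assume z: "z \<in> set xs"
    have "z * (a x * b y) \<in> P" if P: "P \<in> punctured_spec m" for P
    proof -
      note Pi = prime_ideal_is_ideal[OF punctured_prime[OF P]]
      have "a x \<in> P \<or> b y \<in> P" using P UV(2) ab[OF x] ab[OF y] unfolding I_def by blast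
      then have "a x * b y \<in> P" using ideal_mult_left[OF Pi] ideal_mult_right[OF Pi] by blast
      then show ?thesis by (rule ideal_mult_left[OF Pi])
    qed
    then have "(z * (a x * b y)) ^ ?q = 0"
      using k nilpotent_if_in_punctured[of "z * (a x * b y)"] ideal_mult_right[OF m_ideal gen_in_m[OF z]] by blast
    then have "\<phi> (z * (a x * b y)) ^ ?q = 0" using \<phi>_power[OF p_pos, of "z * (a x * b y)" k] \<phi>_zero by simp
    then show "\<phi> z ^ ?q * (\<phi> (a x ^ ?q) * \<phi> (b y ^ ?q)) = 0"
      by (simp only: \<phi>_mult \<phi>_power[OF p_pos] power_mult_distrib)
  qed
  have xq: "x ^ (t * ?q) = a x ^ ?q + b x ^ ?q" if "x \<in> set xs" for x
    using ab[OF that] by (simp add: power_mult frob_add_a)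
  \<comment> \<open>Because x^(t q) = a^q + b^q, the cross-multiplied difference becomes a_x^q b_y^q
    - a_y^q b_x^q, whose terms both vanish in \<open>S\<close>.\<close>
  have "cech_cocycle xs (\<lambda>i. a (xs ! i) ^ ?q, t * ?q)"
    unfolding cech_cocycle_def prod.case
  proof (intro allI impI)
    fix i j assume i: "i < length xs" and j: "j < length xs"
    let ?x = "xs ! i" and ?y = "xs ! j"
    have mem: "?x \<in> set xs" "?y \<in> set xs" using i j by auto
    have "a ?x ^ ?q * ?y ^ (t * ?q) - a ?y ^ ?q * ?x ^ (t * ?q) = a ?x ^ ?q * b ?y ^ ?q - a ?y ^ ?q * b ?x ^ ?q"
      unfolding xq[OF mem(1)] xq[OF mem(2)] by (simp add: algebra_simps)
    then have "\<phi> (a ?x ^ ?q * ?y ^ (t * ?q) - a ?y ^ ?q * ?x ^ (t * ?q)) = 0"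
      using \<phi>ab mem by (simp add: \<phi>_diff \<phi>_mult)
    then obtain s where "?x ^ s * (a ?x ^ ?q * ?y ^ (t * ?q) - a ?y ^ ?q * ?x ^ (t * ?q)) = 0"
      using kernel mem by blast
    then show "\<exists>s. (?x * ?y) ^ s * (a ?x ^ ?q * ?y ^ (t * ?q) - a ?y ^ ?q * ?x ^ (t * ?q)) = 0"
      by (intro exI[of _ s]) (simp only: power_mult_distrib mult.commute[of "?x ^ s"] mult.assoc mult_zero_right)
  qed
  from glue[OF this] obtain e s where eS: "e \<in> S" and
    e: "\<And>i. i < length xs \<Longrightarrow> \<phi> (xs ! i) ^ s * (\<phi> (xs ! i) ^ (t * ?q) * e - \<phi> (a (xs ! i) ^ ?q)) = 0"
    by blast
  \<comment> \<open>Covers the denominator t q together with the additional power s allowed by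
    \<open>glue\<close>.\<close>
  define M where "M = s + t * ?q"
  have xe: "\<phi> x ^ M * e = \<phi> x ^ s * \<phi> (a x ^ ?q)" if x: "x \<in> set xs" for x
  proof -
    obtain i where "i < length xs" "x = xs ! i" using x by (metis in_set_conv_nth)
    then show ?thesis using e[of i] by (simp add: M_def power_add right_diff_distrib mult.assoc)
  qed
  have xf: "\<phi> x ^ M * (\<phi> 1 - e) = \<phi> x ^ s * \<phi> (b x ^ ?q)" if x: "x \<in> set xs" for x
  proof -
    have "\<phi> x ^ M * \<phi> 1 = \<phi> x ^ s * (\<phi> x ^ (t * ?q) * \<phi> 1)" by (simp add: M_def power_add mult.assoc)
    also have "\<phi> x ^ (t * ?q) * \<phi> 1 = \<phi> (a x ^ ?q) + \<phi> (b x ^ ?q)"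
      unfolding \<phi>_power_mult[OF S_\<phi>, symmetric] \<phi>_mult[symmetric] \<phi>_add[symmetric] xq[OF x] by simp
    finally show ?thesis using xe[OF x] by (simp add: algebra_simps)
  qed
  have fS: "\<phi> 1 - e \<in> S" by (intro S_diff S_\<phi> eS)
  have ef: "e * (\<phi> 1 - e) = 0"
  proof (rule separated[OF S_mult[OF eS fS], of "M + M"])
    fix x assume x: "x \<in> set xs"
    have "\<phi> x ^ (M + M) * (e * (\<phi> 1 - e)) = (\<phi> x ^ M * e) * (\<phi> x ^ M * (\<phi> 1 - e))"
      by (simp only: power_add ac_simps)
    also have "\<dots> = \<phi> x ^ s * \<phi> x ^ s * (\<phi> (a x ^ ?q) * \<phi> (b x ^ ?q))"
      unfolding xe[OF x] xf[OF x] by (simp only: ac_simps)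
    finally show "\<phi> x ^ (M + M) * (e * (\<phi> 1 - e)) = 0" using \<phi>ab[OF x x] by simp
  qed
  have e_one: "e * \<phi> 1 = e" using S_one[OF eS] by (simp add: mult.commute)
  have ei: "e \<in> idem" using ef eS e_one by (simp add: idem_def right_diff_distrib)
  have fi: "\<phi> 1 - e \<in> idem" by (rule idem_diff[OF idem_one ei e_one])
  have bf: "\<phi> (a x ^ ?q) * e = \<phi> (a x ^ ?q)" "\<phi> (b x ^ ?q) * (\<phi> 1 - e) = \<phi> (b x ^ ?q)" if x: "x \<in> set xs" for x
  proof -
    have "\<phi> (a x ^ ?q) * (\<phi> 1 - e) = 0"
    proof (rule separated[OF S_scale[OF fS], of M])
      fix y assume y: "y \<in> set xs"
      have "\<phi> y ^ M * (\<phi> (a x ^ ?q) * (\<phi> 1 - e)) = \<phi> (a x ^ ?q) * (\<phi> y ^ M * (\<phi> 1 - e))" by (simp only: ac_simps)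
      also have "\<dots> = \<phi> y ^ s * (\<phi> (a x ^ ?q) * \<phi> (b y ^ ?q))" unfolding xf[OF y] by (simp only: ac_simps)
      finally show "\<phi> y ^ M * (\<phi> (a x ^ ?q) * (\<phi> 1 - e)) = 0" using \<phi>ab[OF x y] by simp
    qed
    then show "\<phi> (a x ^ ?q) * e = \<phi> (a x ^ ?q)" by (simp add: right_diff_distrib \<phi>_mult[symmetric])
    have "\<phi> (b x ^ ?q) * e = 0"
    proof (rule separated[OF S_scale[OF eS], of M])
      fix y assume y: "y \<in> set xs"
      have "\<phi> y ^ M * (\<phi> (b x ^ ?q) * e) = \<phi> (b x ^ ?q) * (\<phi> y ^ M * e)" by (simp only: ac_simps)
      also have "\<dots> = \<phi> y ^ s * (\<phi> (a y ^ ?q) * \<phi> (b x ^ ?q))" unfolding xe[OF y] by (simp only: ac_simps)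
      finally show "\<phi> y ^ M * (\<phi> (b x ^ ?q) * e) = 0" using \<phi>ab[OF y x] by simp
    qed
    then show "\<phi> (b x ^ ?q) * (\<phi> 1 - e) = \<phi> (b x ^ ?q)" by (simp add: right_diff_distrib \<phi>_mult[symmetric])
  qed
  have side: "(P \<in> U \<longrightarrow> P \<in> support e) \<and> (P \<in> V \<longrightarrow> P \<in> support (\<phi> 1 - e))" if P: "P \<in> punctured_spec m" for P
  proof -
    have Pp: "prime_ideal P" by (rule punctured_prime[OF P])
    obtain x where x: "x \<in> set xs" "x \<notin> P" using punctured_gen[OF P] by blast
    have "x ^ t \<notin> P" using x(2) by (simp add: prime_ideal_power_iff[OF Pp])
    then have ne: "a x \<notin> P \<or> b x \<notin> P" using ab[OF x(1)] ideal_add[OF prime_ideal_is_ideal[OF Pp]] by metis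
    have "P \<in> support e" if "P \<in> U"
    proof -
      have "b x \<in> P" using that ab[OF x(1)] unfolding I_def by blast
      then have "a x ^ ?q \<notin> P" using ne by (simp add: prime_ideal_power_iff[OF Pp])
      then show ?thesis unfolding support_def using P bf(1)[OF x(1)] by blast
    qed
    moreover have "P \<in> support (\<phi> 1 - e)" if "P \<in> V"
    proof -
      have "a x \<in> P" using that ab[OF x(1)] unfolding I_def by blast
      then have "b x ^ ?q \<notin> P" using ne by (simp add: prime_ideal_power_iff[OF Pp])
      then show ?thesis unfolding support_def using P bf(2)[OF x(1)] by blast
    qed
    ultimately show ?thesis by blast
  qed
  have "support e \<inter> support (\<phi> 1 - e) = {}" by (rule support_disjoint[OF ef])
  moreover have "support e \<subseteq> punctured_spec m" by (auto simp: support_def)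
  ultimately have "support e = U" using side UV by blast
  then show ?thesis using ei by blast
qed

text \<open>A separation of the support extends to a clopen splitting of the whole space by adding
  the support of \<phi> 1 - e to one side. The resulting idempotent g has g * e equal to 0 or e, so
  one piece of the separation is empty.\<close>

lemma connectedin_support_primitive:
  assumes e: "e \<in> primitive" shows "connectedin (zariski_punctured m) (support e)"
proof (rule ccontr)
  let ?X = "zariski_punctured m"
  have ei: "e \<in> idem" using e by (simp add: primitive_def)
  have eX: "support e \<subseteq> punctured_spec m" by (auto simp: support_def)
  assume "\<not> connectedin ?X (support e)"
  then obtain E1 E2 where E: "openin ?X E1" "openin ?X E2" "support e \<subseteq> E1 \<union> E2"
    "E1 \<inter> E2 \<inter> support e = {}" "E1 \<inter> support e \<noteq> {}" "E2 \<inter> support e \<noteq> {}"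
    using eX unfolding connectedin topspace_zariski_punctured by blast
  define U where "U = E1 \<inter> support e"
  define f where "f = \<phi> 1 - e"
  have f: "f \<in> idem" "e * f = 0"
    using idem_diff[OF idem_one ei idem_one_mult[OF ei]] ei idem_one_mult[OF ei]
    by (simp_all add: f_def idem_def right_diff_distrib)
  have "support e \<union> support f = support (\<phi> 1)"
    using support_add[OF ei f] by (simp add: f_def)
  then have cover: "support e \<union> support f = punctured_spec m" by (simp only: support_one)
  have disj: "support e \<inter> support f = {}" by (rule support_disjoint[OF f(2)])
  have "\<exists>g\<in>idem. support g = U"
  proof (rule clopen_idem)
    show "openin ?X U" unfolding U_def by (intro openin_Int E(1) openin_support)
    show "openin ?X (E2 \<inter> support e \<union> support f)" by (intro openin_Int openin_Un E(2) openin_support)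
    show "U \<inter> (E2 \<inter> support e \<union> support f) = {}" unfolding U_def using E disj by blast
    show "U \<union> (E2 \<inter> support e \<union> support f) = punctured_spec m" unfolding U_def using E cover by blast
  qed
  then obtain g where g: "g \<in> idem" "support g = U" by blast
  have "support (g * e) = U" using support_mult[OF g(1) ei] g(2) unfolding U_def by blast
  moreover have "g * e = 0 \<or> g * e = e" using e g(1) by (simp add: primitive_def)
  ultimately have "U = {} \<or> U = support e" using support_zero by auto
  then show False using E unfolding U_def by blast
qed

lemma support_sum:
  assumes "finite P" "P \<subseteq> primitive" shows "\<Sum>P \<in> idem \<and> support (\<Sum>P) = (\<Union>e\<in>P. support e)"
  using assms
proof (induction P)
  case empty
  show ?case by (simp add: support_zero idem_zero)
next
  case (insert e P)
  have e: "e \<in> primitive" "e \<in> idem" using insert.prems by (auto simp: primitive_def)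
  have P: "\<Sum>P \<in> idem" "support (\<Sum>P) = (\<Union>e\<in>P. support e)" using insert by auto
  have orth: "e * \<Sum>P = 0" using primitive_sum_mult[of P e] insert by simp
  have "(e + s) * (e + s) = e * e + (e * s + e * s) + s * s" for s by (simp add: algebra_simps)
  also have "e * e + (e * \<Sum>P + e * \<Sum>P) + \<Sum>P * \<Sum>P = e + \<Sum>P"
    using e(2) P(1) unfolding orth by (simp add: idem_def)
  finally have "e + \<Sum>P \<in> idem"
    using e(2) P(1) S_add by (simp add: idem_def)
  then show ?case using support_add[OF e(2) P(1) orth] P(2) insert.hyps by simp
qed

theorem card_components: "card (connected_components_of (zariski_punctured m)) = card primitive"
proof -
  have disj: "support e \<inter> support f = {}" if "e \<in> primitive" "f \<in> primitive" "e \<noteq> f" for e f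
    by (rule support_disjoint[OF primitive_mult[OF that]])
  have ne: "support e \<noteq> {}" if "e \<in> primitive" for e
    using support_nonempty that by (simp add: primitive_def)
  have "connected_components_of (zariski_punctured m) = support ` primitive"
  proof (rule connected_components_of_open_partition)
    show "openin (zariski_punctured m) U" if "U \<in> support ` primitive" for U
      using that openin_support by auto
    show "connectedin (zariski_punctured m) U" if "U \<in> support ` primitive" for U
      using that connectedin_support_primitive by auto
    show "{} \<notin> support ` primitive" using ne by auto
    show "U \<inter> V = {}" if UV: "U \<in> support ` primitive" "V \<in> support ` primitive" "U \<noteq> V" for U V
    proof -
      obtain e f where "e \<in> primitive" "f \<in> primitive" "U = support e" "V = support f" using UV(1,2) by blast
      then show ?thesis using disj[of e f] UV(3) by blast
    qed
    show "\<Union>(support ` primitive) = topspace (zariski_punctured m)"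
      using support_sum[OF finite_primitive order.refl] sum_primitive support_one topspace_zariski_punctured[of m] by simp
  qed
  moreover have "inj_on support primitive"
    using disj ne by (intro inj_onI) (metis Int_absorb)
  ultimately show ?thesis by (simp add: card_image)
qed

end

section \<open>Cech cocycles as sections\<close>

context punctured_sections
begin

text \<open>The section s restricts to r i / x_i^N on D(x_i); the power t allows for torsion at
  x_i.\<close>

definition represents :: "'b \<Rightarrow> (nat \<Rightarrow> 'a) \<times> nat \<Rightarrow> bool" where
  "represents s c \<longleftrightarrow> (case c of (r, N) \<Rightarrow>
     (\<exists>t. \<forall>i<length xs. \<phi> (xs ! i) ^ t * (\<phi> (xs ! i) ^ N * s - \<phi> (r i)) = 0))"

lemma section_of_cocycle: "cech_cocycle xs c \<Longrightarrow> \<exists>s\<in>S. represents s c"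
  using glue[of "fst c" "snd c"] by (simp add: represents_def case_prod_unfold)

lemma \<phi>_mult_power: "\<phi> (a * x ^ n) = \<phi> x ^ n * \<phi> a"
  using \<phi>_power_mult[OF S_\<phi>, of x n a] by (simp add: \<phi>_mult mult.commute)

lemma cocycle_of_section:
  assumes s: "s \<in> S" shows "\<exists>c. cech_cocycle xs c \<and> represents s c"
proof -
  obtain N where "\<forall>x\<in>set xs. \<phi> x ^ N * s \<in> range \<phi>" using denominators[OF s] by blast
  then have "\<forall>i<length xs. \<exists>r. \<phi> (xs ! i) ^ N * s = \<phi> r" by (meson imageE nth_mem)
  then obtain r where r: "\<And>i. i < length xs \<Longrightarrow> \<phi> (xs ! i) ^ N * s = \<phi> (r i)" by metis
  have "cech_cocycle xs (r, N)"
    unfolding cech_cocycle_def prod.case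
  proof (intro allI impI)
    fix i j assume ij: "i < length xs" "j < length xs"
    let ?x = "xs ! i" and ?y = "xs ! j"
    have "\<phi> (r i * ?y ^ N - r j * ?x ^ N) = 0"
      unfolding \<phi>_diff \<phi>_mult_power r[OF ij(1), symmetric] r[OF ij(2), symmetric]
      by (simp add: mult.left_commute)
    then obtain t where "\<forall>x\<in>set xs. x ^ t * (r i * ?y ^ N - r j * ?x ^ N) = 0" using kernel by blast
    then have "?y ^ t * (?x ^ t * (r i * ?y ^ N - r j * ?x ^ N)) = 0" using ij by simp
    then show "\<exists>t. (?x * ?y) ^ t * (r i * ?y ^ N - r j * ?x ^ N) = 0"
      by (intro exI[of _ t]) (simp only: power_mult_distrib ac_simps)
  qed
  moreover have "represents s (r, N)" unfolding represents_def using r by simp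
  ultimately show ?thesis by blast
qed

lemma cech_equiv_iff:
  assumes s: "s \<in> S" "represents s c" and s': "s' \<in> S" "represents s' d"
  shows "cech_equiv xs c d \<longleftrightarrow> s - s' \<in> range \<phi>"
proof -
  obtain r N q M where c: "c = (r, N)" and d: "d = (q, M)" by fastforce
  obtain t1 t2 where
    t1: "\<And>i. i < length xs \<Longrightarrow> \<phi> (xs ! i) ^ t1 * (\<phi> (xs ! i) ^ N * s - \<phi> (r i)) = 0" and
    t2: "\<And>i. i < length xs \<Longrightarrow> \<phi> (xs ! i) ^ t2 * (\<phi> (xs ! i) ^ M * s' - \<phi> (q i)) = 0"
    using s(2) s'(2) unfolding represents_def c d by auto
  \<comment> \<open>The quantity tested in \<open>cech_equiv\<close>. Up to powers of x_i its image
    is s - s' - \<phi> a, so by separation it is x_i-torsion for every i exactly when that section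
    vanishes.\<close>
  define B where "B a i = r i * (xs ! i) ^ M - q i * (xs ! i) ^ N - a * (xs ! i) ^ (N + M)" for a i
  let ?T = "t1 + t2"
  have key: "\<phi> (xs ! i) ^ ?T * \<phi> (B a i) = \<phi> (xs ! i) ^ (?T + N + M) * (s - s' - \<phi> a)"
    if i: "i < length xs" for a i
  proof -
    let ?x = "\<phi> (xs ! i)"
    have "?x ^ (?T + N + M) * (s - s' - \<phi> a) - ?x ^ ?T * \<phi> (B a i) =
        ?x ^ t2 * ?x ^ M * (?x ^ t1 * (?x ^ N * s - \<phi> (r i))) -
        ?x ^ t1 * ?x ^ N * (?x ^ t2 * (?x ^ M * s' - \<phi> (q i)))"
      unfolding B_def \<phi>_diff \<phi>_mult_power by (simp add: power_add algebra_simps)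
    then show ?thesis using t1[OF i] t2[OF i] by simp
  qed
  have eq: "(\<forall>i<length xs. \<exists>t. (xs ! i) ^ t * B a i = 0) \<longleftrightarrow> s - s' = \<phi> a" for a
  proof
    assume "\<forall>i<length xs. \<exists>t. (xs ! i) ^ t * B a i = 0"
    then obtain t where t: "\<And>i. i < length xs \<Longrightarrow> (xs ! i) ^ t i * B a i = 0" by metis
    define u where "u = Max (insert 0 (t ` {..<length xs}))"
    have "s - s' - \<phi> a = 0"
    proof (rule separated[of _ "u + (?T + N + M)"])
      show "s - s' - \<phi> a \<in> S" by (intro S_diff s(1) s'(1) S_\<phi>)
      fix x assume "x \<in> set xs"
      then obtain i where i: "i < length xs" "x = xs ! i" by (metis in_set_conv_nth)
      have "t i \<le> u" unfolding u_def using i(1) by (intro Max_ge) auto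
      then have "x ^ u * B a i = x ^ (u - t i) * (x ^ t i * B a i)"
        by (simp add: mult.assoc[symmetric] power_add[symmetric])
      then have "x ^ u * B a i = 0" using t[OF i(1)] i(2) by simp
      then have "\<phi> x ^ u * \<phi> (B a i) = 0"
        using \<phi>_mult_power[of "B a i" x u] \<phi>_zero by (simp add: mult.commute)
      then have "\<phi> x ^ u * (\<phi> x ^ ?T * \<phi> (B a i)) = 0" by (metis mult.left_commute mult_zero_right)
      then show "\<phi> x ^ (u + (?T + N + M)) * (s - s' - \<phi> a) = 0"
        using key[OF i(1), of a] i(2) by (simp add: power_add[of _ u] mult.assoc)
    qed
    then show "s - s' = \<phi> a" by simp
  next
    assume "s - s' = \<phi> a"
    show "\<forall>i<length xs. \<exists>t. (xs ! i) ^ t * B a i = 0"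
    proof (intro allI impI)
      fix i assume i: "i < length xs"
      have "\<phi> (xs ! i) ^ ?T * \<phi> (B a i) = 0" using key[OF i, of a] \<open>s - s' = \<phi> a\<close> by simp
      then have "\<phi> (B a i * (xs ! i) ^ ?T) = 0" by (simp only: \<phi>_mult_power)
      then obtain t where "(xs ! i) ^ t * (B a i * (xs ! i) ^ ?T) = 0" using kernel i nth_mem by blast
      then have "(xs ! i) ^ (t + ?T) * B a i = 0" by (simp only: power_add ac_simps)
      then show "\<exists>t. (xs ! i) ^ t * B a i = 0" by blast
    qed
  qed
  have "cech_equiv xs c d \<longleftrightarrow> (\<exists>a. \<forall>i<length xs. \<exists>t. (xs ! i) ^ t * B a i = 0)"
    by (simp add: cech_equiv_def c d B_def)
  then show ?thesis unfolding eq by blast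
qed

lemma represents_frob: "represents s c \<Longrightarrow> represents (s ^ p ^ e) (cech_frob p e c)"
proof -
  assume "represents s c"
  obtain r N where c: "c = (r, N)" by fastforce
  from \<open>represents s c\<close> obtain t where
    t: "\<And>i. i < length xs \<Longrightarrow> \<phi> (xs ! i) ^ t * (\<phi> (xs ! i) ^ N * s - \<phi> (r i)) = 0"
    unfolding represents_def c by auto
  have "\<phi> (xs ! i) ^ (t * p ^ e) * (\<phi> (xs ! i) ^ (p ^ e * N) * s ^ p ^ e - \<phi> (r i ^ p ^ e)) = 0"
    if i: "i < length xs" for i
  proof -
    have "(\<phi> (xs ! i) ^ t * (\<phi> (xs ! i) ^ N * s - \<phi> (r i))) ^ p ^ e = 0"
      using t[OF i] p_pos[of e] by (simp add: power_0_left)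
    then show ?thesis
      by (simp only: power_mult_distrib frob_diff \<phi>_power[OF p_pos] power_mult[symmetric] mult.commute[of N])
  qed
  then show ?thesis unfolding represents_def cech_frob_def c by auto
qed

lemma represents_zero: "represents 0 cech_zero"
  by (simp add: represents_def cech_zero_def \<phi>_zero)

lemma represents_smult: "represents s c \<Longrightarrow> represents (\<phi> k * s) (cech_smult k c)"
proof -
  assume "represents s c"
  obtain r N where c: "c = (r, N)" by fastforce
  from \<open>represents s c\<close> obtain t where
    t: "\<And>i. i < length xs \<Longrightarrow> \<phi> (xs ! i) ^ t * (\<phi> (xs ! i) ^ N * s - \<phi> (r i)) = 0"
    unfolding represents_def c by auto
  have "\<phi> (xs ! i) ^ t * (\<phi> (xs ! i) ^ N * (\<phi> k * s) - \<phi> (k * r i)) = 0" if i: "i < length xs" for i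
  proof -
    have "\<phi> (xs ! i) ^ t * (\<phi> (xs ! i) ^ N * (\<phi> k * s) - \<phi> (k * r i)) =
      \<phi> k * (\<phi> (xs ! i) ^ t * (\<phi> (xs ! i) ^ N * s - \<phi> (r i)))"
      by (simp add: \<phi>_mult algebra_simps)
    then show ?thesis using t[OF i] by simp
  qed
  then show ?thesis unfolding represents_def cech_smult_def c by auto
qed

lemma represents_add:
  assumes "represents s c" "represents s' d"
  shows "represents (s + s') (cech_add xs c d)"
proof -
  obtain r N q M where c: "c = (r, N)" and d: "d = (q, M)" by fastforce
  obtain t1 t2 where
    t1: "\<And>i. i < length xs \<Longrightarrow> \<phi> (xs ! i) ^ t1 * (\<phi> (xs ! i) ^ N * s - \<phi> (r i)) = 0" and
    t2: "\<And>i. i < length xs \<Longrightarrow> \<phi> (xs ! i) ^ t2 * (\<phi> (xs ! i) ^ M * s' - \<phi> (q i)) = 0"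
    using assms unfolding represents_def c d by auto
  have "\<phi> (xs ! i) ^ (t1 + t2) * (\<phi> (xs ! i) ^ (N + M) * (s + s') -
      \<phi> (r i * (xs ! i) ^ M + q i * (xs ! i) ^ N)) = 0" if i: "i < length xs" for i
  proof -
    let ?x = "\<phi> (xs ! i)"
    have "?x ^ (t1 + t2) * (?x ^ (N + M) * (s + s') - \<phi> (r i * (xs ! i) ^ M + q i * (xs ! i) ^ N)) =
        ?x ^ t2 * ?x ^ M * (?x ^ t1 * (?x ^ N * s - \<phi> (r i))) +
        ?x ^ t1 * ?x ^ N * (?x ^ t2 * (?x ^ M * s' - \<phi> (q i)))"
      unfolding \<phi>_add \<phi>_mult_power by (simp add: power_add algebra_simps)
    then show ?thesis using t1[OF i] t2[OF i] by simp
  qed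
  then show ?thesis unfolding represents_def cech_add_def c d by auto
qed

lemma represents_lincomb:
  "length ks = length es \<Longrightarrow> (\<And>e. e \<in> set es \<Longrightarrow> represents e (c e)) \<Longrightarrow>
    represents (sum_list (map2 (\<lambda>k e. \<phi> k * e) ks es)) (cech_lincomb xs ks (map c es))"
  by (induction ks es rule: list_induct2)
    (auto simp: represents_zero intro!: represents_add represents_smult)

lemma frob_stable_part_iff:
  assumes c: "cech_cocycle xs c" and s: "s \<in> S" "represents s c"
  shows "c \<in> frob_stable_part xs p \<longleftrightarrow> s \<in> stable"
proof
  assume c_stable: "c \<in> frob_stable_part xs p"
  have "\<exists>t\<in>S. s - t ^ p ^ e \<in> range \<phi>" for e
  proof -
    obtain c' where c': "cech_cocycle xs c'" "cech_equiv xs (cech_frob p e c') c"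
      using c_stable unfolding frob_stable_part_def by blast
    obtain t where t: "t \<in> S" "represents t c'" using section_of_cocycle[OF c'(1)] by blast
    have "t ^ p ^ e - s \<in> range \<phi>"
      using cech_equiv_iff[OF S_pow[OF t(1) p_pos] represents_frob[OF t(2)] s] c'(2) by blast
    then have "0 - (t ^ p ^ e - s) \<in> range \<phi>" by (rule range_diff[OF range_zero])
    then show ?thesis using t(1) by (intro bexI[of _ t]) simp_all
  qed
  then show "s \<in> stable" using s(1) by (simp add: stable_def)
next
  assume s_stable: "s \<in> stable"
  have "\<exists>c'. cech_cocycle xs c' \<and> cech_equiv xs (cech_frob p e c') c" for e
  proof -
    obtain t where t: "t \<in> S" "s - t ^ p ^ e \<in> range \<phi>" using s_stable unfolding stable_def by blast
    obtain c' where c': "cech_cocycle xs c'" "represents t c'" using cocycle_of_section[OF t(1)] by blast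
    have "0 - (s - t ^ p ^ e) \<in> range \<phi>" by (rule range_diff[OF range_zero t(2)])
    then have "t ^ p ^ e - s \<in> range \<phi>" by simp
    then show ?thesis
      using cech_equiv_iff[OF S_pow[OF t(1) p_pos] represents_frob[OF c'(2)] s] c'(1) by blast
  qed
  then show "c \<in> frob_stable_part xs p" using c unfolding frob_stable_part_def by blast
qed

lemma map_surj_on_distinct:
  "length ks = length es \<Longrightarrow> distinct es \<Longrightarrow> \<exists>k. map k es = ks"
proof (induction ks es rule: list_induct2)
  case (Cons k ks e es)
  then obtain f where "map f es = ks" by auto
  then have "map (f(e := k)) (e # es) = k # ks" using Cons.prems by simp
  then show ?case by (rule exI[of _ "f(e := k)"])
qed simp

lemma sum_list_map2_map:
  "sum_list (map2 (\<lambda>k e. \<phi> k * e) (map k es) es) = sum_list (map (\<lambda>e. \<phi> (k e) * e) es)"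
  by (induction es) auto

theorem cech_dim_components:
  "\<exists>n. cech_dim_eq xs K (frob_stable_part xs p) n \<and>
    card (connected_components_of (zariski_punctured m)) = 1 + n"
proof -
  obtain e0 where e0: "e0 \<in> primitive" using primitive_nonempty by blast
  have fin: "finite (primitive - {e0})" using finite_primitive by simp
  then obtain es where es: "set es = primitive - {e0}" "distinct es"
    using finite_distinct_list by blast
  define n where "n = length es"
  have prS: "e \<in> S" if "e \<in> primitive" for e using that by (simp add: primitive_def idem_def)
  have "card primitive = 1 + n"
    using distinct_card[OF es(2)] card.remove[OF finite_primitive e0] by (simp add: n_def es(1))
  then have card: "card (connected_components_of (zariski_punctured m)) = 1 + n"
    by (simp only: card_components)
  have "\<forall>e\<in>primitive. \<exists>c. cech_cocycle xs c \<and> represents e c" using cocycle_of_section prS by blast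
  then obtain c where c: "\<And>e. e \<in> primitive \<Longrightarrow> cech_cocycle xs (c e) \<and> represents e (c e)" by metis
  have split: "(\<Sum>e\<in>primitive. \<phi> (k e) * e) = \<phi> (k e0) * e0 + sum_list (map (\<lambda>e. \<phi> (k e) * e) es)" for k
    using finite_primitive e0 es by (simp add: sum_list_distinct_conv_sum_set sum.remove)
  have rep: "represents (sum_list (map (\<lambda>e. \<phi> (k e) * e) es)) (cech_lincomb xs (map k es) (map c es))" for k
    using represents_lincomb[of "map k es" es c] c es(1) by (simp only: sum_list_map2_map length_map) auto
  have comb_S: "sum_list (map (\<lambda>e. \<phi> (k e) * e) es) \<in> S" for k
    using es prS S_scale by (auto simp: sum_list_distinct_conv_sum_set intro!: submod_sum[OF S_submod])
  have "cech_dim_eq xs K (frob_stable_part xs p) n"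
    unfolding cech_dim_eq_def
  proof (intro exI[of _ "map c es"] conjI allI impI ballI)
    show "length (map c es) = n" by (simp add: n_def)
    show "set (map c es) \<subseteq> frob_stable_part xs p"
    proof
      fix d assume "d \<in> set (map c es)"
      then obtain e where e: "e \<in> primitive" "d = c e" using es(1) by auto
      then show "d \<in> frob_stable_part xs p"
        using frob_stable_part_iff[of d e] c[OF e(1)] prS primitive_stable by auto
    qed
  next
    fix ks l
    assume ks: "length ks = n \<and> set ks \<subseteq> K \<and> cech_equiv xs (cech_lincomb xs ks (map c es)) cech_zero"
      and l: "l \<in> set ks"
    obtain k' where k': "map k' es = ks" using map_surj_on_distinct[of ks es] ks es(2) n_def by auto
    \<comment> \<open>Coefficient 0 at the omitted e0 turns this into a relation over all
      primitives; there all coefficients agree, so all are 0.\<close>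
    define k where "k = k'(e0 := 0)"
    have k: "map k es = ks" using k' es(1) by (auto simp: k_def)
    have "sum_list (map (\<lambda>e. \<phi> (k e) * e) es) - 0 \<in> range \<phi>"
      using cech_equiv_iff[OF comb_S rep submod_zero[OF S_submod] represents_zero, of k] ks unfolding k by blast
    then have "(\<Sum>e\<in>primitive. \<phi> (k e) * e) \<in> range \<phi>" by (simp add: split k_def \<phi>_zero)
    moreover have "k e \<in> K" if "e \<in> primitive" for e
    proof (cases "e = e0")
      case True
      then show ?thesis using K_zero by (simp add: k_def)
    next
      case False
      then have "k e \<in> set ks" using that es(1) unfolding k[symmetric] by auto
      then show ?thesis using ks by blast
    qed
    ultimately obtain k0 where k0: "\<forall>e\<in>primitive. k e = k0" using primitive_independent[of k] by blast
    then have "k0 = 0" using e0 by (auto simp: k_def)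
    then show "l = 0" using l k0 es(1) unfolding k[symmetric] by auto
  next
    fix d assume d: "d \<in> frob_stable_part xs p"
    then have dc: "cech_cocycle xs d" by (simp add: frob_stable_part_def)
    obtain s where s: "s \<in> S" "represents s d" using section_of_cocycle[OF dc] by blast
    then have "s \<in> stable" using frob_stable_part_iff[OF dc] d by blast
    then obtain k where k: "\<And>e. k e \<in> K" "s - (\<Sum>e\<in>primitive. \<phi> (k e) * e) \<in> range \<phi>"
      using stable_spanned by blast
    \<comment> \<open>Subtracting k e0 times \<phi> 1, an element of R', clears the coefficient at
      e0.\<close>
    define l where "l e = k e - k e0" for e
    have "(\<Sum>e\<in>primitive. \<phi> (l e) * e) = (\<Sum>e\<in>primitive. \<phi> (k e) * e) - \<phi> (k e0) * \<phi> 1"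
      unfolding sum_primitive[symmetric] sum_distrib_left
      by (simp add: l_def \<phi>_diff left_diff_distrib sum_subtractf)
    moreover have "sum_list (map (\<lambda>e. \<phi> (l e) * e) es) = (\<Sum>e\<in>primitive. \<phi> (l e) * e)"
      unfolding split[of l] by (simp add: l_def \<phi>_zero)
    ultimately have "sum_list (map (\<lambda>e. \<phi> (l e) * e) es) = (\<Sum>e\<in>primitive. \<phi> (k e) * e) - \<phi> (k e0)"
      by (simp only: \<phi>_mult[symmetric] mult_1_right)
    then have "s - sum_list (map (\<lambda>e. \<phi> (l e) * e) es) = (s - (\<Sum>e\<in>primitive. \<phi> (k e) * e)) + \<phi> (k e0)"
      by (simp only: diff_diff_eq2 add_diff_eq diff_add_eq)
    then have "s - sum_list (map (\<lambda>e. \<phi> (l e) * e) es) \<in> range \<phi>"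
      using range_add[OF k(2) rangeI[of \<phi> "k e0"]] by (simp only:)
    then have "cech_equiv xs d (cech_lincomb xs (map l es) (map c es))"
      using cech_equiv_iff[OF s comb_S rep] by blast
    moreover have "set (map l es) \<subseteq> K" using k(1) K_diff by (auto simp: l_def)
    ultimately show "\<exists>ks. length ks = n \<and> set ks \<subseteq> K \<and> cech_equiv xs d (cech_lincomb xs ks (map c es))"
      by (intro exI[of _ "map l es"]) (simp add: n_def)
  qed
  then show ?thesis using card by blast
qed

end

section \<open>Products of localizations\<close>

text \<open>An element of \<open>'a loc\<close> is a family \<open>(f x)\<^sub>x\<close> with \<open>f x = (r, N)\<close> standing for \<open>r / x\<^sup>N\<close> in the
  localization at \<open>x\<close>. Taking all \<open>x\<close> at once makes the type independent of the chosen generators of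
  the maximal ideal.\<close>

definition loc_rel :: "'a::comm_ring_1 \<Rightarrow> 'a \<times> nat \<Rightarrow> 'a \<times> nat \<Rightarrow> bool" where
  "loc_rel x c d \<longleftrightarrow> (\<exists>t. x ^ t * (fst c * x ^ snd d - fst d * x ^ snd c) = 0)"

lemma loc_rel_refl: "loc_rel x c c"
  by (simp add: loc_rel_def)

lemma loc_rel_sym: assumes "loc_rel x c d" shows "loc_rel x d c"
proof -
  obtain t where "x ^ t * (fst c * x ^ snd d - fst d * x ^ snd c) = 0" using assms by (auto simp: loc_rel_def)
  then have "x ^ t * (fst d * x ^ snd c - fst c * x ^ snd d) = 0" by (simp add: right_diff_distrib)
  then show ?thesis by (auto simp: loc_rel_def)
qed

lemma loc_rel_trans:
  assumes "loc_rel x c d" "loc_rel x d e" shows "loc_rel x c e"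
proof -
  obtain s t where s: "x ^ s * (fst c * x ^ snd d - fst d * x ^ snd c) = 0"
    and t: "x ^ t * (fst d * x ^ snd e - fst e * x ^ snd d) = 0"
    using assms by (auto simp: loc_rel_def)
  have "x ^ (s + t + snd d) * (fst c * x ^ snd e - fst e * x ^ snd c) =
      x ^ t * x ^ snd e * (x ^ s * (fst c * x ^ snd d - fst d * x ^ snd c)) +
      x ^ s * x ^ snd c * (x ^ t * (fst d * x ^ snd e - fst e * x ^ snd d))"
    by (simp add: power_add algebra_simps)
  then have "x ^ (s + t + snd d) * (fst c * x ^ snd e - fst e * x ^ snd c) = 0" using s t by simp
  then show ?thesis by (auto simp: loc_rel_def)
qed

quotient_type (overloaded) 'a loc = "'a::comm_ring_1 \<Rightarrow> 'a \<times> nat" / "\<lambda>f g. \<forall>x. loc_rel x (f x) (g x)"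
  by (intro equivpI reflpI sympI transpI) (blast intro: loc_rel_refl loc_rel_sym loc_rel_trans)+

lemma loc_rel_eq: "fst c * x ^ snd d = fst d * x ^ snd c \<Longrightarrow> loc_rel x c d"
  by (auto simp: loc_rel_def intro: exI[of _ 0])

lemma loc_rel_add:
  assumes "loc_rel x (r, N) (r', N')" "loc_rel x (q, M) (q', M')"
  shows "loc_rel x (r * x ^ M + q * x ^ N, N + M) (r' * x ^ M' + q' * x ^ N', N' + M')"
proof -
  obtain s t where s: "x ^ s * (r * x ^ N' - r' * x ^ N) = 0" and t: "x ^ t * (q * x ^ M' - q' * x ^ M) = 0"
    using assms by (auto simp: loc_rel_def)
  have "x ^ (s + t) * ((r * x ^ M + q * x ^ N) * x ^ (N' + M') - (r' * x ^ M' + q' * x ^ N') * x ^ (N + M)) =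
      x ^ t * x ^ M * x ^ M' * (x ^ s * (r * x ^ N' - r' * x ^ N)) +
      x ^ s * x ^ N * x ^ N' * (x ^ t * (q * x ^ M' - q' * x ^ M))"
    by (simp add: power_add algebra_simps)
  also have "\<dots> = 0" using s t by simp
  finally show ?thesis by (auto simp: loc_rel_def)
qed

lemma loc_rel_mult:
  assumes "loc_rel x (r, N) (r', N')" "loc_rel x (q, M) (q', M')"
  shows "loc_rel x (r * q, N + M) (r' * q', N' + M')"
proof -
  obtain s t where s: "x ^ s * (r * x ^ N' - r' * x ^ N) = 0" and t: "x ^ t * (q * x ^ M' - q' * x ^ M) = 0"
    using assms by (auto simp: loc_rel_def)
  have "x ^ (s + t) * ((r * q) * x ^ (N' + M') - (r' * q') * x ^ (N + M)) =
      x ^ t * q * x ^ M' * (x ^ s * (r * x ^ N' - r' * x ^ N)) +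
      x ^ s * r' * x ^ N * (x ^ t * (q * x ^ M' - q' * x ^ M))"
    by (simp add: power_add algebra_simps)
  also have "\<dots> = 0" using s t by simp
  finally show ?thesis by (auto simp: loc_rel_def)
qed

lemma loc_rel_uminus:
  assumes "loc_rel x (r, N) (r', N')"
  shows "loc_rel x (- r, N) (- r', N')"
proof -
  obtain s where s: "x ^ s * (r * x ^ N' - r' * x ^ N) = 0" using assms by (auto simp: loc_rel_def)
  have "x ^ s * (- r * x ^ N' - - r' * x ^ N) = - (x ^ s * (r * x ^ N' - r' * x ^ N))"
    by (simp add: algebra_simps)
  then show ?thesis using s by (auto simp: loc_rel_def)
qed

instantiation loc :: (comm_ring_1) comm_ring_1
begin

lift_definition zero_loc :: "'a loc" is "\<lambda>_. (0, 0)" .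

lift_definition one_loc :: "'a loc" is "\<lambda>_. (1, 0)" .

lift_definition plus_loc :: "'a loc \<Rightarrow> 'a loc \<Rightarrow> 'a loc" is
  "\<lambda>f g x. (fst (f x) * x ^ snd (g x) + fst (g x) * x ^ snd (f x), snd (f x) + snd (g x))"
  by (auto intro!: loc_rel_add)

lift_definition times_loc :: "'a loc \<Rightarrow> 'a loc \<Rightarrow> 'a loc" is
  "\<lambda>f g x. (fst (f x) * fst (g x), snd (f x) + snd (g x))"
  by (auto intro!: loc_rel_mult)

lift_definition uminus_loc :: "'a loc \<Rightarrow> 'a loc" is "\<lambda>f x. (- fst (f x), snd (f x))"
  by (auto intro!: loc_rel_uminus)

definition minus_loc :: "'a loc \<Rightarrow> 'a loc \<Rightarrow> 'a loc" where "minus_loc a b = a + - b"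

instance
proof
  fix a b c :: "'a loc"
  show "a + b + c = a + (b + c)" "a + b = b + a" "0 + a = a" "- a + a = 0"
    "a * b * c = a * (b * c)" "a * b = b * a" "1 * a = a" "(a + b) * c = a * c + b * c"
    by (transfer; intro allI loc_rel_eq; simp add: power_add algebra_simps)+
  show "a - b = a + - b" by (simp add: minus_loc_def)
  have "\<not> loc_rel (1::'a) (0, 0) (1, 0)" by (simp add: loc_rel_def)
  then show "(0 :: 'a loc) \<noteq> 1" by transfer blast
qed

end

lemma loc_rel_vanishing:
  assumes "loc_rel x c d" "x ^ t * fst c = 0" shows "\<exists>t. x ^ t * fst d = 0"
proof -
  obtain s where s: "x ^ s * (fst c * x ^ snd d - fst d * x ^ snd c) = 0"
    using assms by (auto simp: loc_rel_def)
  have "x ^ (s + t + snd c) * fst d = x ^ s * x ^ snd d * (x ^ t * fst c) -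
      x ^ t * (x ^ s * (fst c * x ^ snd d - fst d * x ^ snd c))"
    by (simp add: power_add algebra_simps)
  then show ?thesis using s assms(2) by (intro exI[of _ "s + t + snd c"]) simp
qed

lift_definition zero_at :: "'a::comm_ring_1 \<Rightarrow> 'a loc \<Rightarrow> bool" is "\<lambda>x f. \<exists>t. x ^ t * fst (f x) = 0"
  using loc_rel_vanishing loc_rel_sym by blast

lemma loc_eq_0_iff: "s = 0 \<longleftrightarrow> (\<forall>x. zero_at x s)"
  by transfer (simp add: loc_rel_def)

text \<open>Components outside X are set to 0, so that only the open sets D(x) with x in X matter;
  the image of 1 is then an idempotent.\<close>

lift_definition loc_incl :: "'a::comm_ring_1 set \<Rightarrow> 'a \<Rightarrow> 'a loc" is
  "\<lambda>X r x. (if x \<in> X then r else 0, 0)" .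

lemma rhom_loc_incl: "rhom (loc_incl X)"
  unfolding rhom_def by (intro allI conjI; transfer; simp add: loc_rel_eq)

lemma zero_at_loc_incl: "zero_at x (loc_incl X r) \<longleftrightarrow> x \<notin> X \<or> (\<exists>t. x ^ t * r = 0)"
  by transfer auto

lemma loc_incl_mult_eq_iff:
  "loc_incl X a * abs_loc f = loc_incl X b \<longleftrightarrow>
    (\<forall>x\<in>X. \<exists>t. x ^ t * (a * fst (f x) - b * x ^ snd (f x)) = 0)"
  unfolding loc_incl_def times_loc.abs_eq map_fun_def
  by (auto simp: loc_incl.abs_eq times_loc.abs_eq loc.abs_eq_iff loc_rel_def)

lemma zero_at_outside: "x \<notin> X \<Longrightarrow> zero_at x (loc_incl X r * s)"
  by transfer auto

lemma zero_at_scale: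
  assumes "x \<in> X" "zero_at x (loc_incl X (x ^ n) * s)" shows "zero_at x s"
  using assms
proof (transfer fixing: x X n)
  fix s :: "'a \<Rightarrow> 'a \<times> nat"
  assume "x \<in> X" "\<exists>t. x ^ t * fst (fst (if x \<in> X then x ^ n else 0, 0::nat) * fst (s x),
    snd (if x \<in> X then x ^ n else 0, 0::nat) + snd (s x)) = 0"
  then obtain t where "x ^ t * (x ^ n * fst (s x)) = 0" by auto
  then have "x ^ (t + n) * fst (s x) = 0" by (simp add: power_add mult.assoc)
  then show "\<exists>t. x ^ t * fst (s x) = 0" by blast
qed

lemma of_nat_loc: "of_nat n = abs_loc (\<lambda>_::'a::comm_ring_1. (of_nat n, 0))"
  by (induction n) (simp_all add: zero_loc.abs_eq one_loc.abs_eq plus_loc.abs_eq zero_loc_def one_loc_def)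

text \<open>That x^N s comes from a single r in R says that the component at every y in X agrees
  with r / x^N on D(x y); this encodes compatibility on overlaps.\<close>

definition loc_sections :: "'a::comm_ring_1 set \<Rightarrow> 'a loc set" where
  "loc_sections X = {s. loc_incl X 1 * s = s \<and>
    (\<exists>N. \<forall>x\<in>X. loc_incl X (x ^ N) * s \<in> range (loc_incl X))}"

lemma loc_incl_simps:
  "loc_incl X (a + b) = loc_incl X a + loc_incl X b" "loc_incl X (a * b) = loc_incl X a * loc_incl X b"
  "loc_incl X (a - b) = loc_incl X a - loc_incl X b" "loc_incl X 0 = 0"
  using rhom_loc_incl[of X] by (auto simp: rhom_add rhom_mult rhom_diff rhom_zero)

lemma loc_incl_power_mult:
  assumes "loc_incl X 1 * s = s" shows "loc_incl X (x ^ n) * s = loc_incl X x ^ n * s"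
  using assms rhom_power[OF rhom_loc_incl, of n X x] by (cases n) auto

lemma loc_sections_denominator:
  assumes "\<forall>x\<in>X. loc_incl X (x ^ N) * s \<in> range (loc_incl X)" "N \<le> M" "x \<in> X"
  shows "loc_incl X (x ^ M) * s \<in> range (loc_incl X)"
proof -
  obtain r where "loc_incl X (x ^ N) * s = loc_incl X r" using assms by blast
  then have "loc_incl X (x ^ (M - N) * x ^ N) * s = loc_incl X (x ^ (M - N) * r)"
    by (simp only: loc_incl_simps mult.assoc)
  moreover have "x ^ (M - N) * x ^ N = x ^ M" using assms(2) by (simp add: power_add[symmetric])
  ultimately show ?thesis by simp
qed

lemma submod_loc_sections: "submod (loc_incl X) (loc_sections X)"
  unfolding submod_def
proof (intro conjI ballI allI)
  have "loc_incl X r * 0 = loc_incl X 0" for r by (simp add: loc_incl_simps)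
  then show "0 \<in> loc_sections X" unfolding loc_sections_def by simp
next
  fix s t assume "s \<in> loc_sections X" "t \<in> loc_sections X"
  then obtain N M where 1: "loc_incl X 1 * s = s" "loc_incl X 1 * t = t"
    and N: "\<forall>x\<in>X. loc_incl X (x ^ N) * s \<in> range (loc_incl X)"
    and M: "\<forall>x\<in>X. loc_incl X (x ^ M) * t \<in> range (loc_incl X)"
    unfolding loc_sections_def by blast
  have "loc_incl X (x ^ max N M) * (s - t) \<in> range (loc_incl X)" if x: "x \<in> X" for x
  proof -
    obtain a b where "loc_incl X (x ^ max N M) * s = loc_incl X a" "loc_incl X (x ^ max N M) * t = loc_incl X b"
      using loc_sections_denominator[OF N _ x, of "max N M"] loc_sections_denominator[OF M _ x, of "max N M"] by auto
    then have "loc_incl X (x ^ max N M) * (s - t) = loc_incl X (a - b)"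
      by (simp only: right_diff_distrib loc_incl_simps)
    then show ?thesis by simp
  qed
  then show "s - t \<in> loc_sections X" unfolding loc_sections_def using 1 by (auto simp: right_diff_distrib)
next
  fix r s assume "s \<in> loc_sections X"
  then obtain N where 1: "loc_incl X 1 * s = s"
    and N: "\<forall>x\<in>X. loc_incl X (x ^ N) * s \<in> range (loc_incl X)"
    unfolding loc_sections_def by blast
  have "loc_incl X (x ^ N) * (loc_incl X r * s) \<in> range (loc_incl X)" if x: "x \<in> X" for x
  proof -
    obtain a where a: "loc_incl X (x ^ N) * s = loc_incl X a" using N x by blast
    have "loc_incl X (x ^ N) * (loc_incl X r * s) = loc_incl X (r * a)"
      unfolding loc_incl_simps(2) a[symmetric] by (simp only: ac_simps)
    then show ?thesis by simp
  qed
  moreover have "loc_incl X 1 * (loc_incl X r * s) = loc_incl X r * s"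
    using 1 by (metis mult.left_commute)
  ultimately show "loc_incl X r * s \<in> loc_sections X" unfolding loc_sections_def by blast
qed

lemma loc_sections_mult:
  assumes "s \<in> loc_sections X" "t \<in> loc_sections X" shows "s * t \<in> loc_sections X"
proof -
  obtain N M where 1: "loc_incl X 1 * s = s" "loc_incl X 1 * t = t"
    and N: "\<forall>x\<in>X. loc_incl X (x ^ N) * s \<in> range (loc_incl X)"
    and M: "\<forall>x\<in>X. loc_incl X (x ^ M) * t \<in> range (loc_incl X)"
    using assms unfolding loc_sections_def by blast
  have "loc_incl X (x ^ (N + M)) * (s * t) \<in> range (loc_incl X)" if x: "x \<in> X" for x
  proof -
    obtain a b where ab: "loc_incl X (x ^ N) * s = loc_incl X a" "loc_incl X (x ^ M) * t = loc_incl X b"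
      using N M x by blast
    have "loc_incl X (x ^ (N + M)) * (s * t) = loc_incl X (a * b)"
      unfolding power_add loc_incl_simps(2) ab[symmetric] by (simp only: ac_simps)
    then show ?thesis by simp
  qed
  moreover have "loc_incl X 1 * (s * t) = s * t" using 1 by (simp add: mult.assoc[symmetric])
  ultimately show ?thesis unfolding loc_sections_def by blast
qed

lemma loc_incl_eq_0_iff:
  assumes "finite X"
  shows "loc_incl X r = 0 \<longleftrightarrow> (\<exists>t. \<forall>x\<in>X. x ^ t * r = 0)"
proof
  assume "loc_incl X r = 0"
  then have "\<forall>x\<in>X. \<exists>t. x ^ t * r = 0" by (simp add: loc_eq_0_iff zero_at_loc_incl)
  then obtain t where t: "\<And>x. x \<in> X \<Longrightarrow> x ^ t x * r = 0" by metis
  define u where "u = Max (insert 0 (t ` X))"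
  have "x ^ u * r = 0" if x: "x \<in> X" for x
  proof -
    have "t x \<le> u" unfolding u_def using assms x by (intro Max_ge) auto
    then have "x ^ u * r = x ^ (u - t x) * (x ^ t x * r)"
      by (simp add: mult.assoc[symmetric] power_add[symmetric])
    then show ?thesis using t[OF x] by simp
  qed
  then show "\<exists>t. \<forall>x\<in>X. x ^ t * r = 0" by blast
next
  assume "\<exists>t. \<forall>x\<in>X. x ^ t * r = 0"
  then show "loc_incl X r = 0" by (auto simp: loc_eq_0_iff zero_at_loc_incl)
qed

lemma loc_sections_separated:
  assumes "s \<in> loc_sections X" "\<And>x. x \<in> X \<Longrightarrow> loc_incl X x ^ N * s = 0"
  shows "s = 0"
proof -
  have 1: "loc_incl X 1 * s = s" using assms(1) by (simp add: loc_sections_def)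
  have "zero_at x s" for x
  proof (cases "x \<in> X")
    case True
    have "loc_incl X (x ^ N) * s = 0" using assms(2)[OF True] loc_incl_power_mult[OF 1] by simp
    then have "zero_at x (loc_incl X (x ^ N) * s)" using loc_eq_0_iff by blast
    then show ?thesis by (rule zero_at_scale[OF True])
  next
    case False
    then show ?thesis using zero_at_outside[of x X 1 s] 1 by simp
  qed
  then show ?thesis by (simp add: loc_eq_0_iff)
qed

lemma loc_sections_glue:
  assumes "cech_cocycle xs (r, N)"
  shows "\<exists>s\<in>loc_sections (set xs). \<exists>t. \<forall>i<length xs.
    loc_incl (set xs) (xs ! i) ^ t * (loc_incl (set xs) (xs ! i) ^ N * s - loc_incl (set xs) (r i)) = 0"
proof -
  let ?\<phi> = "loc_incl (set xs)"
  have "\<forall>i j. \<exists>t. i < length xs \<longrightarrow> j < length xs \<longrightarrow>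
      (xs ! i * xs ! j) ^ t * (r i * (xs ! j) ^ N - r j * (xs ! i) ^ N) = 0"
    using assms unfolding cech_cocycle_def by auto
  then obtain t where t: "\<And>i j. i < length xs \<Longrightarrow> j < length xs \<Longrightarrow>
      (xs ! i * xs ! j) ^ t i j * (r i * (xs ! j) ^ N - r j * (xs ! i) ^ N) = 0" by metis
  \<comment> \<open>The cocycle condition gives one exponent per pair; a common one yields the
    uniform denominator x_i^(u + N).\<close>
  define u where "u = Max (insert 0 ((\<lambda>(i, j). t i j) ` ({..<length xs} \<times> {..<length xs})))"
  have u: "(xs ! i * xs ! j) ^ u * (r i * (xs ! j) ^ N - r j * (xs ! i) ^ N) = 0"
    if ij: "i < length xs" "j < length xs" for i j
  proof -
    have "t i j \<le> u" unfolding u_def using ij by (intro Max_ge) (auto intro!: image_eqI[of _ _ "(i, j)"])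
    then have "(xs ! i * xs ! j) ^ u = (xs ! i * xs ! j) ^ (u - t i j) * (xs ! i * xs ! j) ^ t i j"
      by (simp add: power_add[symmetric])
    then show ?thesis using t[OF ij] by (simp add: mult.assoc)
  qed
  \<comment> \<open>A generator may occur several times in \<open>xs\<close>; its component is read
    off at one chosen position, and the cocycle condition makes the other positions agree with
    it.\<close>
  define idx where "idx x = (SOME i. i < length xs \<and> xs ! i = x)" for x
  have idx: "idx x < length xs \<and> xs ! idx x = x" if "x \<in> set xs" for x
    unfolding idx_def by (rule someI_ex) (use that in \<open>auto simp: in_set_conv_nth\<close>)
  define f where "f x = (r (idx x), N)" for x
  define s where "s = ?\<phi> 1 * abs_loc f"
  have s1: "?\<phi> 1 * s = s"
    unfolding s_def by (simp add: mult.assoc[symmetric] loc_incl_simps(2)[symmetric])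
  have num: "?\<phi> (xs ! i ^ (u + N)) * s = ?\<phi> (xs ! i ^ u * r i)" if i: "i < length xs" for i
  proof -
    have "?\<phi> (xs ! i ^ (u + N)) * s = ?\<phi> (xs ! i ^ (u + N)) * abs_loc f"
      unfolding s_def by (simp add: mult.assoc[symmetric] loc_incl_simps(2)[symmetric])
    also have "\<dots> = ?\<phi> (xs ! i ^ u * r i)"
      unfolding loc_incl_mult_eq_iff
    proof
      fix x assume x: "x \<in> set xs"
      have "(x * xs ! i) ^ u * (r (idx x) * (xs ! i) ^ N - r i * x ^ N) = 0"
        using u[of "idx x" i] idx[OF x] i by simp
      then show "\<exists>t. x ^ t * (xs ! i ^ (u + N) * fst (f x) - xs ! i ^ u * r i * x ^ snd (f x)) = 0"
        by (intro exI[of _ u]) (simp add: f_def power_mult_distrib power_add algebra_simps)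
    qed
    finally show ?thesis .
  qed
  have "?\<phi> (x ^ (u + N)) * s \<in> range ?\<phi>" if "x \<in> set xs" for x
    using num idx[OF that] by (metis rangeI)
  then have "s \<in> loc_sections (set xs)" unfolding loc_sections_def using s1 by blast
  moreover have "?\<phi> (xs ! i) ^ u * (?\<phi> (xs ! i) ^ N * s - ?\<phi> (r i)) = 0" if i: "i < length xs" for i
  proof -
    have "?\<phi> 1 * ?\<phi> (r i) = ?\<phi> (r i)" by (simp add: loc_incl_simps(2)[symmetric])
    then have "?\<phi> (xs ! i ^ u * r i) = ?\<phi> (xs ! i) ^ u * ?\<phi> (r i)"
      unfolding loc_incl_simps(2) by (rule loc_incl_power_mult)
    moreover have "?\<phi> (xs ! i ^ (u + N)) * s = ?\<phi> (xs ! i) ^ u * (?\<phi> (xs ! i) ^ N * s)"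
      unfolding loc_incl_power_mult[OF s1] by (simp add: power_add mult.assoc)
    ultimately show ?thesis using num[OF i] by (simp add: right_diff_distrib)
  qed
  ultimately show ?thesis by blast
qed

theorem theorem1p2:
  fixes m K :: "'a::comm_ring_1 set" and p :: nat and xs :: "'a list"
  assumes "noetherian_ring TYPE('a)"
    and "local_ring m"
    and "madic_complete m"
    and "positive_dim TYPE('a)"
    and "coefficient_field m K"
    and "alg_closed_subfield K"
    and "prime p" and "of_nat p = (0::'a)"
    and "m = ideal_gen xs"
  shows "\<exists>n. cech_dim_eq xs K (frob_stable_part xs p) n \<and>
             card (connected_components_of (zariski_punctured m)) = 1 + n"
proof -
  let ?\<phi> = "loc_incl (set xs)" and ?S = "loc_sections (set xs)"
  have one: "?\<phi> 1 * ?\<phi> r = ?\<phi> r" for r by (simp add: loc_incl_simps(2)[symmetric])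
  interpret punctured_sections m K p xs ?\<phi> ?S
  proof unfold_locales
    show "of_nat p = (0 :: 'a loc)"
      unfolding of_nat_loc assms(8) zero_loc_def by simp
    show "range ?\<phi> \<subseteq> ?S"
    proof
      fix s assume "s \<in> range ?\<phi>"
      then obtain r where s: "s = ?\<phi> r" by blast
      have "?\<phi> (x ^ 0) * s \<in> range ?\<phi>" for x using one s by simp
      then show "s \<in> ?S" unfolding loc_sections_def using one s by blast
    qed
    show "?\<phi> 1 * s = s" if "s \<in> ?S" for s using that by (simp add: loc_sections_def)
    show "\<exists>N. \<forall>x\<in>set xs. ?\<phi> x ^ N * s \<in> range ?\<phi>" if s: "s \<in> ?S" for s
    proof -
      have 1: "?\<phi> 1 * s = s" using s by (simp add: loc_sections_def)
      show ?thesis using s unfolding loc_sections_def loc_incl_power_mult[OF 1, symmetric] by blast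
    qed
    \<comment> \<open>Positive dimension enters here: if \<phi> 1 = 0, the generators of m are
      nilpotent and m lies in every prime, which leaves no room for P \<subset> Q.\<close>
    show "?\<phi> 1 \<noteq> 0"
    proof
      assume "?\<phi> 1 = 0"
      then obtain t where t: "\<forall>x\<in>set xs. x ^ t = 0" unfolding loc_incl_eq_0_iff[OF finite_set] by auto
      obtain P Q :: "'a set" where PQ: "prime_ideal P" "prime_ideal Q" "P \<subset> Q"
        using assms(4) by (auto simp: positive_dim_def)
      have "set xs \<subseteq> P"
        using t prime_ideal_power_iff[OF PQ(1), of _ t] ideal_zero[OF prime_ideal_is_ideal[OF PQ(1)]] by fastforce
      then have "m \<subseteq> P" using ideal_gen_subset[OF prime_ideal_is_ideal[OF PQ(1)]] assms(9) by blast
      moreover have "Q \<subseteq> m" using local_ring_ideal_subset[OF assms(2)] PQ(2) by (simp add: prime_ideal_def)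
      ultimately show False using PQ(3) by blast
    qed
  qed (fact assms rhom_loc_incl submod_loc_sections loc_sections_mult loc_sections_separated
      loc_incl_eq_0_iff[OF finite_set] loc_sections_glue)+
  show ?thesis by (rule cech_dim_components)
qed

end
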